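(* Let $n,m\ge 1$, let $D\subset\mathbb{R}^n$ be an open set, and let $f=(f^1,\dots,f^m):D\to\mathbb{R}^m$ be a $C^2$ solution of the minimal surface system, so that its graph $\Sigma=\{(x,f(x)):x\in D\}\subset\mathbb{R}^{n+m}$ is a minimal submanifold of dimension $n$ and codimension $m$. If the normal bundle of $\Sigma$ is flat, then $\Sigma$ is stable.
   Context: Minimal surface system: $f=(f^1,\dots,f^m)$ is a solution if $\sum_{i,j=1}^n\frac{\partial}{\partial x^i}\left(\sqrt{g}\,g^{ij}\frac{\partial f^\alpha}{\partial x^j}\right)=0$ for each $\alpha=1,\dots,m$, where $g_{ij}=\delta_{ij}+\sum_{\beta=1}^m\frac{\partial f^\beta}{\partial x^i}\frac{\partial f^\beta}{\partial x^j}$, $(g^{ij})=(g_{ij})^{-1}$ and $g=\det(g_{ij})$. The graph of a solution is called a minimal graph; it is a minimal submanifold of $\mathbb{R}^{n+m}$. Flat normal bundle: near a point of $\Sigma$ choose an orthonormal frame $e_1,\dots,e_n$ of the tangent bundle and $e_{n+1},\dots,e_{n+m}$ of the normal bundle. The coefficients of the second fundamental form are $h_{\alpha ij}=\langle\nabla_{e_i}e_\alpha,e_j\rangle$, where $\nabla$ is the flat connection of $\mathbb{R}^{n+m}$. By the Ricci equation the curvature of the normal bundle is $R_{\alpha\beta ij}=\sum_{k}(h_{\alpha ik}h_{\beta jk}-h_{\alpha jk}h_{\beta ik})$. $\Sigma$ has flat normal bundle if $R_{\alpha\beta ij}\equiv 0$ for all $\alpha,\beta,i,j$. Stable: a minimal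 submanifold is stable if the second variation of the volume functional is non-negative with respect to every compactly supported variation field. For a minimal submanifold $\Sigma$ of $\mathbb{R}^{n+m}$ this is equivalent to $\int_\Sigma\sum_{i,j}\langle\nabla_{e_i}e_j,V\rangle^2\le\int_\Sigma\sum_i|(\nabla_{e_i}V)^\perp|^2$ for every compactly supported section $V$ of the normal bundle, where $(\cdot)^\perp$ denotes projection onto the normal space. *)

theory Defs
  imports "HOL-Analysis.Analysis"
begin

section \<open>Differentiability classes\<close>

definition partial_deriv :: "'n \<Rightarrow> (real ^ 'n \<Rightarrow> 'e::real_normed_vector) \<Rightarrow> real ^ 'n \<Rightarrow> 'e"
  where "partial_deriv i u x = frechet_derivative u (at x) (axis i 1)"

definition C1_on :: "(real ^ 'n) set \<Rightarrow> (real ^ 'n \<Rightarrow> 'e::real_normed_vector) \<Rightarrow> bool"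
  where "C1_on D u \<longleftrightarrow>
    (\<forall>x\<in>D. u differentiable (at x)) \<and> (\<forall>i. continuous_on D (partial_deriv i u))"

definition C2_on :: "(real ^ 'n) set \<Rightarrow> (real ^ 'n \<Rightarrow> 'e::real_normed_vector) \<Rightarrow> bool"
  where "C2_on D u \<longleftrightarrow> C1_on D u \<and> (\<forall>i. C1_on D (partial_deriv i u))"

section \<open>The minimal surface system\<close>

definition metric :: "(real ^ 'n \<Rightarrow> real ^ 'm) \<Rightarrow> real ^ 'n \<Rightarrow> real ^ 'n ^ 'n"
  where "metric f x = (\<chi> i j. (if i = j then 1 else 0) +
    (\<Sum>\<beta>\<in>UNIV. partial_deriv i (\<lambda>y. f y $ \<beta>) x * partial_deriv j (\<lambda>y. f y $ \<beta>) x))"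

definition minimal_surface_system :: "(real ^ 'n) set \<Rightarrow> (real ^ 'n \<Rightarrow> real ^ 'm) \<Rightarrow> bool"
  where "minimal_surface_system D f \<longleftrightarrow>
    (\<forall>x\<in>D. \<forall>\<alpha>. (\<Sum>i\<in>UNIV. \<Sum>j\<in>UNIV.
      partial_deriv i (\<lambda>y. sqrt (det (metric f y)) * matrix_inv (metric f y) $ i $ j
        * partial_deriv j (\<lambda>z. f z $ \<alpha>) y) x) = 0)"

section \<open>The graph and its normal bundle\<close>

text \<open>The ambient space of dimension \<open>n + m\<close> is the product
  \<^typ>\<open>(real ^ 'n) \<times> (real ^ 'm)\<close> with its Euclidean inner product. A vector field along the
  graph over \<open>D\<close> is given as a function of the base point \<open>x \<in> D\<close>.\<close>

definition graph_map :: "(real ^ 'n \<Rightarrow> real ^ 'm) \<Rightarrow> real ^ 'n \<Rightarrow> (real ^ 'n) \<times> (real ^ 'm)"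
  where "graph_map f x = (x, f x)"

definition tangent_space ::
    "(real ^ 'n \<Rightarrow> real ^ 'm) \<Rightarrow> real ^ 'n \<Rightarrow> ((real ^ 'n) \<times> (real ^ 'm)) set"
  where "tangent_space f x = range (frechet_derivative (graph_map f) (at x))"

definition normal_space ::
    "(real ^ 'n \<Rightarrow> real ^ 'm) \<Rightarrow> real ^ 'n \<Rightarrow> ((real ^ 'n) \<times> (real ^ 'm)) set"
  where "normal_space f x = {v. \<forall>w\<in>tangent_space f x. v \<bullet> w = 0}"

text \<open>The flat derivative of the field \<open>u\<close> along the graph in the tangent direction \<open>v\<close> at
  \<open>(x, f x)\<close>. A tangent vector has the form \<open>v = (w, Df(x) w)\<close>, so it is the velocity of the lift
  of the curve \<open>x + t w\<close>, where \<open>w = fst v\<close>.\<close>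

definition nabla ::
    "(real ^ 'n \<Rightarrow> (real ^ 'n) \<times> (real ^ 'm)) \<Rightarrow> real ^ 'n \<Rightarrow> (real ^ 'n) \<times> (real ^ 'm)
      \<Rightarrow> (real ^ 'n) \<times> (real ^ 'm)"
  where "nabla u x v = frechet_derivative u (at x) (fst v)"

definition orthonormal_frame ::
    "(real ^ 'n) set \<Rightarrow> (real ^ 'n \<Rightarrow> real ^ 'm)
      \<Rightarrow> ('n \<Rightarrow> real ^ 'n \<Rightarrow> (real ^ 'n) \<times> (real ^ 'm))
      \<Rightarrow> ('m \<Rightarrow> real ^ 'n \<Rightarrow> (real ^ 'n) \<times> (real ^ 'm)) \<Rightarrow> bool"
  where "orthonormal_frame U f e \<nu> \<longleftrightarrow>
    (\<forall>i. C1_on U (e i)) \<and> (\<forall>\<alpha>. C1_on U (\<nu> \<alpha>)) \<and>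
    (\<forall>x\<in>U.
      (\<forall>i. e i x \<in> tangent_space f x) \<and>
      (\<forall>i j. e i x \<bullet> e j x = (if i = j then 1 else 0)) \<and>
      (\<forall>\<alpha>. \<nu> \<alpha> x \<in> normal_space f x) \<and>
      (\<forall>\<alpha> \<beta>. \<nu> \<alpha> x \<bullet> \<nu> \<beta> x = (if \<alpha> = \<beta> then 1 else 0)))"

definition second_fundamental ::
    "('n \<Rightarrow> real ^ 'n \<Rightarrow> (real ^ 'n) \<times> (real ^ 'm))
      \<Rightarrow> ('m \<Rightarrow> real ^ 'n \<Rightarrow> (real ^ 'n) \<times> (real ^ 'm))
      \<Rightarrow> real ^ 'n \<Rightarrow> 'm \<Rightarrow> 'n \<Rightarrow> 'n \<Rightarrow> real"
  where "second_fundamental e \<nu> x \<alpha> i j = nabla (\<nu> \<alpha>) x (e i x) \<bullet> e j x"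

definition normal_curvature ::
    "('n \<Rightarrow> real ^ 'n \<Rightarrow> (real ^ 'n) \<times> (real ^ 'm))
      \<Rightarrow> ('m \<Rightarrow> real ^ 'n \<Rightarrow> (real ^ 'n) \<times> (real ^ 'm))
      \<Rightarrow> real ^ 'n \<Rightarrow> 'm \<Rightarrow> 'm \<Rightarrow> 'n \<Rightarrow> 'n \<Rightarrow> real"
  where "normal_curvature e \<nu> x \<alpha> \<beta> i j =
    (let h = second_fundamental e \<nu> x
     in \<Sum>k\<in>UNIV. h \<alpha> i k * h \<beta> j k - h \<alpha> j k * h \<beta> i k)"

text \<open>The normal curvature is tensorial and local frames always exist, so it does not matter
  which frame is chosen near a point.\<close>

definition flat_normal_bundle :: "(real ^ 'n) set \<Rightarrow> (real ^ 'n \<Rightarrow> real ^ 'm) \<Rightarrow> bool"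
  where "flat_normal_bundle D f \<longleftrightarrow>
    (\<forall>p\<in>D. \<exists>U e \<nu>. open U \<and> p \<in> U \<and> U \<subseteq> D \<and> orthonormal_frame U f e \<nu> \<and>
      (\<forall>x\<in>U. \<forall>\<alpha> \<beta> i j. normal_curvature e \<nu> x \<alpha> \<beta> i j = 0))"

section \<open>Second variation of volume and stability\<close>

definition induced_metric :: "(real ^ 'n \<Rightarrow> 'e::euclidean_space) \<Rightarrow> real ^ 'n \<Rightarrow> real ^ 'n ^ 'n"
  where "induced_metric X x = (\<chi> i j. partial_deriv i X x \<bullet> partial_deriv j X x)"

definition volume :: "(real ^ 'n) set \<Rightarrow> (real ^ 'n \<Rightarrow> 'e::euclidean_space) \<Rightarrow> real"
  where "volume K X = integral K (\<lambda>x. sqrt (det (induced_metric X x)))"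

definition C1_family ::
    "real set \<Rightarrow> (real ^ 'n) set \<Rightarrow> (real \<Rightarrow> real ^ 'n \<Rightarrow> 'e::real_normed_vector) \<Rightarrow> bool"
  where "C1_family I D F \<longleftrightarrow>
    (\<forall>t\<in>I. \<forall>x\<in>D. F t differentiable (at x)) \<and>
    continuous_on (I \<times> D) (\<lambda>(t, x). F t x) \<and>
    (\<forall>i. continuous_on (I \<times> D) (\<lambda>(t, x). partial_deriv i (F t) x))"

text \<open>A variation of the immersion \<open>X\<close> of \<open>D\<close> that is fixed outside the compact set \<open>K\<close>. Its
  variation field \<open>F' 0\<close> need not be normal. The regularity asked for is that \<open>t \<mapsto> F t\<close> is twice
  continuously differentiable with values in the \<open>C1\<close> maps. This includes \<open>F t x = X x + t V x\<close>
  for every \<open>C1\<close> field \<open>V\<close> with support in \<open>K\<close>, in particular for normal fields along a \<open>C2\<close>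
  graph, which are in general no more regular than \<open>C1\<close>.\<close>

definition variation ::
    "(real ^ 'n) set \<Rightarrow> (real ^ 'n \<Rightarrow> 'e::euclidean_space) \<Rightarrow> (real ^ 'n) set
      \<Rightarrow> (real \<Rightarrow> real ^ 'n \<Rightarrow> 'e) \<Rightarrow> bool"
  where "variation D X K F \<longleftrightarrow>
    compact K \<and> K \<subseteq> D \<and> (\<forall>x\<in>D. F 0 x = X x) \<and>
    (\<exists>\<epsilon>>0. \<exists>F' F''.
      (\<forall>t\<in>{-\<epsilon><..<\<epsilon>}. \<forall>x\<in>D - K. F t x = X x) \<and>
      (\<forall>t\<in>{-\<epsilon><..<\<epsilon>}. \<forall>x\<in>D.
        ((\<lambda>s. F s x) has_vector_derivative F' t x) (at t) \<and>
        ((\<lambda>s. F' s x) has_vector_derivative F'' t x) (at t)) \<and>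
      C1_family {-\<epsilon><..<\<epsilon>} D F \<and> C1_family {-\<epsilon><..<\<epsilon>} D F' \<and> C1_family {-\<epsilon><..<\<epsilon>} D F'')"

text \<open>The second derivative at \<open>0\<close> exists and is non-negative.\<close>

definition nonneg_second_derivative_at_0 :: "(real \<Rightarrow> real) \<Rightarrow> bool"
  where "nonneg_second_derivative_at_0 A \<longleftrightarrow>
    (\<exists>A' c. (\<forall>\<^sub>F t in nhds 0. (A has_real_derivative A' t) (at t)) \<and>
      (A' has_real_derivative c) (at 0) \<and> 0 \<le> c)"

definition stable_immersion :: "(real ^ 'n) set \<Rightarrow> (real ^ 'n \<Rightarrow> 'e::euclidean_space) \<Rightarrow> bool"
  where "stable_immersion D X \<longleftrightarrow>
    (\<forall>K F. variation D X K F \<longrightarrow> nonneg_second_derivative_at_0 (\<lambda>t. volume K (F t)))"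

end

theory Submission
  imports Defs
begin

text \<open>Let \<open>X x = (x, f x)\<close>, let \<open>g\<close> be the induced metric, \<open>v = log sqrt (det g)\<close>, and let \<open>A\<close> be
  the second fundamental form. Minimality of the graph makes \<open>X\<close> a stationary point of volume in
  all ambient directions (lemma \<open>graph_stationary\<close>). Differentiating the volume of a variation
  twice under the integral sign therefore leaves a quadratic form \<open>Q\<close> in the velocity field alone.
  Tangential fields lie in the kernel of \<open>Q\<close> (lemma \<open>tangential_second_variation\<close>), so the
  velocity may be replaced by its normal part \<open>N\<close>, for which \<open>Q N\<close> is the integral of \<open>|\<nabla>N|\<^sup>2 - |A
  \<cdot> N|\<^sup>2\<close>, where \<open>\<nabla>\<close> is the connection of the normal bundle.

  The function \<open>u = exp (- v)\<close> is positive; it is the value of the form \<open>dx\<^sub>1 \<and> \<dots> \<and> dx\<^sub>n\<close> on the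
  unit tangent plane of the graph. If the normal bundle is flat, it solves \<open>\<Delta>u + |A|\<^sup>2 u = 0\<close>,
  that is, \<open>\<Delta>v = |A|\<^sup>2 + |\<nabla>v|\<^sup>2\<close>. Testing this equation with \<open>|N|\<^sup>2\<close> completes a square: \<open>Q N\<close> is
  the integral of \<open>|\<nabla>N + N \<otimes> dv|\<^sup>2 + (|A|\<^sup>2 |N|\<^sup>2 - |A \<cdot> N|\<^sup>2)\<close>, which is non-negative by the
  Cauchy-Schwarz inequality (lemma \<open>second_variation_normal_nonneg\<close>).

  Flatness enters as follows. Because the coordinates of a minimal graph are harmonic, \<open>\<Delta>v = |A|\<^sup>2
  + g\<^sup>a\<^sup>b tr (\<Gamma>\<^sub>a \<Gamma>\<^sub>b)\<close> with the matrices \<open>\<Gamma>\<^sub>a\<close> of Christoffel symbols, while \<open>|\<nabla>v|\<^sup>2 = g\<^sup>a\<^sup>b tr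
  \<Gamma>\<^sub>a tr \<Gamma>\<^sub>b\<close>. All second derivatives of \<open>X\<close> are vertical, and for vertical vectors the tangential
  part is a linear function of the normal part; so the Christoffel symbols are linear in \<open>A\<close>, and
  the two traces agree once the shape operators commute (lemma \<open>flat_normal_bundle_hess\<close>).

  As \<open>f\<close> is only \<open>C2\<close>, the function \<open>v\<close> is only \<open>C1\<close>, and no third derivatives of \<open>f\<close> are
  available. The equation of \<open>v\<close> and the Jacobi equation of tangential fields are used in weak
  form; both come from the identity \<open>\<integral> \<partial>\<^sub>i T \<bullet> \<partial>\<^sub>j S = \<integral> \<partial>\<^sub>j T \<bullet> \<partial>\<^sub>i S\<close> for \<open>C1\<close> functions, one of
  them with compact support (lemma \<open>integral_partial_deriv_swap\<close>). For the equation of \<open>v\<close>, it is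
  applied with \<open>T\<close> the gradient of the area integrand and \<open>S\<close> a multiple of the dual frame.\<close>

section \<open>Derivatives of the determinant and of the inverse matrix\<close>

lemma matrix_inv_mult:
  fixes A :: "real ^ 'n ^ 'n"
  assumes "det A \<noteq> 0"
  shows "A ** matrix_inv A = mat 1" and "matrix_inv A ** A = mat 1"
proof -
  have "\<exists>B. A ** B = mat 1 \<and> B ** A = mat 1"
    using assms by (simp add: invertible_det_nz[symmetric] invertible_def)
  from someI_ex[OF this] show "A ** matrix_inv A = mat 1" "matrix_inv A ** A = mat 1"
    by (auto simp: matrix_inv_def)
qed

lemma det_pos_if_positive_definite:
  fixes A :: "real ^ 'n ^ 'n"
  assumes "\<And>x. x \<noteq> 0 \<Longrightarrow> 0 < x \<bullet> (A *v x)"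
  shows "0 < det A"
proof (rule ccontr)
  assume neg: "\<not> 0 < det A"
  define B where "B s = (\<chi> i j. (1 - s) * (mat 1 :: real ^ 'n ^ 'n) $ i $ j + s * A $ i $ j)"
      for s :: real
  have Bx: "B s *v x = (1 - s) *\<^sub>R x + s *\<^sub>R (A *v x)" for s x
  proof -
    have "B s = (1 - s) *\<^sub>R mat 1 + s *\<^sub>R A"
      by (simp add: B_def vec_eq_iff)
    then show ?thesis
      by (simp add: matrix_vector_mult_add_rdistrib scaleR_matrix_vector_assoc[symmetric])
  qed
  \<comment> \<open>The determinant has no zero on the segment from the identity matrix to \<open>A\<close>.\<close>
  have nz: "det (B s) \<noteq> 0" if "0 \<le> s" "s \<le> 1" for s
  proof
    assume "det (B s) = 0"
    then obtain x where x: "B s *v x = 0" "x \<noteq> 0"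
      using invertible_det_nz[of "B s"] invertible_left_inverse matrix_left_invertible_ker
      by blast
    have "x \<bullet> (B s *v x) = (1 - s) * (x \<bullet> x) + s * (x \<bullet> (A *v x))"
      by (simp add: Bx inner_add_right)
    also have "\<dots> > 0"
    proof (cases "s = 0")
      case False
      then have "0 < s * (x \<bullet> (A *v x))" using that x assms by simp
      moreover have "0 \<le> (1 - s) * (x \<bullet> x)" using that by simp
      ultimately show ?thesis by linarith
    qed (use x in simp)
    finally show False using x by simp
  qed
  have "continuous_on {0..1} (\<lambda>s. det (B s))"
    unfolding det_def B_def by (simp, intro continuous_intros)
  moreover have B0: "B 0 = mat 1" and B1: "B 1 = A"
    by (simp_all add: B_def vec_eq_iff)
  ultimately obtain s where "0 \<le> s" "s \<le> 1" "det (B s) = 0"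
    using IVT2'[of "\<lambda>s. det (B s)" 1 0 0] neg by auto
  with nz show False by blast
qed

lemma has_derivative_vec_nth2:
  fixes A :: "real ^ 'n ^ 'm"
  shows "((\<lambda>M. M $ i $ j) has_derivative (\<lambda>H. H $ i $ j)) (at A)"
proof -
  have "bounded_linear (\<lambda>M :: real ^ 'n ^ 'm. M $ i $ j)"
    using bounded_linear_compose[OF bounded_linear_vec_nth[of j] bounded_linear_vec_nth[of i]]
    by (simp add: o_def)
  then show ?thesis by (rule bounded_linear_imp_has_derivative)
qed

lemma has_derivative_componentwise_matrix:
  fixes f :: "'a::euclidean_space \<Rightarrow> real ^ 'n ^ 'm"
  assumes "\<And>i j. ((\<lambda>x. f x $ i $ j) has_derivative (\<lambda>h. f' h $ i $ j)) (at x)"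
  shows "(f has_derivative f') (at x)"
proof (subst has_derivative_componentwise_within, intro ballI)
  fix b :: "real ^ 'n ^ 'm" assume "b \<in> Basis"
  then obtain i j where b: "b = axis i (axis j 1)"
    by (auto simp: Basis_vec_def)
  show "((\<lambda>x. f x \<bullet> b) has_derivative (\<lambda>h. f' h \<bullet> b)) (at x)"
    using assms[of i j] by (simp add: b inner_axis)
qed

text \<open>Jacobi's formula. The Leibniz rule gives a sum of determinants in each of which one row of
  \<open>A\<close> has been replaced by the corresponding row of \<open>H = (H A\<inverse>) A\<close>; Cramer's rule evaluates them.\<close>

lemma has_derivative_det:
  fixes A :: "real ^ 'n ^ 'n"
  assumes "det A \<noteq> 0"
  shows "(det has_derivative
    (\<lambda>H. det A * (\<Sum>i\<in>UNIV. \<Sum>j\<in>UNIV. H $ i $ j * matrix_inv A $ j $ i))) (at A)"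
proof -
  define D where "D H = (\<Sum>p | p permutes (UNIV :: 'n set). of_int (sign p) *
      (\<Sum>i\<in>UNIV. H $ i $ p i * (\<Prod>j\<in>UNIV - {i}. A $ j $ p j)))" for H
  have "((\<lambda>M. \<Sum>p | p permutes (UNIV :: 'n set). of_int (sign p) * (\<Prod>i\<in>UNIV. M $ i $ p i))
      has_derivative D) (at A)"
    unfolding D_def
    by (intro has_derivative_sum has_derivative_mult_right has_derivative_prod
        has_derivative_vec_nth2)
  then have *: "(det has_derivative D) (at A)"
    by (simp add: det_def[abs_def])
  have "D H = det A * (\<Sum>i\<in>UNIV. \<Sum>j\<in>UNIV. H $ i $ j * matrix_inv A $ j $ i)" for H
  proof -
    have "D H = (\<Sum>i\<in>UNIV. \<Sum>p | p permutes (UNIV :: 'n set). of_int (sign p) *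
        (H $ i $ p i * (\<Prod>j\<in>UNIV - {i}. A $ j $ p j)))"
      unfolding D_def sum_distrib_left by (rule sum.swap)
    also have "\<dots> = (\<Sum>i\<in>UNIV. det (\<chi> k. if k = i then H $ i else A $ k))"
    proof (rule sum.cong[OF refl])
      fix i :: 'n
      have "(\<Prod>j\<in>UNIV. (\<chi> k. if k = i then H $ i else A $ k) $ j $ p j)
          = H $ i $ p i * (\<Prod>j\<in>UNIV - {i}. A $ j $ p j)" for p
        by (subst prod.remove[of _ i]) (auto intro!: prod.cong)
      then show "(\<Sum>p | p permutes (UNIV :: 'n set). of_int (sign p) *
          (H $ i $ p i * (\<Prod>j\<in>UNIV - {i}. A $ j $ p j)))
          = det (\<chi> k. if k = i then H $ i else A $ k)"
        by (simp add: det_def)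
    qed
    also have "\<dots> = (\<Sum>i\<in>UNIV. (H ** matrix_inv A) $ i $ i * det A)"
    proof (rule sum.cong[OF refl])
      fix i :: 'n
      have "H $ i = ((H ** matrix_inv A) ** A) $ i"
        by (simp add: matrix_mul_assoc[symmetric] matrix_inv_mult[OF assms])
      also have "\<dots> = (\<Sum>k\<in>UNIV. (H ** matrix_inv A) $ i $ k *s row k A)"
        by (simp add: vec_eq_iff matrix_matrix_mult_def[of "H ** matrix_inv A"] row_def)
      finally have "det (\<chi> k. if k = i then H $ i else A $ k)
          = det (\<chi> k. if k = i then \<Sum>k\<in>UNIV. (H ** matrix_inv A) $ i $ k *s row k A else row k A)"
        by (intro arg_cong[of _ _ det]) (simp add: vec_eq_iff row_def)
      then show "det (\<chi> k. if k = i then H $ i else A $ k) = (H ** matrix_inv A) $ i $ i * det A"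
        by (simp add: cramer_lemma_transpose)
    qed
    also have "\<dots> = det A * (\<Sum>i\<in>UNIV. \<Sum>j\<in>UNIV. H $ i $ j * matrix_inv A $ j $ i)"
      by (simp add: matrix_matrix_mult_def sum_distrib_left sum_distrib_right mult_ac)
    finally show ?thesis .
  qed
  then have "D = (\<lambda>H. det A * (\<Sum>i\<in>UNIV. \<Sum>j\<in>UNIV. H $ i $ j * matrix_inv A $ j $ i))"
    by auto
  with * show ?thesis by simp
qed

lemma matrix_inv_cramer:
  fixes A :: "real ^ 'n ^ 'n"
  assumes "det A \<noteq> 0"
  shows "matrix_inv A $ i $ j = det (\<chi> k l. if l = i then axis j 1 $ k else A $ k $ l) / det A"
proof -
  have "A *v column j (matrix_inv A) = column j (A ** matrix_inv A)"
    by (simp add: vec_eq_iff matrix_vector_mult_def matrix_matrix_mult_def column_def)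
  also have "\<dots> = axis j 1"
    by (simp add: matrix_inv_mult[OF assms] vec_eq_iff column_def mat_def axis_def)
  finally have "column j (matrix_inv A) = (\<chi> k. det (\<chi> i l. if l = k then axis j 1 $ i else A $ i $ l) / det A)"
    by (simp add: cramer[OF assms])
  then have "column j (matrix_inv A) $ i = det (\<chi> k l. if l = i then axis j 1 $ k else A $ k $ l) / det A"
    by simp
  then show ?thesis by (simp add: column_def)
qed

lemma open_det_nonzero: "open {A :: real ^ 'n ^ 'n. det A \<noteq> 0}"
proof -
  have "continuous_on UNIV (det :: real ^ 'n ^ 'n \<Rightarrow> real)"
    unfolding det_def by (intro continuous_intros)
  then have "open (det -` (- {0}) :: (real ^ 'n ^ 'n) set)"
    by (metis open_vimage open_Compl closed_singleton)
  then show ?thesis by (simp add: vimage_def)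
qed

text \<open>Cramer's rule shows that the inverse is differentiable, and differentiating \<open>M ** matrix_inv
  M = mat 1\<close> then identifies the derivative.\<close>

lemma has_derivative_matrix_inv_nth:
  fixes A :: "real ^ 'n ^ 'n"
  assumes "det A \<noteq> 0"
  shows "((\<lambda>M. matrix_inv M $ i $ j) has_derivative
    (\<lambda>H. - (matrix_inv A ** H ** matrix_inv A) $ i $ j)) (at A)"
proof -
  let ?S = "{A :: real ^ 'n ^ 'n. det A \<noteq> 0}"
  have diff: "(\<lambda>M. matrix_inv M $ i $ j) differentiable (at A)" for i j
  proof -
    let ?C = "\<lambda>M :: real ^ 'n ^ 'n. (\<chi> k l. if l = i then axis j 1 $ k else M $ k $ l) :: real ^ 'n ^ 'n"
    have nth: "(\<lambda>M. M $ a $ b) differentiable (at A)" for a b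
      using has_derivative_vec_nth2[of a b A] by (auto simp: differentiable_def)
    have "(\<lambda>M. ?C M $ a $ b) differentiable (at A)" for a b
      by (cases "b = i") (auto simp: nth)
    then have C: "((\<lambda>M. ?C M $ a $ b) has_derivative frechet_derivative
        (\<lambda>M. ?C M $ a $ b) (at A)) (at A)" for a b
      by (simp only: frechet_derivative_works[symmetric])
    have "((\<lambda>M. \<Sum>p | p permutes (UNIV :: 'n set). of_int (sign p)
        * (\<Prod>i\<in>UNIV. ?C M $ i $ p i)) has_derivative
        (\<lambda>H. \<Sum>p | p permutes (UNIV :: 'n set). of_int (sign p) *
          (\<Sum>i\<in>UNIV. frechet_derivative (\<lambda>M. ?C M $ i $ p i) (at A) H
              * (\<Prod>j\<in>UNIV - {i}. ?C A $ j $ p j)))) (at A)"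
      by (intro has_derivative_sum has_derivative_mult_right has_derivative_prod C)
    then have "(\<lambda>M. det (?C M)) differentiable (at A)"
      unfolding det_def differentiable_def by blast
    moreover have "det differentiable (at A)"
      using has_derivative_det[OF assms] by (auto simp: differentiable_def)
    ultimately have "(\<lambda>M. det (?C M) / det M) differentiable (at A)"
      using assms by (intro differentiable_divide) auto
    then obtain D where D: "((\<lambda>M. det (?C M) / det M) has_derivative D) (at A)"
      by (auto simp: differentiable_def)
    have "((\<lambda>M. matrix_inv M $ i $ j) has_derivative D) (at A)"
      by (rule has_derivative_transform_within_open[OF D open_det_nonzero])
        (use assms in \<open>auto simp: matrix_inv_cramer\<close>)
    then show ?thesis by (auto simp: differentiable_def)
  qed
  define D where "D H = (\<chi> i j. frechet_derivative (\<lambda>M. matrix_inv M $ i $ j) (at A) H)" for H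
  have D: "((\<lambda>M. matrix_inv M $ i $ j) has_derivative (\<lambda>H. D H $ i $ j)) (at A)" for i j
    using diff[of i j] by (simp add: D_def frechet_derivative_works)
  have "A ** D H + H ** matrix_inv A = 0" for H
  proof -
    have "(A ** D H + H ** matrix_inv A) $ i $ j = 0" for i j
    proof -
      have 1: "((\<lambda>M. \<Sum>k\<in>UNIV. M $ i $ k * matrix_inv M $ k $ j) has_derivative
          (\<lambda>H. \<Sum>k\<in>UNIV. A $ i $ k * D H $ k $ j + H $ i $ k * matrix_inv A $ k $ j)) (at A)"
        by (intro has_derivative_sum has_derivative_mult has_derivative_vec_nth2 D)
      have "((\<lambda>M :: real ^ 'n ^ 'n. (mat 1 :: real ^ 'n ^ 'n) $ i $ j) has_derivative (\<lambda>H. 0)) (at A)"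
        by (rule has_derivative_const)
      then have 2: "((\<lambda>M. \<Sum>k\<in>UNIV. M $ i $ k * matrix_inv M $ k $ j) has_derivative (\<lambda>H. 0)) (at A)"
      proof (rule has_derivative_transform_within_open[OF _ open_det_nonzero])
        fix M :: "real ^ 'n ^ 'n" assume "M \<in> ?S"
        then have "M ** matrix_inv M = mat 1" by (simp add: matrix_inv_mult)
        from arg_cong[OF this, of "\<lambda>M. M $ i $ j"]
        show "(mat 1 :: real ^ 'n ^ 'n) $ i $ j = (\<Sum>k\<in>UNIV. M $ i $ k * matrix_inv M $ k $ j)"
          by (simp add: matrix_matrix_mult_def)
      qed (use assms in auto)
      show ?thesis
        using fun_cong[OF has_derivative_unique[OF 1 2], of H]
        by (simp add: matrix_matrix_mult_def sum.distrib)
    qed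
    then show ?thesis by (simp add: vec_eq_iff)
  qed
  then have "matrix_inv A ** (A ** D H + H ** matrix_inv A) = 0" for H
    by (simp add: vec_eq_iff matrix_matrix_mult_def)
  then have "D H + matrix_inv A ** H ** matrix_inv A = 0" for H
    by (simp add: matrix_add_ldistrib matrix_mul_assoc matrix_inv_mult[OF assms])
  then have "D H = - (matrix_inv A ** H ** matrix_inv A)" for H
    by (metis add_eq_0_iff2)
  with D[of i j] show ?thesis by simp
qed

section \<open>Frames, dual frames and the area integrand\<close>

text \<open>A family \<open>P\<close> of vectors indexed by \<^typ>\<open>'n\<close> stands for the columns of the differential of an
  immersion. It is linearly independent exactly when its Gram determinant is positive.\<close>

definition gram :: "('n::finite \<Rightarrow> 'e::euclidean_space) \<Rightarrow> real ^ 'n ^ 'n"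
  where "gram P = (\<chi> i j. P i \<bullet> P j)"

definition area :: "('n::finite \<Rightarrow> 'e::euclidean_space) \<Rightarrow> real"
  where "area P = sqrt (det (gram P))"

text \<open>The dual basis of the span of \<open>P\<close>; the inner products \<open>dual P i \<bullet> dual P j\<close> are the
  coefficients \<open>g\<^sup>i\<^sup>j\<close> of the inverse metric.\<close>

definition dual :: "('n::finite \<Rightarrow> 'e::euclidean_space) \<Rightarrow> 'n \<Rightarrow> 'e"
  where "dual P i = (\<Sum>k\<in>UNIV. matrix_inv (gram P) $ i $ k *\<^sub>R P k)"

text \<open>Orthogonal projection onto the orthogonal complement of the span of \<open>P\<close>.\<close>

definition nproj :: "('n::finite \<Rightarrow> 'e::euclidean_space) \<Rightarrow> 'e \<Rightarrow> 'e"
  where "nproj P w = w - (\<Sum>k\<in>UNIV. (dual P k \<bullet> w) *\<^sub>R P k)"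

text \<open>The partial gradients of the area integrand with respect to the vectors of the frame, and
  the derivative of these gradients in the direction of a family \<open>R\<close>.\<close>

definition area_grad :: "('n::finite \<Rightarrow> 'e::euclidean_space) \<Rightarrow> 'n \<Rightarrow> 'e"
  where "area_grad P j = area P *\<^sub>R dual P j"

definition dual_deriv :: "('n::finite \<Rightarrow> 'e::euclidean_space) \<Rightarrow> ('n \<Rightarrow> 'e) \<Rightarrow> 'n \<Rightarrow> 'e"
  where "dual_deriv P R j = (\<Sum>k\<in>UNIV. (dual P j \<bullet> dual P k) *\<^sub>R nproj P (R k))
    - (\<Sum>k\<in>UNIV. (dual P j \<bullet> R k) *\<^sub>R dual P k)"

definition area_hess :: "('n::finite \<Rightarrow> 'e::euclidean_space) \<Rightarrow> ('n \<Rightarrow> 'e) \<Rightarrow> 'n \<Rightarrow> 'e"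
  where "area_hess P R j = area P *\<^sub>R ((\<Sum>k\<in>UNIV. dual P k \<bullet> R k) *\<^sub>R dual P j + dual_deriv P R j)"

context
  fixes P :: "'n::finite \<Rightarrow> 'e::euclidean_space"
  assumes nondeg: "0 < det (gram P)"
begin

lemma det_gram_nz: "det (gram P) \<noteq> 0"
  using nondeg by simp

lemma area_pos: "0 < area P"
  using nondeg by (simp add: area_def)

lemma inner_dual_frame: "dual P i \<bullet> P j = (if i = j then 1 else 0)"
proof -
  have "dual P i \<bullet> P j = (matrix_inv (gram P) ** gram P) $ i $ j"
    by (simp add: dual_def inner_sum_left matrix_matrix_mult_def gram_def)
  then show ?thesis by (simp add: matrix_inv_mult[OF det_gram_nz] mat_def)
qed

lemma inner_dual_dual: "dual P i \<bullet> dual P j = matrix_inv (gram P) $ i $ j"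
proof -
  have "dual P j \<bullet> dual P i = (\<Sum>k\<in>UNIV. matrix_inv (gram P) $ i $ k * (dual P j \<bullet> P k))"
    by (subst (2) dual_def) (simp add: inner_sum_right)
  also have "\<dots> = (\<Sum>k\<in>UNIV. if j = k then matrix_inv (gram P) $ i $ k else 0)"
    by (intro sum.cong) (auto simp: inner_dual_frame)
  also have "\<dots> = matrix_inv (gram P) $ i $ j" by simp
  finally show ?thesis by (simp add: inner_commute)
qed

lemma dual_expand: "dual P i = (\<Sum>k\<in>UNIV. (dual P i \<bullet> dual P k) *\<^sub>R P k)"
  unfolding inner_dual_dual by (rule dual_def)

lemma frame_expand: "P i = (\<Sum>k\<in>UNIV. (P i \<bullet> P k) *\<^sub>R dual P k)"
proof -
  have "(\<Sum>k\<in>UNIV. (P i \<bullet> P k) *\<^sub>R dual P k)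
      = (\<Sum>k\<in>UNIV. \<Sum>l\<in>UNIV. (gram P $ i $ k * matrix_inv (gram P) $ k $ l) *\<^sub>R P l)"
    by (simp add: dual_def gram_def scaleR_sum_right)
  also have "\<dots> = (\<Sum>l\<in>UNIV. (gram P ** matrix_inv (gram P)) $ i $ l *\<^sub>R P l)"
    by (subst sum.swap) (simp add: matrix_matrix_mult_def scaleR_sum_left)
  also have "\<dots> = (\<Sum>l\<in>UNIV. if i = l then P l else 0)"
    by (intro sum.cong) (auto simp: matrix_inv_mult[OF det_gram_nz] mat_def)
  finally show ?thesis by simp
qed

lemma nproj_inner_frame: "nproj P w \<bullet> P j = 0"
proof -
  have "(\<Sum>k\<in>UNIV. (dual P k \<bullet> w) * (P k \<bullet> P j)) = w \<bullet> P j"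
    using arg_cong[OF frame_expand[of j], of "\<lambda>v. w \<bullet> v"]
    by (simp add: inner_sum_right inner_commute mult.commute)
  then show ?thesis by (simp add: nproj_def inner_diff_left inner_sum_left)
qed

lemma nproj_inner_dual: "nproj P w \<bullet> dual P j = 0"
  by (subst dual_expand) (simp add: inner_sum_right nproj_inner_frame)

lemma nproj_inner_nproj: "nproj P w \<bullet> nproj P z = nproj P w \<bullet> z"
  by (subst (2) nproj_def) (simp add: inner_diff_right inner_sum_right nproj_inner_frame)

lemma nproj_frame: "nproj P (P i) = 0"
proof -
  have "(\<Sum>k\<in>UNIV. (dual P k \<bullet> P i) *\<^sub>R P k) = (\<Sum>k\<in>UNIV. if k = i then P k else 0)"
    by (intro sum.cong) (auto simp: inner_dual_frame)
  then show ?thesis by (simp add: nproj_def)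
qed

text \<open>If \<open>R\<close> and \<open>S\<close> are the differentials of two variation fields, this is the bilinear form of
  the second variation of the area integrand: the inner product of the normal parts, and an
  antisymmetrised product of the tangential parts.\<close>

lemma sum_area_hess_inner:
  "(\<Sum>j\<in>UNIV. area_hess P R j \<bullet> S j) = area P *
    ((\<Sum>i\<in>UNIV. \<Sum>j\<in>UNIV. (dual P i \<bullet> dual P j) * (nproj P (R i) \<bullet> nproj P (S j)))
     + (\<Sum>i\<in>UNIV. dual P i \<bullet> R i) * (\<Sum>j\<in>UNIV. dual P j \<bullet> S j)
     - (\<Sum>i\<in>UNIV. \<Sum>j\<in>UNIV. (dual P i \<bullet> R j) * (dual P j \<bullet> S i)))"
proof -
  have 1: "(\<Sum>j\<in>UNIV. (\<Sum>k\<in>UNIV. (dual P j \<bullet> dual P k) *\<^sub>R nproj P (R k)) \<bullet> S j)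
      = (\<Sum>i\<in>UNIV. \<Sum>j\<in>UNIV. (dual P i \<bullet> dual P j) * (nproj P (R i) \<bullet> nproj P (S j)))"
    unfolding inner_sum_left
    by (subst sum.swap) (simp add: nproj_inner_nproj inner_commute[of "dual P _" "dual P _"])
  have 2: "(\<Sum>j\<in>UNIV. (\<Sum>k\<in>UNIV. (dual P j \<bullet> R k) *\<^sub>R dual P k) \<bullet> S j)
      = (\<Sum>i\<in>UNIV. \<Sum>j\<in>UNIV. (dual P i \<bullet> R j) * (dual P j \<bullet> S i))"
    by (simp add: inner_sum_left)
  have "(\<Sum>j\<in>UNIV. area_hess P R j \<bullet> S j) = area P * ((\<Sum>k\<in>UNIV. dual P k \<bullet> R k)
      * (\<Sum>j\<in>UNIV. dual P j \<bullet> S j)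
      + ((\<Sum>j\<in>UNIV. (\<Sum>k\<in>UNIV. (dual P j \<bullet> dual P k) *\<^sub>R nproj P (R k)) \<bullet> S j)
      - (\<Sum>j\<in>UNIV. (\<Sum>k\<in>UNIV. (dual P j \<bullet> R k) *\<^sub>R dual P k) \<bullet> S j)))"
    unfolding area_hess_def dual_deriv_def
    by (simp add: inner_add_left inner_diff_left sum.distrib sum_subtractf sum_distrib_left
        algebra_simps)
  then show ?thesis unfolding 1 2 by (simp add: algebra_simps)
qed

lemma sum_area_hess_inner_commute:
  "(\<Sum>j\<in>UNIV. area_hess P R j \<bullet> S j) = (\<Sum>j\<in>UNIV. area_hess P S j \<bullet> R j)"
proof -
  have "(\<Sum>i\<in>UNIV. \<Sum>j\<in>UNIV. (dual P i \<bullet> R j) * (dual P j \<bullet> S i))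
      = (\<Sum>i\<in>UNIV. \<Sum>j\<in>UNIV. (dual P i \<bullet> S j) * (dual P j \<bullet> R i))"
    by (subst sum.swap) (simp add: mult.commute)
  moreover have "(\<Sum>i\<in>UNIV. \<Sum>j\<in>UNIV. (dual P i \<bullet> dual P j) * (nproj P (R i) \<bullet> nproj P (S j)))
      = (\<Sum>i\<in>UNIV. \<Sum>j\<in>UNIV. (dual P i \<bullet> dual P j) * (nproj P (S i) \<bullet> nproj P (R j)))"
    by (subst sum.swap) (simp add: inner_commute)
  ultimately show ?thesis by (simp add: sum_area_hess_inner mult.commute)
qed

end

lemma nproj_add: "nproj P (v + w) = nproj P v + nproj P w"
  by (simp add: nproj_def inner_add_right scaleR_add_left sum.distrib)

lemma nproj_scaleR: "nproj P (c *\<^sub>R w) = c *\<^sub>R nproj P w"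
  by (simp add: nproj_def scaleR_diff_right scaleR_sum_right)

lemma linear_nproj: "linear (nproj P)"
  by (intro linearI nproj_add nproj_scaleR)

lemma nproj_sum: "nproj P (\<Sum>i\<in>A. w i) = (\<Sum>i\<in>A. nproj P (w i))"
  by (rule linear_sum[OF linear_nproj])

lemma nproj_zero: "nproj P 0 = 0"
  by (rule linear_0[OF linear_nproj])

lemma dual_deriv_add:
  "dual_deriv P (\<lambda>k. R k + S k) j = dual_deriv P R j + dual_deriv P S j"
  by (simp add: dual_deriv_def nproj_add inner_add_right scaleR_add_left scaleR_add_right
      sum.distrib)

lemma dual_deriv_scaleR: "dual_deriv P (\<lambda>k. c *\<^sub>R R k) j = c *\<^sub>R dual_deriv P R j"
  by (simp add: dual_deriv_def nproj_scaleR scaleR_diff_right scaleR_sum_right mult.commute)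

lemma area_hess_add: "area_hess P (\<lambda>k. R k + S k) j = area_hess P R j + area_hess P S j"
  by (simp add: area_hess_def dual_deriv_add inner_add_right sum.distrib scaleR_add_left
      scaleR_add_right)

lemma area_hess_scaleR: "area_hess P (\<lambda>k. c *\<^sub>R R k) j = c *\<^sub>R area_hess P R j"
  by (simp add: area_hess_def dual_deriv_scaleR scaleR_add_right sum_distrib_left[symmetric] mult_ac)

lemma area_hess_zero: "area_hess P (\<lambda>_. 0) j = 0"
  using area_hess_scaleR[of P 0 "\<lambda>_. 0" j] by simp

lemma area_hess_sum: "area_hess P (\<lambda>k. \<Sum>i\<in>A. R i k) j = (\<Sum>i\<in>A. area_hess P (R i) j)"
  by (induction A rule: infinite_finite_induct) (simp_all add: area_hess_zero area_hess_add)

text \<open>First derivatives of the dual frame and of the area integrand.\<close>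

context
  fixes P :: "'a::euclidean_space \<Rightarrow> 'n::finite \<Rightarrow> 'e::euclidean_space"
    and P' :: "'n \<Rightarrow> 'a \<Rightarrow> 'e" and x :: 'a
  assumes P': "\<And>i. ((\<lambda>y. P y i) has_derivative P' i) (at x)"
    and nondeg: "0 < det (gram (P x))"
begin

lemma has_derivative_gram:
  "((\<lambda>y. gram (P y)) has_derivative
    (\<lambda>h. \<chi> i j. P x i \<bullet> P' j h + P' i h \<bullet> P x j)) (at x)"
  by (rule has_derivative_componentwise_matrix)
    (auto simp: gram_def intro!: has_derivative_inner P')

lemma has_derivative_area:
  "((\<lambda>y. area (P y)) has_derivative
    (\<lambda>h. \<Sum>k\<in>UNIV. area_grad (P x) k \<bullet> P' k h)) (at x)"
proof -
  let ?G = "gram (P x)"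
  let ?H = "\<lambda>h. (\<chi> i j. P x i \<bullet> P' j h + P' i h \<bullet> P x j) :: real ^ 'n ^ 'n"
  have 1: "((\<lambda>y. det (gram (P y))) has_derivative
      (\<lambda>h. det ?G * (\<Sum>i\<in>UNIV. \<Sum>j\<in>UNIV. ?H h $ i $ j * matrix_inv ?G $ j $ i))) (at x)"
    using has_derivative_compose[OF has_derivative_gram has_derivative_det] nondeg by auto
  have 2: "((\<lambda>y. area (P y)) has_derivative
      (\<lambda>h. (det ?G * (\<Sum>i\<in>UNIV. \<Sum>j\<in>UNIV. ?H h $ i $ j * matrix_inv ?G $ j $ i)) *
        (inverse (sqrt (det ?G)) / 2))) (at x)"
    unfolding area_def
    by (rule DERIV_compose_FDERIV[where f = sqrt and g = "\<lambda>y. det (gram (P y))",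
          OF DERIV_real_sqrt[OF nondeg] 1])
  have 3: "(\<Sum>i\<in>UNIV. \<Sum>j\<in>UNIV. ?H h $ i $ j * matrix_inv ?G $ j $ i)
      = 2 * (\<Sum>k\<in>UNIV. dual (P x) k \<bullet> P' k h)" for h
  proof -
    have s: "(\<Sum>k\<in>UNIV. dual (P x) k \<bullet> P' k h) = (\<Sum>i\<in>UNIV. \<Sum>j\<in>UNIV. (P x i \<bullet> P' j h) * matrix_inv ?G $ j $ i)"
      by (subst sum.swap) (simp add: dual_def inner_sum_left mult.commute)
    have "(\<Sum>i\<in>UNIV. \<Sum>j\<in>UNIV. (P' i h \<bullet> P x j) * matrix_inv ?G $ j $ i)
        = (\<Sum>i\<in>UNIV. \<Sum>j\<in>UNIV. (P x i \<bullet> P' j h) * matrix_inv ?G $ j $ i)"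
      by (subst sum.swap)
        (simp add: inner_dual_dual[OF nondeg, symmetric] inner_commute)
    then show ?thesis
      unfolding s by (simp add: distrib_right sum.distrib)
  qed
  have "det ?G = area (P x) * area (P x)" "area (P x) > 0"
    using nondeg by (auto simp: area_def)
  then have "(det ?G * (2 * S)) * (inverse (sqrt (det ?G)) / 2) = area (P x) * S" for S
    by (simp add: area_def[symmetric] field_simps)
  note S = this
  show ?thesis
    using 2 unfolding 3 S by (simp add: area_grad_def sum_distrib_left)
qed

lemma has_derivative_dual:
  "((\<lambda>y. dual (P y) i) has_derivative (\<lambda>h. dual_deriv (P x) (\<lambda>k. P' k h) i)) (at x)"
proof -
  let ?G = "gram (P x)" and ?I = "matrix_inv (gram (P x))" and ?d = "dual (P x)"
  let ?H = "\<lambda>h. (\<chi> i j. P x i \<bullet> P' j h + P' i h \<bullet> P x j) :: real ^ 'n ^ 'n"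
  have 1: "((\<lambda>y. matrix_inv (gram (P y)) $ i $ k) has_derivative
      (\<lambda>h. - (?I ** ?H h ** ?I) $ i $ k)) (at x)" for k
    using has_derivative_compose[OF has_derivative_gram has_derivative_matrix_inv_nth] nondeg
    by auto
  have 2: "((\<lambda>y. dual (P y) i) has_derivative
      (\<lambda>h. \<Sum>k\<in>UNIV. ?I $ i $ k *\<^sub>R P' k h + (- (?I ** ?H h ** ?I) $ i $ k) *\<^sub>R P x k)) (at x)"
    unfolding dual_def by (intro has_derivative_sum has_derivative_scaleR 1 P')
  have "(\<Sum>k\<in>UNIV. ?I $ i $ k *\<^sub>R P' k h + (- (?I ** ?H h ** ?I) $ i $ k) *\<^sub>R P x k)
      = dual_deriv (P x) (\<lambda>k. P' k h) i" for h
  proof -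
    have c: "(?I ** ?H h ** ?I) $ i $ k = (\<Sum>a\<in>UNIV. (?d i \<bullet> ?d a) * (?d k \<bullet> P' a h))
        + (\<Sum>b\<in>UNIV. (?d i \<bullet> P' b h) * (?d b \<bullet> ?d k))" for k
    proof -
      have "(?I ** ?H h ** ?I) $ i $ k = (\<Sum>b\<in>UNIV. \<Sum>a\<in>UNIV. ?I $ i $ a * (P' a h \<bullet> P x b) * ?I $ k $ b)
          + (\<Sum>b\<in>UNIV. (\<Sum>a\<in>UNIV. ?I $ i $ a * (P x a \<bullet> P' b h)) * ?I $ b $ k)"
        by (simp add: matrix_matrix_mult_def distrib_left distrib_right sum.distrib
            sum_distrib_right inner_dual_dual[OF nondeg, symmetric] inner_commute add.commute)
      also have "(\<Sum>b\<in>UNIV. \<Sum>a\<in>UNIV. ?I $ i $ a * (P' a h \<bullet> P x b) * ?I $ k $ b)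
          = (\<Sum>a\<in>UNIV. ?I $ i $ a * (P' a h \<bullet> (\<Sum>b\<in>UNIV. ?I $ k $ b *\<^sub>R P x b)))"
        by (subst sum.swap) (simp add: inner_sum_right sum_distrib_left mult_ac)
      also have "(\<Sum>b\<in>UNIV. (\<Sum>a\<in>UNIV. ?I $ i $ a * (P x a \<bullet> P' b h)) * ?I $ b $ k)
          = (\<Sum>b\<in>UNIV. ((\<Sum>a\<in>UNIV. ?I $ i $ a *\<^sub>R P x a) \<bullet> P' b h) * ?I $ b $ k)"
        by (simp add: inner_sum_left)
      finally show ?thesis
        unfolding dual_def[symmetric]
        by (simp add: inner_dual_dual[OF nondeg] inner_commute[of "P' _ h"])
    qed
    have d1: "(\<Sum>k\<in>UNIV. (\<Sum>a\<in>UNIV. (?d i \<bullet> ?d a) * (?d k \<bullet> P' a h)) *\<^sub>R P x k)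
        = (\<Sum>a\<in>UNIV. (?d i \<bullet> ?d a) *\<^sub>R (\<Sum>k\<in>UNIV. (?d k \<bullet> P' a h) *\<^sub>R P x k))"
      unfolding scaleR_sum_left scaleR_sum_right by (subst sum.swap) simp
    have d2: "(\<Sum>k\<in>UNIV. (\<Sum>b\<in>UNIV. (?d i \<bullet> P' b h) * (?d b \<bullet> ?d k)) *\<^sub>R P x k)
        = (\<Sum>b\<in>UNIV. (?d i \<bullet> P' b h) *\<^sub>R ?d b)"
    proof -
      have "(\<Sum>k\<in>UNIV. (\<Sum>b\<in>UNIV. (?d i \<bullet> P' b h) * (?d b \<bullet> ?d k)) *\<^sub>R P x k)
          = (\<Sum>b\<in>UNIV. (?d i \<bullet> P' b h) *\<^sub>R (\<Sum>k\<in>UNIV. (?d b \<bullet> ?d k) *\<^sub>R P x k))"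
        unfolding scaleR_sum_left scaleR_sum_right by (subst sum.swap) simp
      then show ?thesis by (simp add: dual_expand[OF nondeg, symmetric])
    qed
    have "(\<Sum>k\<in>UNIV. ?I $ i $ k *\<^sub>R P' k h + (- (?I ** ?H h ** ?I) $ i $ k) *\<^sub>R P x k)
        = (\<Sum>k\<in>UNIV. (?d i \<bullet> ?d k) *\<^sub>R P' k h)
        - (\<Sum>k\<in>UNIV. (\<Sum>a\<in>UNIV. (?d i \<bullet> ?d a) * (?d k \<bullet> P' a h)) *\<^sub>R P x k)
        - (\<Sum>k\<in>UNIV. (\<Sum>b\<in>UNIV. (?d i \<bullet> P' b h) * (?d b \<bullet> ?d k)) *\<^sub>R P x k)"
      unfolding c
      by (simp add: inner_dual_dual[OF nondeg] sum.distrib sum_negf scaleR_add_left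
          scaleR_diff_left sum_subtractf)
    also have "\<dots> = dual_deriv (P x) (\<lambda>k. P' k h) i"
      unfolding d1 d2 dual_deriv_def nproj_def
      by (simp add: scaleR_diff_right sum_subtractf)
    finally show ?thesis .
  qed
  with 2 show ?thesis by simp
qed

lemma has_derivative_area_grad:
  "((\<lambda>y. area_grad (P y) j) has_derivative (\<lambda>h. area_hess (P x) (\<lambda>k. P' k h) j)) (at x)"
proof -
  have "((\<lambda>y. area_grad (P y) j) has_derivative
      (\<lambda>h. area (P x) *\<^sub>R dual_deriv (P x) (\<lambda>k. P' k h) j
        + (\<Sum>k\<in>UNIV. area_grad (P x) k \<bullet> P' k h) *\<^sub>R dual (P x) j)) (at x)"
    unfolding area_grad_def[of "P _" j]
    by (intro has_derivative_scaleR has_derivative_area has_derivative_dual)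
  then show ?thesis
    by (simp add: area_hess_def area_grad_def scaleR_add_right sum_distrib_left add.commute)
qed

end

text \<open>Continuous dependence on the frame.\<close>

lemma continuous_on_gram [continuous_intros]:
  assumes "\<And>i. continuous_on S (\<lambda>y. P y i)"
  shows "continuous_on S (\<lambda>y. gram (P y))"
  unfolding gram_def by (intro continuous_intros assms)

lemma continuous_on_det_gram:
  fixes P :: "'a::topological_space \<Rightarrow> 'n::finite \<Rightarrow> 'e::euclidean_space"
  assumes "\<And>i. continuous_on S (\<lambda>y. P y i)"
  shows "continuous_on S (\<lambda>y. det (gram (P y)))"
  unfolding det_def gram_def by (simp, intro continuous_intros assms)

lemma continuous_on_area:
  fixes P :: "'a::topological_space \<Rightarrow> 'n::finite \<Rightarrow> 'e::euclidean_space"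
  assumes "\<And>i. continuous_on S (\<lambda>y. P y i)"
  shows "continuous_on S (\<lambda>y. area (P y))"
  unfolding area_def by (intro continuous_intros continuous_on_det_gram assms)

lemma continuous_on_dual:
  fixes P :: "'a::topological_space \<Rightarrow> 'n::finite \<Rightarrow> 'e::euclidean_space"
  assumes "\<And>i. continuous_on S (\<lambda>y. P y i)" and "\<And>y. y \<in> S \<Longrightarrow> 0 < det (gram (P y))"
  shows "continuous_on S (\<lambda>y. dual (P y) i)"
proof -
  have "continuous_on {A. det A \<noteq> 0} (\<lambda>A :: real ^ 'n ^ 'n. matrix_inv A $ i $ k)" for i k
    using has_derivative_matrix_inv_nth[THEN has_derivative_continuous]
    by (auto intro!: continuous_at_imp_continuous_on)
  then have "continuous_on S (\<lambda>y. matrix_inv (gram (P y)) $ i $ k)" for k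
    using assms by (intro continuous_on_compose2[where g = "\<lambda>A. matrix_inv A $ i $ k", OF _ continuous_on_gram])
      fastforce+
  then show ?thesis
    unfolding dual_def by (intro continuous_on_sum continuous_on_scaleR assms)
qed

lemma continuous_on_area_grad:
  fixes P :: "'a::topological_space \<Rightarrow> 'n::finite \<Rightarrow> 'e::euclidean_space"
  assumes "\<And>i. continuous_on S (\<lambda>y. P y i)" and "\<And>y. y \<in> S \<Longrightarrow> 0 < det (gram (P y))"
  shows "continuous_on S (\<lambda>y. area_grad (P y) i)"
  unfolding area_grad_def by (intro continuous_intros continuous_on_area continuous_on_dual assms)

lemma continuous_on_nproj:
  fixes P :: "'a::topological_space \<Rightarrow> 'n::finite \<Rightarrow> 'e::euclidean_space"
  assumes "\<And>i. continuous_on S (\<lambda>y. P y i)" and "\<And>y. y \<in> S \<Longrightarrow> 0 < det (gram (P y))"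
    and "continuous_on S w"
  shows "continuous_on S (\<lambda>y. nproj (P y) (w y))"
  unfolding nproj_def by (intro continuous_intros continuous_on_dual assms)

lemma continuous_on_dual_deriv:
  fixes P :: "'a::topological_space \<Rightarrow> 'n::finite \<Rightarrow> 'e::euclidean_space"
  assumes "\<And>i. continuous_on S (\<lambda>y. P y i)" and "\<And>y. y \<in> S \<Longrightarrow> 0 < det (gram (P y))"
    and "\<And>i. continuous_on S (\<lambda>y. R y i)"
  shows "continuous_on S (\<lambda>y. dual_deriv (P y) (R y) i)"
  unfolding dual_deriv_def by (intro continuous_intros continuous_on_dual continuous_on_nproj assms)

lemma continuous_on_area_hess:
  fixes P :: "'a::topological_space \<Rightarrow> 'n::finite \<Rightarrow> 'e::euclidean_space"
  assumes "\<And>i. continuous_on S (\<lambda>y. P y i)" and "\<And>y. y \<in> S \<Longrightarrow> 0 < det (gram (P y))"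
    and "\<And>i. continuous_on S (\<lambda>y. R y i)"
  shows "continuous_on S (\<lambda>y. area_hess (P y) (R y) i)"
  unfolding area_hess_def
  by (intro continuous_intros continuous_on_area continuous_on_dual continuous_on_dual_deriv assms)

section \<open>Partial derivatives on open sets\<close>

lemma partial_deriv_eq:
  "(u has_derivative u') (at x) \<Longrightarrow> partial_deriv i u x = u' (axis i 1)"
  by (metis frechet_derivative_at partial_deriv_def)

lemma C1_onI:
  assumes "\<And>x. x \<in> D \<Longrightarrow> (u has_derivative u' x) (at x)"
    and "\<And>i. continuous_on D (\<lambda>x. u' x (axis i 1))"
  shows "C1_on D u"
  unfolding C1_on_def
proof (intro conjI ballI allI)
  fix i
  show "continuous_on D (partial_deriv i u)"
    using assms(2)[of i] by (rule continuous_on_eq) (simp add: partial_deriv_eq[OF assms(1)])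
qed (rule differentiableI[OF assms(1)])

lemma C1_on_has_derivative:
  "C1_on D u \<Longrightarrow> x \<in> D \<Longrightarrow> (u has_derivative frechet_derivative u (at x)) (at x)"
  by (simp add: C1_on_def frechet_derivative_works[symmetric])

lemma C1_on_continuous: "C1_on D u \<Longrightarrow> continuous_on D u"
  unfolding C1_on_def
  by (auto intro!: continuous_at_imp_continuous_on differentiable_imp_continuous_within)

lemma C1_on_continuous_partial: "C1_on D u \<Longrightarrow> continuous_on D (partial_deriv i u)"
  by (simp add: C1_on_def)

lemma C1_on_continuous_subset: "C1_on D u \<Longrightarrow> S \<subseteq> D \<Longrightarrow> continuous_on S u"
  by (rule continuous_on_subset[OF C1_on_continuous])

lemma C1_on_continuous_partial_subset:
  "C1_on D u \<Longrightarrow> S \<subseteq> D \<Longrightarrow> continuous_on S (partial_deriv i u)"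
  by (rule continuous_on_subset[OF C1_on_continuous_partial])

lemma C2_on_imp_C1_on: "C2_on D u \<Longrightarrow> C1_on D u" and
  C2_on_partial: "C2_on D u \<Longrightarrow> C1_on D (partial_deriv i u)"
  by (simp_all add: C2_on_def)

lemma C1_on_subset: "C1_on D u \<Longrightarrow> E \<subseteq> D \<Longrightarrow> C1_on E u"
  unfolding C1_on_def by (auto intro: continuous_on_subset)

lemma partial_deriv_cong:
  assumes "open D" "x \<in> D" "\<And>y. y \<in> D \<Longrightarrow> u y = v y"
  shows "partial_deriv i u x = partial_deriv i v x"
proof -
  have "(u has_derivative d) (at x) \<longleftrightarrow> (v has_derivative d) (at x)" for d
    using has_derivative_transform_within_open[of u d x UNIV D v, OF _ assms(1,2)]
      has_derivative_transform_within_open[of v d x UNIV D u, OF _ assms(1,2)] assms(3)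
    by metis
  then show ?thesis by (simp add: partial_deriv_def frechet_derivative_def)
qed

lemma C1_on_cong:
  assumes "open D" "\<And>y. y \<in> D \<Longrightarrow> u y = v y" "C1_on D u"
  shows "C1_on D v"
proof (rule C1_onI)
  fix x assume x: "x \<in> D"
  show "(v has_derivative frechet_derivative u (at x)) (at x)"
    by (rule has_derivative_transform_within_open[OF C1_on_has_derivative[OF assms(3) x] assms(1) x])
      (simp add: assms(2))
next
  fix i show "continuous_on D (\<lambda>x. frechet_derivative u (at x) (axis i 1))"
    using C1_on_continuous_partial[OF assms(3)] by (simp add: partial_deriv_def[abs_def])
qed

lemma partial_deriv_eq_0:
  assumes "open D" "x \<in> D" "\<And>y. y \<in> D \<Longrightarrow> u y = 0"
  shows "partial_deriv i u x = 0"
  using partial_deriv_cong[of D x u "\<lambda>_. 0" i, OF assms] partial_deriv_eq[OF has_derivative_const]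
  by metis

context
  fixes D :: "(real ^ 'n) set"
    and prd :: "'a::real_normed_vector \<Rightarrow> 'b::real_normed_vector \<Rightarrow> 'c::real_normed_vector"
  assumes bil: "bounded_bilinear prd"
begin

lemma partial_deriv_bilinear:
  assumes "C1_on D u" "C1_on D v" "x \<in> D"
  shows "partial_deriv i (\<lambda>x. prd (u x) (v x)) x
    = prd (u x) (partial_deriv i v x) + prd (partial_deriv i u x) (v x)"
  using partial_deriv_eq[OF bounded_bilinear.FDERIV[OF bil C1_on_has_derivative C1_on_has_derivative, OF assms(1,3) assms(2,3)]]
  by (simp add: partial_deriv_def)

lemma C1_on_bilinear:
  assumes "C1_on D u" "C1_on D v"
  shows "C1_on D (\<lambda>x. prd (u x) (v x))"
proof (rule C1_onI[OF bounded_bilinear.FDERIV[OF bil assms[THEN C1_on_has_derivative]]])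
  fix i
  show "continuous_on D (\<lambda>x. prd (u x) (frechet_derivative v (at x) (axis i 1))
      + prd (frechet_derivative u (at x) (axis i 1)) (v x))"
    using C1_on_continuous_partial[OF assms(1), of i] C1_on_continuous_partial[OF assms(2), of i]
      C1_on_continuous[OF assms(1)] C1_on_continuous[OF assms(2)]
    by (intro continuous_intros bounded_bilinear.continuous_on[OF bil])
      (simp_all add: partial_deriv_def[abs_def])
qed

end

lemmas C1_on_scaleR = C1_on_bilinear[OF bounded_bilinear_scaleR]
lemmas C1_on_inner = C1_on_bilinear[OF bounded_bilinear_inner]
lemmas C1_on_mult = C1_on_bilinear[OF bounded_bilinear_mult]
lemmas partial_deriv_scaleR = partial_deriv_bilinear[OF bounded_bilinear_scaleR]
lemmas partial_deriv_inner = partial_deriv_bilinear[OF bounded_bilinear_inner]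
lemmas partial_deriv_mult = partial_deriv_bilinear[OF bounded_bilinear_mult]

lemma C1_on_const: "C1_on D (\<lambda>_. c)"
  by (rule C1_onI[where u' = "\<lambda>_ _. 0"]) auto

lemma C1_on_add:
  assumes "C1_on D u" "C1_on D v"
  shows "C1_on D (\<lambda>x. u x + v x)"
proof (rule C1_onI[OF has_derivative_add[OF assms[THEN C1_on_has_derivative]]])
  fix i
  show "continuous_on D (\<lambda>x. frechet_derivative u (at x) (axis i 1) + frechet_derivative v (at x) (axis i 1))"
    using continuous_on_add[OF assms[THEN C1_on_continuous_partial, of i]]
    by (simp add: partial_deriv_def)
qed

lemma C1_on_diff:
  assumes "C1_on D u" "C1_on D v"
  shows "C1_on D (\<lambda>x. u x - v x)"
proof (rule C1_onI[OF has_derivative_diff[OF assms[THEN C1_on_has_derivative]]])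
  fix i
  show "continuous_on D (\<lambda>x. frechet_derivative u (at x) (axis i 1) - frechet_derivative v (at x) (axis i 1))"
    using continuous_on_diff[OF assms[THEN C1_on_continuous_partial, of i]]
    by (simp add: partial_deriv_def)
qed

lemma partial_deriv_add:
  assumes "C1_on D u" "C1_on D v" "x \<in> D"
  shows "partial_deriv i (\<lambda>x. u x + v x) x = partial_deriv i u x + partial_deriv i v x"
  using partial_deriv_eq[OF has_derivative_add[OF assms(1,2)[THEN C1_on_has_derivative, OF assms(3)]]]
  by (simp add: partial_deriv_def)

lemma C1_on_sum:
  assumes "\<And>k. C1_on D (u k)"
  shows "C1_on D (\<lambda>x. \<Sum>k\<in>A. u k x)"
  by (induction A rule: infinite_finite_induct) (auto intro: C1_on_const C1_on_add assms)

lemma partial_deriv_const: "partial_deriv i (\<lambda>_. c) x = 0"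
  by (rule partial_deriv_eq[OF has_derivative_const])

lemma partial_deriv_sum:
  assumes "\<And>k. C1_on D (u k)" "x \<in> D"
  shows "partial_deriv i (\<lambda>x. \<Sum>k\<in>A. u k x) x = (\<Sum>k\<in>A. partial_deriv i (u k) x)"
proof (induction A rule: infinite_finite_induct)
  case (insert k A)
  then show ?case
    using partial_deriv_add[OF assms(1)[of k] C1_on_sum[of D u A, OF assms(1)] assms(2)] by simp
qed (simp_all add: partial_deriv_const)

lemma C1_on_inner_const: "C1_on D u \<Longrightarrow> C1_on D (\<lambda>x. u x \<bullet> b)"
  by (intro C1_on_inner C1_on_const)

lemma partial_deriv_inner_const:
  "C1_on D u \<Longrightarrow> x \<in> D \<Longrightarrow> partial_deriv i (\<lambda>x. u x \<bullet> b) x = partial_deriv i u x \<bullet> b"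
  using partial_deriv_inner[OF _ C1_on_const] by (simp add: partial_deriv_const)

text \<open>The partial derivative as a derivative along a coordinate line.\<close>

lemma has_vector_derivative_line:
  assumes "u differentiable (at (x + s *\<^sub>R axis i 1))"
  shows "((\<lambda>s. u (x + s *\<^sub>R axis i 1)) has_vector_derivative partial_deriv i u (x + s *\<^sub>R axis i 1)) (at s)"
proof -
  have l: "((\<lambda>s. x + s *\<^sub>R axis i 1) has_derivative (\<lambda>h. h *\<^sub>R axis i 1)) (at s)"
    by (auto intro!: derivative_eq_intros)
  have d: "(u has_derivative frechet_derivative u (at (x + s *\<^sub>R axis i 1))) (at (x + s *\<^sub>R axis i 1))"
    using assms by (simp add: frechet_derivative_works)
  have "((\<lambda>s. u (x + s *\<^sub>R axis i 1)) has_derivative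
      (\<lambda>h. frechet_derivative u (at (x + s *\<^sub>R axis i 1)) (h *\<^sub>R axis i 1))) (at s)"
    by (rule has_derivative_compose[OF l d])
  then show ?thesis
    by (simp add: has_vector_derivative_def partial_deriv_def
        linear_cmul[OF has_derivative_linear[OF d]])
qed

lemma has_vector_derivative_line_0:
  assumes "u differentiable (at x)"
  shows "((\<lambda>s. u (x + s *\<^sub>R axis i 1)) has_vector_derivative partial_deriv i u x) (at 0)"
  using has_vector_derivative_line[of u x 0 i] assms by simp

lemma line_in_open:
  assumes "open D" "x \<in> D"
  obtains d where "d > 0" "\<And>s y. \<bar>s\<bar> \<le> d \<Longrightarrow> dist x y < d \<Longrightarrow> y + s *\<^sub>R axis i (1 :: real) \<in> D"
proof -
  obtain e where e: "e > 0" "ball x e \<subseteq> D"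
    using assms openE by blast
  show thesis
  proof (rule that[of "e / 2"])
    fix s :: real and y assume "\<bar>s\<bar> \<le> e / 2" "dist x y < e / 2"
    moreover have "dist x (y + s *\<^sub>R axis i 1) \<le> dist x y + \<bar>s\<bar>"
      using dist_triangle[of x "y + s *\<^sub>R axis i 1" y] by (simp add: dist_norm)
    ultimately show "y + s *\<^sub>R axis i 1 \<in> D" using e by (intro subsetD[OF e(2)]) auto
  qed (use e in auto)
qed

text \<open>Interchange of a parameter derivative with a partial derivative: differentiate \<open>F s y = F a
  y + \<integral>\<^sub>a\<^sup>s F' \<sigma> y d\<sigma>\<close> under the integral sign in \<open>y\<close>, and then apply the fundamental theorem of
  calculus.\<close>

lemma has_vector_derivative_partial_deriv:
  fixes F F' :: "real \<Rightarrow> real ^ 'n \<Rightarrow> 'e::euclidean_space"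
  assumes D: "open D" and x: "x \<in> D" and t: "t \<in> {-\<epsilon><..<\<epsilon>}"
    and FF': "\<And>t y. t \<in> {-\<epsilon><..<\<epsilon>} \<Longrightarrow> y \<in> D \<Longrightarrow> ((\<lambda>s. F s y) has_vector_derivative F' t y) (at t)"
    and F: "\<And>t y. t \<in> {-\<epsilon><..<\<epsilon>} \<Longrightarrow> y \<in> D \<Longrightarrow> F t differentiable (at y)"
    and F': "C1_family {-\<epsilon><..<\<epsilon>} D F'"
  shows "((\<lambda>s. partial_deriv i (F s) x) has_vector_derivative partial_deriv i (F' t) x) (at t)"
proof -
  define a where "a = (t - \<epsilon>) / 2"
  define b where "b = (t + \<epsilon>) / 2"
  have ab: "a < t" "t < b" "-\<epsilon> < a" "b < \<epsilon>" using t by (auto simp: a_def b_def)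
  obtain d where d: "d > 0" "\<And>s y. \<bar>s\<bar> \<le> d \<Longrightarrow> dist x y < d \<Longrightarrow> y + s *\<^sub>R axis i 1 \<in> D"
    using line_in_open[OF D x] by metis
  let ?l = "\<lambda>r. x + r *\<^sub>R axis i (1 :: real)"
  let ?U = "{-d<..<d}"
  have l: "?l r \<in> D" if "r \<in> ?U" for r using d that by auto
  have contF': "continuous_on ({-\<epsilon><..<\<epsilon>} \<times> D) (\<lambda>(t, x). F' t x)"
    and contdF': "continuous_on ({-\<epsilon><..<\<epsilon>} \<times> D) (\<lambda>(t, x). partial_deriv i (F' t) x)"
    and diffF': "\<And>t y. t \<in> {-\<epsilon><..<\<epsilon>} \<Longrightarrow> y \<in> D \<Longrightarrow> F' t differentiable (at y)"
    using F' by (auto simp: C1_family_def)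
  have comp: "continuous_on S (\<lambda>p. w (f p) (g p))"
    if "continuous_on ({-\<epsilon><..<\<epsilon>} \<times> D) (\<lambda>(t, x). w t x)" "continuous_on S f" "continuous_on S g"
      "\<And>p. p \<in> S \<Longrightarrow> f p \<in> {-\<epsilon><..<\<epsilon>}" "\<And>p. p \<in> S \<Longrightarrow> g p \<in> D"
    for S :: "'c::topological_space set" and w :: "real \<Rightarrow> real ^ 'n \<Rightarrow> 'e" and f g
    using continuous_on_compose2[OF that(1) continuous_on_Pair[OF that(2,3)]] that(4,5) by fastforce
  have eq: "partial_deriv i (F s) x = partial_deriv i (F a) x
      + integral {a..s} (\<lambda>\<sigma>. partial_deriv i (F' \<sigma>) x)"
    if s: "s \<in> {a..b}" for s
  proof -
    have I: "integral {a..s} (\<lambda>\<sigma>. F' \<sigma> y) = F s y - F a y" if "y \<in> D" for y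
      by (intro integral_unique fundamental_theorem_of_calculus)
        (use s ab that in \<open>auto intro!: has_vector_derivative_at_within[OF FF']\<close>)
    have 1: "((\<lambda>r. integral (cbox a s) (\<lambda>\<sigma>. F' \<sigma> (?l r))) has_vector_derivative
        integral (cbox a s) (\<lambda>\<sigma>. partial_deriv i (F' \<sigma>) (?l 0))) (at 0 within ?U)"
    proof (rule leibniz_rule_vector_derivative[where f = "\<lambda>r \<sigma>. F' \<sigma> (?l r)"])
      fix r \<sigma> assume "r \<in> ?U" "\<sigma> \<in> cbox a s"
      then show "((\<lambda>r. F' \<sigma> (?l r)) has_vector_derivative partial_deriv i (F' \<sigma>) (?l r)) (at r within ?U)"
        using s ab l by (intro has_vector_derivative_at_within[OF
            has_vector_derivative_line] diffF') auto
    next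
      fix r assume "r \<in> ?U"
      then show "(\<lambda>\<sigma>. F' \<sigma> (?l r)) integrable_on cbox a s"
        by (intro integrable_continuous comp[OF contF'] continuous_intros) (use s ab l in auto)
    next
      have "continuous_on (?U \<times> cbox a s) (\<lambda>p. partial_deriv i (F' (snd p)) (?l (fst p)))"
        by (intro comp[OF contdF'] continuous_intros) (use s ab l in auto)
      then show "continuous_on (?U \<times> cbox a s) (\<lambda>(r, \<sigma>). partial_deriv i (F' \<sigma>) (?l r))"
        by (simp add: case_prod_unfold)
    qed (use d in auto)
    have "((\<lambda>r. integral {a..s} (\<lambda>\<sigma>. F' \<sigma> (?l r))) has_vector_derivative
        integral {a..s} (\<lambda>\<sigma>. partial_deriv i (F' \<sigma>) x)) (at 0)"
      using 1 d by (simp add: at_within_open[OF _ open_greaterThanLessThan])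
    moreover have "((\<lambda>r. F s (?l r) - F a (?l r)) has_vector_derivative
        partial_deriv i (F s) x - partial_deriv i (F a) x) (at 0)"
      using s ab x by (intro has_vector_derivative_diff has_vector_derivative_line_0 F) auto
    then have "((\<lambda>r. integral {a..s} (\<lambda>\<sigma>. F' \<sigma> (?l r))) has_vector_derivative
        partial_deriv i (F s) x - partial_deriv i (F a) x) (at 0)"
      by (rule has_vector_derivative_transform_within_open[where S = ?U]) (use d l I in auto)
    ultimately have "partial_deriv i (F s) x - partial_deriv i (F a) x
        = integral {a..s} (\<lambda>\<sigma>. partial_deriv i (F' \<sigma>) x)"
      using vector_derivative_unique_at by blast
    then show ?thesis by (simp add: algebra_simps)
  qed
  have "continuous_on {a..b} (\<lambda>\<sigma>. partial_deriv i (F' \<sigma>) x)"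
    by (intro comp[OF contdF'] continuous_intros) (use ab x in auto)
  then have "((\<lambda>s. integral {a..s} (\<lambda>\<sigma>. partial_deriv i (F' \<sigma>) x)) has_vector_derivative
      partial_deriv i (F' t) x) (at t within {a..b})"
    using ab by (intro integral_has_vector_derivative) auto
  then have "((\<lambda>s. integral {a..s} (\<lambda>\<sigma>. partial_deriv i (F' \<sigma>) x)) has_vector_derivative
      partial_deriv i (F' t) x) (at t)"
    using ab by (simp add: at_within_Icc_at)
  from has_vector_derivative_add[OF has_vector_derivative_const this, of "partial_deriv i (F a) x"]
  have "((\<lambda>s. partial_deriv i (F a) x + integral {a..s} (\<lambda>\<sigma>. partial_deriv i (F' \<sigma>) x))
      has_vector_derivative
      partial_deriv i (F' t) x) (at t)" by simp
  then show ?thesis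
  proof (rule has_vector_derivative_transform_within_open[where S = "{a<..<b}"])
    fix s assume "s \<in> {a<..<b}"
    then show "partial_deriv i (F a) x + integral {a..s} (\<lambda>\<sigma>. partial_deriv i (F' \<sigma>) x)
        = partial_deriv i (F s) x"
      by (intro eq[symmetric]) auto
  qed (use ab in auto)
qed

lemma partial_deriv_commute:
  fixes u :: "real ^ 'n \<Rightarrow> 'e::euclidean_space"
  assumes "open D" "C2_on D u" "x \<in> D"
  shows "partial_deriv i (partial_deriv j u) x = partial_deriv j (partial_deriv i u) x"
proof -
  obtain d where d: "d > 0" "\<And>s y. \<bar>s\<bar> \<le> d \<Longrightarrow> dist x y < d \<Longrightarrow> y + s *\<^sub>R axis j 1 \<in> D"
    using line_in_open[OF assms(1,3)] by metis
  have u: "u differentiable (at y)" "partial_deriv k u differentiable (at y)" if "y \<in> D" for y k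
    using assms(2) that by (auto simp: C2_on_def C1_on_def)
  have shift: "((\<lambda>y. v (y + c)) has_derivative frechet_derivative v (at (y + c))) (at y)"
    if "v differentiable (at (y + c))" for v :: "real ^ 'n \<Rightarrow> 'e" and y c
  proof -
    have "((\<lambda>y. y + c) has_derivative (\<lambda>h. h)) (at y)"
      by (auto intro!: derivative_eq_intros)
    from has_derivative_compose[OF this] that show ?thesis
      by (simp add: frechet_derivative_works)
  qed
  have shift': "partial_deriv k (\<lambda>y. v (y + c)) y = partial_deriv k v (y + c)"
    if "v differentiable (at (y + c))" for v :: "real ^ 'n \<Rightarrow> 'e" and y c k
    using partial_deriv_eq[OF shift[OF that]] by (simp add: partial_deriv_def)
  let ?F = "\<lambda>s y. u (y + s *\<^sub>R axis j 1)"
  let ?F' = "\<lambda>s y. partial_deriv j u (y + s *\<^sub>R axis j 1)"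
  have in_D: "y + s *\<^sub>R axis j 1 \<in> D" if "y \<in> ball x d" "s \<in> {-d<..<d}" for s y
    using that by (intro d) auto
  have C1: "C1_on D (partial_deriv j u)" using assms by (simp add: C2_on_def)
  have line: "continuous_on ({-d<..<d} \<times> ball x d) (\<lambda>p. w (snd p + fst p *\<^sub>R axis j 1))"
    if "continuous_on D w" for w :: "real ^ 'n \<Rightarrow> 'e"
    by (rule continuous_on_compose2[OF that]) (use in_D in \<open>auto intro!: continuous_intros\<close>)
  have "((\<lambda>s. partial_deriv i (?F s) x) has_vector_derivative partial_deriv i (?F' 0) x) (at 0)"
  proof (rule has_vector_derivative_partial_deriv[where D = "ball x d" and \<epsilon> = d])
    show "C1_family {-d<..<d} (ball x d) ?F'"
      unfolding C1_family_def
    proof (intro conjI ballI allI)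
      fix t y assume "t \<in> {-d<..<d}" "y \<in> ball x d"
      then show "?F' t differentiable (at y)"
        by (intro differentiableI[OF shift] u(2) in_D)
    next
      show "continuous_on ({-d<..<d} \<times> ball x d) (\<lambda>(t, x). ?F' t x)"
        using line[OF C1_on_continuous[OF C1]] by (simp add: case_prod_unfold)
    next
      fix k
      have "continuous_on ({-d<..<d} \<times> ball x d) (\<lambda>p. partial_deriv k (partial_deriv j u) (snd p + fst p *\<^sub>R axis j 1))"
        by (rule line[OF C1_on_continuous_partial[OF C1]])
      then show "continuous_on ({-d<..<d} \<times> ball x d) (\<lambda>(t, x). partial_deriv k (?F' t) x)"
        by (rule continuous_on_eq)
          (use in_D u in \<open>auto simp: shift'\<close>)
    qed
  next
    fix t y assume "t \<in> {-d<..<d}" "y \<in> ball x d"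
    then show "?F t differentiable (at y)"
      by (intro differentiableI[OF shift] u(1) in_D)
  next
    fix t y assume "t \<in> {-d<..<d}" "y \<in> ball x d"
    then show "((\<lambda>s. ?F s y) has_vector_derivative ?F' t y) (at t)"
      by (intro has_vector_derivative_line u(1) in_D)
  qed (use d in auto)
  then have "((\<lambda>s. partial_deriv i (?F s) x) has_vector_derivative partial_deriv i (partial_deriv j u) x) (at 0)"
    by simp
  then have "((\<lambda>s. partial_deriv i u (x + s *\<^sub>R axis j 1)) has_vector_derivative
      partial_deriv i (partial_deriv j u) x) (at 0)"
  proof (rule has_vector_derivative_transform_within_open[where S = "{-d<..<d}"])
    fix s assume s: "s \<in> {-d<..<d}"
    show "partial_deriv i (?F s) x = partial_deriv i u (x + s *\<^sub>R axis j 1)"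
      by (rule shift'[OF u(1)[OF in_D]]) (use d s in auto)
  qed (use d in auto)
  moreover have "((\<lambda>s. partial_deriv i u (x + s *\<^sub>R axis j 1)) has_vector_derivative
      partial_deriv j (partial_deriv i u) x) (at 0)"
    using u(2)[OF assms(3)] by (rule has_vector_derivative_line_0)
  ultimately show ?thesis by (rule vector_derivative_unique_at)
qed

section \<open>Integration over compact sets\<close>

lemma integrable_on_compact:
  fixes f :: "'a::euclidean_space \<Rightarrow> 'b::euclidean_space"
  assumes "compact K" "continuous_on K f"
  shows "f integrable_on K"
  using set_borel_integral_eq_integral(1)[of K f] borel_integrable_compact[OF assms]
  by (simp add: set_integrable_def)

lemma integral_eq_if_zero_outside:
  fixes f :: "'a::euclidean_space \<Rightarrow> real"
  assumes "K \<subseteq> S" "\<And>x. x \<in> S - K \<Longrightarrow> f x = 0"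
  shows "integral S f = integral K f"
proof -
  have "(\<lambda>x. if x \<in> S then f x else 0) = (\<lambda>x. if x \<in> K then f x else 0)"
    using assms by (intro ext) (metis DiffI subsetD)
  then show ?thesis
    by (metis Henstock_Kurzweil_Integration.integral_restrict_UNIV)
qed

lemma integral_translation:
  fixes f :: "'a::euclidean_space \<Rightarrow> real"
  assumes "compact K" "continuous_on K f" "\<And>x. x + c \<in> K \<Longrightarrow> x \<in> S"
  shows "integral S (\<lambda>x. if x + c \<in> K then f (x + c) else 0) = integral K f"
proof -
  define g where "g x = indicator K x *\<^sub>R f x" for x
  have g: "integrable lborel g"
    unfolding g_def by (rule borel_integrable_compact[OF assms(1,2)])
  then have g': "integrable lborel (\<lambda>x. g (c + x))"
    using integrable_distr_eq[of "(+) c" lborel borel g] by (simp add: lborel_distr_plus)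
  have "integral\<^sup>L lborel g = integral\<^sup>L (distr lborel borel ((+) c)) g"
    by (simp add: lborel_distr_plus)
  also have "\<dots> = integral\<^sup>L lborel (\<lambda>x. g (c + x))"
    by (rule integral_distr) (use g in auto)
  finally have "integral UNIV g = integral UNIV (\<lambda>x. g (c + x))"
    using integral_lborel[OF g] integral_lborel[OF g'] by simp
  moreover have "integral UNIV g = integral K f"
  proof -
    have "g = (\<lambda>x. if x \<in> K then f x else 0)" by (auto simp: g_def)
    then show ?thesis by (simp add: Henstock_Kurzweil_Integration.integral_restrict_UNIV)
  qed
  moreover have "integral UNIV (\<lambda>x. g (c + x)) = integral S (\<lambda>x. g (c + x))"
    by (rule integral_eq_if_zero_outside) (use assms(3) in \<open>auto simp: g_def indicator_def add.commute\<close>)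
  moreover have "(\<lambda>x. g (c + x)) = (\<lambda>x. if x + c \<in> K then f (x + c) else 0)"
    by (auto simp: g_def add.commute)
  ultimately show ?thesis by simp
qed

text \<open>Differentiation under an integral over a compact set.\<close>

lemma has_real_derivative_integral_compact:
  fixes f f' :: "real \<Rightarrow> 'a::euclidean_space \<Rightarrow> real"
  assumes K: "compact K" and U: "open U" "t0 \<in> U"
    and f: "\<And>t x. t \<in> U \<Longrightarrow> x \<in> K \<Longrightarrow> ((\<lambda>s. f s x) has_real_derivative f' t x) (at t)"
    and cf: "\<And>t. t \<in> U \<Longrightarrow> continuous_on K (f t)"
    and cf': "continuous_on (U \<times> K) (\<lambda>(t, x). f' t x)"
  shows "((\<lambda>t. integral K (f t)) has_real_derivative integral K (f' t0)) (at t0)"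
  unfolding has_field_derivative_iff
proof (rule tendstoI)
  fix e' :: real assume "e' > 0"
  define c where "c = integral K (\<lambda>_. 1 :: real)"
  have int1: "(\<lambda>_. r :: real) integrable_on K" for r
    by (rule integrable_on_compact[OF K]) simp
  have c: "c \<ge> 0" unfolding c_def by (rule integral_nonneg[OF int1]) simp
  define e where "e = e' / (c + 1)"
  have e: "e > 0" "e * c < e'"
    using \<open>e' > 0\<close> c by (auto simp: e_def field_simps)
  from continuous_on_prod_compactE[OF cf' K U(2) e(1)] obtain X0 where
    X0: "t0 \<in> X0" "open X0" "\<forall>t\<in>X0 \<inter> U. \<forall>x\<in>K. dist (f' t x) (f' t0 x) \<le> e"
    by auto
  obtain d where d: "d > 0" "ball t0 d \<subseteq> X0 \<inter> U"
    using X0(1,2) U by (meson IntI open_Int openE)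
  have cf't0: "continuous_on K (f' t0)"
    using continuous_on_compose2[OF cf' continuous_on_Pair[OF continuous_on_const continuous_on_id, of K t0]] U(2)
    by auto
  have "dist ((integral K (f t) - integral K (f t0)) / (t - t0)) (integral K (f' t0)) < e'"
    if t: "t \<noteq> t0" "dist t t0 < d" for t
  proof -
    have tU: "t \<in> U" using t d by (auto simp: dist_commute)
    have I: "f t integrable_on K" "f t0 integrable_on K" "f' t0 integrable_on K"
      by (intro integrable_on_compact[OF K] cf cf't0 tU U(2))+
    let ?q = "\<lambda>x. (f t x - f t0 x) / (t - t0) - f' t0 x"
    have "norm (?q x) \<le> e" if x: "x \<in> K" for x
    proof -
      have "\<exists>\<xi>. \<xi> \<in> ball t0 d \<and> f t x - f t0 x = (t - t0) * f' \<xi> x"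
      proof (cases "t0 < t")
        case True
        have "\<And>\<xi>. t0 \<le> \<xi> \<Longrightarrow> \<xi> \<le> t \<Longrightarrow> ((\<lambda>s. f s x) has_real_derivative f' \<xi> x) (at \<xi>)"
          using t d x by (intro f) (auto simp: dist_real_def subset_iff)
        from MVT2[OF True, of "\<lambda>s. f s x" "\<lambda>s. f' s x", OF this]
        obtain z where "t0 < z" "z < t" "f t x - f t0 x = (t - t0) * f' z x" by blast
        then show ?thesis using t by (intro exI[of _ z]) (auto simp: dist_real_def)
      next
        case False
        then have lt: "t < t0" using t by simp
        have "\<And>\<xi>. t \<le> \<xi> \<Longrightarrow> \<xi> \<le> t0 \<Longrightarrow> ((\<lambda>s. f s x) has_real_derivative f' \<xi> x) (at \<xi>)"
          using t d x by (intro f) (auto simp: dist_real_def subset_iff)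
        from MVT2[OF lt, of "\<lambda>s. f s x" "\<lambda>s. f' s x", OF this]
        obtain z where z: "t < z" "z < t0" "f t0 x - f t x = (t0 - t) * f' z x" by blast
        then have "z \<in> ball t0 d" "f t x - f t0 x = (t - t0) * f' z x"
          using t by (auto simp: dist_real_def algebra_simps)
        then show ?thesis by blast
      qed
      then obtain \<xi> where \<xi>: "\<xi> \<in> ball t0 d" "f t x - f t0 x = (t - t0) * f' \<xi> x" by blast
      then have "?q x = f' \<xi> x - f' t0 x" using t by simp
      then show ?thesis using X0(3) \<xi>(1) d(2) x by (auto simp: dist_norm subset_iff)
    qed
    then have "norm (integral K ?q) \<le> integral K (\<lambda>_. e)"
      by (intro Henstock_Kurzweil_Integration.integral_norm_bound_integral int1
          integrable_diff integrable_on_divide I)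
    also have "\<dots> = e * c"
      using integral_mult_right[of K e "\<lambda>_. 1"] by (simp add: c_def)
    also have "integral K ?q = (integral K (f t) - integral K (f t0)) / (t - t0) - integral K (f' t0)"
      by (simp add: Henstock_Kurzweil_Integration.integral_diff integrable_diff integrable_on_divide I)
    finally show ?thesis using e(2) by (simp add: dist_norm)
  qed
  then show "\<forall>\<^sub>F t in at t0. dist ((integral K (f t) - integral K (f t0)) / (t - t0)) (integral K (f' t0)) < e'"
    using d(1) by (auto simp: eventually_at)
qed

section \<open>Integration by parts\<close>

text \<open>The function that agrees with \<open>w\<close> on \<open>K\<close> and is zero elsewhere. It is of class \<open>C1\<close> on the
  whole space when \<open>K\<close> is compact and \<open>w\<close> is of class \<open>C1\<close> on a neighbourhood of \<open>K\<close> and vanishes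
  there off \<open>K\<close>.\<close>

definition zero_ext :: "'a set \<Rightarrow> ('a \<Rightarrow> real) \<Rightarrow> 'a \<Rightarrow> real"
  where "zero_ext K w x = (if x \<in> K then w x else 0)"

lemma C1_on_zero_ext:
  fixes w :: "real ^ 'n \<Rightarrow> real"
  assumes D: "open D" and K: "compact K" "K \<subseteq> D" and w: "C1_on D w" "\<forall>x\<in>D - K. w x = 0"
  shows "C1_on UNIV (zero_ext K w)"
    and "partial_deriv i (zero_ext K w) x = (if x \<in> K then partial_deriv i w x else 0)"
    and "x \<in> D - K \<Longrightarrow> partial_deriv i w x = 0"
proof -
  let ?E = "zero_ext K w"
  note E_def = zero_ext_def
  have oK: "open (-K)" using K by (simp add: compact_imp_closed open_Compl)
  have "C1_on D ?E"
    by (rule C1_on_cong[OF D _ w(1)]) (use w(2) in \<open>auto simp: E_def\<close>)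
  moreover have "C1_on (-K) ?E"
    by (rule C1_on_cong[OF oK _ C1_on_const[of "-K" 0]]) (auto simp: E_def)
  ultimately have "C1_on (D \<union> -K) ?E"
    unfolding C1_on_def using continuous_on_open_Un[OF D oK] by (metis UnE)
  moreover have "D \<union> -K = UNIV" using K(2) by blast
  ultimately show "C1_on UNIV ?E" by simp
  show "partial_deriv i ?E x = (if x \<in> K then partial_deriv i w x else 0)"
    using partial_deriv_cong[OF D, of x ?E w i] partial_deriv_eq_0[OF oK, of x ?E i] w(2) K(2)
    by (auto simp: E_def)
  show "partial_deriv i w x = 0" if "x \<in> D - K"
    using partial_deriv_eq_0[of "D - K" x w i] that w(2) D K(1)
    by (simp add: open_Diff compact_imp_closed)
qed

lemma C1_on_shift:
  assumes "C1_on UNIV u"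
  shows "C1_on D (\<lambda>x. u (x + c))" and "partial_deriv i (\<lambda>x. u (x + c)) x = partial_deriv i u (x + c)"
proof -
  have d: "((\<lambda>x. u (x + c)) has_derivative frechet_derivative u (at (x + c))) (at x)" for x
  proof -
    have "((\<lambda>y. y + c) has_derivative (\<lambda>h. h)) (at x)" by (auto intro!: derivative_eq_intros)
    from has_derivative_compose[OF this C1_on_has_derivative[OF assms]] show ?thesis by simp
  qed
  show "C1_on D (\<lambda>x. u (x + c))"
  proof (rule C1_onI[OF d])
    fix i
    have "continuous_on D (\<lambda>x. partial_deriv i u (x + c))"
      by (rule continuous_on_compose2[OF C1_on_continuous_partial[OF assms]])
        (auto intro!: continuous_intros)
    then show "continuous_on D (\<lambda>x. frechet_derivative u (at (x + c)) (axis i 1))"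
      by (simp add: partial_deriv_def)
  qed
  show "partial_deriv i (\<lambda>x. u (x + c)) x = partial_deriv i u (x + c)"
    using partial_deriv_eq[OF d] by (simp add: partial_deriv_def)
qed

lemma has_real_derivative_line:
  fixes u :: "real ^ 'n \<Rightarrow> real"
  assumes "u differentiable (at (x + s *\<^sub>R axis i 1))"
  shows "((\<lambda>s. u (x + s *\<^sub>R axis i 1)) has_real_derivative partial_deriv i u (x + s *\<^sub>R axis i 1)) (at s)"
  using has_vector_derivative_line[OF assms] by (simp add:
      has_real_derivative_iff_has_vector_derivative)

text \<open>The integral of a translate of \<open>w\<close> does not depend on the translation; its derivative at \<open>0\<close>
  is the integral of a partial derivative.\<close>

lemma integral_partial_deriv_eq_0:
  fixes w :: "real ^ 'n \<Rightarrow> real"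
  assumes D: "open D" and K: "compact K" "K \<subseteq> D" and w: "C1_on D w" "\<forall>x\<in>D - K. w x = 0"
  shows "integral K (partial_deriv i w) = 0"
proof -
  define E where "E = zero_ext K w"
  note ext = C1_on_zero_ext[OF D K w, folded E_def]
  obtain R where R: "K \<subseteq> cball 0 R"
  proof -
    obtain R where "\<forall>x\<in>K. norm x \<le> R"
      using compact_imp_bounded[OF K(1)] by (auto simp: bounded_iff)
    then show thesis by (intro that[of R]) auto
  qed
  let ?S = "cball 0 (R + 1) :: (real ^ 'n) set"
  let ?a = "axis i 1 :: real ^ 'n"
  have KS: "K \<subseteq> ?S" using R by fastforce
  have const: "integral ?S (\<lambda>x. E (x + t *\<^sub>R ?a)) = integral K w" if t: "t \<in> {-1<..<1}" for t
    unfolding E_def zero_ext_def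
  proof (rule integral_translation[OF K(1)])
    show "continuous_on K w" by (rule C1_on_continuous_subset[OF w(1) K(2)])
    fix x assume "x + t *\<^sub>R ?a \<in> K"
    then have "norm (x + t *\<^sub>R ?a) \<le> R" using R by auto
    moreover have "norm x \<le> norm (x + t *\<^sub>R ?a) + \<bar>t\<bar>"
      using norm_triangle_ineq4[of "x + t *\<^sub>R ?a" "t *\<^sub>R ?a"] by simp
    moreover have "\<bar>t\<bar> < 1" using t by auto
    ultimately show "x \<in> ?S" by simp
  qed
  have "((\<lambda>t. integral ?S (\<lambda>x. E (x + t *\<^sub>R ?a))) has_real_derivative
      integral ?S (\<lambda>x. partial_deriv i E (x + 0 *\<^sub>R ?a))) (at 0)"
  proof (rule has_real_derivative_integral_compact[where U = "{-1<..<1}"])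
    fix t x
    show "((\<lambda>s. E (x + s *\<^sub>R ?a)) has_real_derivative partial_deriv i E (x + t *\<^sub>R ?a)) (at t)"
      using ext(1) by (intro has_real_derivative_line) (simp add: C1_on_def)
  next
    fix t show "continuous_on ?S (\<lambda>x. E (x + t *\<^sub>R ?a))"
      by (intro continuous_on_compose2[OF C1_on_continuous[OF ext(1)]] continuous_intros) auto
  next
    have "continuous_on ({-1<..<1} \<times> ?S) (\<lambda>p. partial_deriv i E (snd p + fst p *\<^sub>R ?a))"
      by (intro continuous_on_compose2[OF C1_on_continuous_partial[OF ext(1)]] continuous_intros) auto
    then show "continuous_on ({-1<..<1} \<times> ?S) (\<lambda>(t, x). partial_deriv i E (x + t *\<^sub>R ?a))"
      by (simp add: case_prod_unfold)
  qed auto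
  then have "((\<lambda>t. integral K w) has_real_derivative
      integral ?S (\<lambda>x. partial_deriv i E (x + 0 *\<^sub>R ?a))) (at 0)"
    by (rule has_field_derivative_transform_within_open[where S = "{-1<..<1}"]) (use const in auto)
  then have "integral ?S (partial_deriv i E) = 0"
    using DERIV_unique[OF _ DERIV_const] by simp
  moreover have "integral ?S (partial_deriv i E) = integral K (partial_deriv i E)"
    by (rule integral_eq_if_zero_outside[OF KS]) (simp add: ext(2))
  moreover have "integral K (partial_deriv i E) = integral K (partial_deriv i w)"
    by (rule Henstock_Kurzweil_Integration.integral_cong) (simp add: ext(2))
  ultimately show ?thesis by simp
qed

text \<open>A symmetry of weak second derivatives: both sides equal \<open>- \<integral> T \<partial>\<^sub>i\<partial>\<^sub>j S\<close> when \<open>S\<close> is \<open>C2\<close>.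
  For \<open>C1\<close> functions, integrate by parts in the integral of \<open>\<partial>\<^sub>i T\<close> against translates of \<open>S\<close>
  along the \<open>j\<close>-th axis, move the translation to \<open>T\<close>, and differentiate with respect to the
  translation.\<close>

lemma integral_partial_deriv_swap_real:
  fixes T S :: "real ^ 'n \<Rightarrow> real"
  assumes D: "open D" and K: "compact K" "K \<subseteq> D" and T: "C1_on D T"
    and S: "C1_on D S" "\<forall>x\<in>D - K. S x = 0"
  shows "integral K (\<lambda>x. partial_deriv i T x * partial_deriv j S x)
    = integral K (\<lambda>x. partial_deriv j T x * partial_deriv i S x)"
proof -
  define E where "E = zero_ext K S"
  note ext = C1_on_zero_ext[OF D K S, folded E_def]
  let ?a = "axis j 1 :: real ^ 'n"
  obtain d where d: "d > 0" "(\<Union>x\<in>K. cball x d) \<subseteq> D"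
    using compact_subset_open_imp_cball_epsilon_subset[OF K(1) D K(2)] by metis
  define M where "M = (\<lambda>(x, s). x + s *\<^sub>R ?a) ` (K \<times> {-d..d})"
  have cM: "compact M"
    unfolding M_def case_prod_unfold
    by (intro compact_continuous_image compact_Times K continuous_intros) simp
  have shiftD: "x + s *\<^sub>R ?a \<in> D" if "x \<in> K" "\<bar>s\<bar> \<le> d" for x s
  proof -
    have "x + s *\<^sub>R ?a \<in> cball x d" using that by (simp add: dist_norm)
    then show ?thesis using d(2) that(1) by blast
  qed
  have MD: "M \<subseteq> D" using shiftD by (auto simp: M_def)
  have KM: "K \<subseteq> M"
    unfolding M_def by (rule subsetI, rule image_eqI[of _ _ "(_, 0)"]) (use d(1) in auto)
  have inM: "x \<in> M" if "x + h *\<^sub>R ?a \<in> K" "\<bar>h\<bar> \<le> d" for x h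
    unfolding M_def by (rule image_eqI[of _ _ "(x + h *\<^sub>R ?a, -h)"]) (use that in auto)
  let ?U = "{-d<..<d}"
  have ibp: "integral M (\<lambda>x. partial_deriv i T x * E (x + h *\<^sub>R ?a))
      = - integral K (\<lambda>x. T (x + (-h) *\<^sub>R ?a) * partial_deriv i S x)" if h: "h \<in> ?U" for h
  proof -
    have Eh: "C1_on D (\<lambda>x. E (x + h *\<^sub>R ?a))" by (rule C1_on_shift[OF ext(1)])
    have z: "E (x + h *\<^sub>R ?a) = 0" if "x \<in> D - M" for x
      using inM[of x h] that h by (auto simp: E_def zero_ext_def abs_le_iff)
    have cont: "continuous_on M (\<lambda>x. partial_deriv i T x * E (x + h *\<^sub>R ?a))"
        "continuous_on M (\<lambda>x. T x * partial_deriv i E (x + h *\<^sub>R ?a))"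
    proof -
      have "partial_deriv i (\<lambda>x. E (x + h *\<^sub>R ?a)) = (\<lambda>x. partial_deriv i E (x + h *\<^sub>R ?a))"
        by (simp add: fun_eq_iff C1_on_shift(2)[OF ext(1)])
      then have "continuous_on M (\<lambda>x. partial_deriv i E (x + h *\<^sub>R ?a))"
        using C1_on_continuous_partial_subset[OF Eh MD, of i] by simp
      then show "continuous_on M (\<lambda>x. partial_deriv i T x * E (x + h *\<^sub>R ?a))"
        "continuous_on M (\<lambda>x. T x * partial_deriv i E (x + h *\<^sub>R ?a))"
        by (intro continuous_on_mult C1_on_continuous_partial_subset[OF T MD]
            C1_on_continuous_subset[OF Eh MD] C1_on_continuous_subset[OF T MD])+
    qed
    have "0 = integral M (partial_deriv i (\<lambda>x. T x * E (x + h *\<^sub>R ?a)))"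
      by (rule integral_partial_deriv_eq_0[symmetric, OF D cM MD C1_on_mult[OF T Eh]])
        (use z in auto)
    also have "\<dots> = integral M (\<lambda>x. T x * partial_deriv i E (x + h *\<^sub>R ?a)
        + partial_deriv i T x * E (x + h *\<^sub>R ?a))"
      by (rule Henstock_Kurzweil_Integration.integral_cong)
        (use MD in \<open>auto simp: partial_deriv_mult[OF T Eh] C1_on_shift(2)[OF ext(1)]\<close>)
    also have "\<dots> = integral M (\<lambda>x. T x * partial_deriv i E (x + h *\<^sub>R ?a))
        + integral M (\<lambda>x. partial_deriv i T x * E (x + h *\<^sub>R ?a))"
      by (intro Henstock_Kurzweil_Integration.integral_add integrable_on_compact[OF cM] cont)
    also have "integral M (\<lambda>x. T x * partial_deriv i E (x + h *\<^sub>R ?a))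
        = integral M (\<lambda>x. if x + h *\<^sub>R ?a \<in> K
            then T ((x + h *\<^sub>R ?a) + (-h) *\<^sub>R ?a) * partial_deriv i S (x + h *\<^sub>R ?a) else 0)"
      by (rule Henstock_Kurzweil_Integration.integral_cong) (auto simp: ext(2))
    also have "\<dots> = integral K (\<lambda>x. T (x + (-h) *\<^sub>R ?a) * partial_deriv i S x)"
    proof (rule integral_translation[OF K(1)])
      have "continuous_on K (\<lambda>x. T (x + (-h) *\<^sub>R ?a))"
      proof (rule continuous_on_compose2[OF C1_on_continuous[OF T]])
        show "(\<lambda>x. x + (-h) *\<^sub>R ?a) ` K \<subseteq> D"
          using h by (intro image_subsetI shiftD) auto
      qed (intro continuous_intros)
      moreover have "continuous_on K (partial_deriv i S)"
        by (rule C1_on_continuous_partial_subset[OF S(1) K(2)])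
      ultimately show "continuous_on K (\<lambda>x. T (x + (-h) *\<^sub>R ?a) * partial_deriv i S x)"
        by (rule continuous_on_mult)
    qed (use inM h in auto)
    finally show ?thesis by simp
  qed
  have 1: "((\<lambda>h. integral M (\<lambda>x. partial_deriv i T x * E (x + h *\<^sub>R ?a))) has_real_derivative
      integral M (\<lambda>x. partial_deriv i T x * partial_deriv j E (x + 0 *\<^sub>R ?a))) (at 0)"
  proof (rule has_real_derivative_integral_compact[OF cM, where U = ?U])
    fix h x
    show "((\<lambda>h. partial_deriv i T x * E (x + h *\<^sub>R ?a)) has_real_derivative
        partial_deriv i T x * partial_deriv j E (x + h *\<^sub>R ?a)) (at h)"
      using ext(1) by (intro DERIV_cmult has_real_derivative_line) (simp add: C1_on_def)
  next
    fix h show "continuous_on M (\<lambda>x. partial_deriv i T x * E (x + h *\<^sub>R ?a))"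
      by (intro continuous_on_mult C1_on_continuous_partial_subset[OF T MD]
          continuous_on_compose2[OF C1_on_continuous[OF ext(1)]] continuous_intros) auto
  next
    have "continuous_on (?U \<times> M) (\<lambda>p. partial_deriv i T (snd p) * partial_deriv j E (snd p + fst p *\<^sub>R ?a))"
      by (intro continuous_on_mult continuous_on_compose2[OF C1_on_continuous_partial[OF ext(1)]]
          continuous_on_compose2[OF C1_on_continuous_partial[OF T]] continuous_intros) (use MD in auto)
    then show "continuous_on (?U \<times> M) (\<lambda>(h, x). partial_deriv i T x * partial_deriv j E (x + h *\<^sub>R ?a))"
      by (simp add: case_prod_unfold)
  qed (use d in auto)
  have 2: "((\<lambda>h. integral K (\<lambda>x. T (x + (-h) *\<^sub>R ?a) * partial_deriv i S x)) has_real_derivative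
      integral K (\<lambda>x. - partial_deriv j T (x + (-0) *\<^sub>R ?a) * partial_deriv i S x)) (at 0)"
  proof (rule has_real_derivative_integral_compact[OF K(1), where U = ?U])
    fix h x assume h: "h \<in> ?U" and x: "x \<in> K"
    have "T differentiable (at (x + (-h) *\<^sub>R ?a))"
      using T shiftD[OF x, of "-h"] h by (auto simp: C1_on_def)
    from DERIV_mirror[THEN iffD1, OF has_real_derivative_line[OF this]]
    have "((\<lambda>h. T (x + (-h) *\<^sub>R ?a)) has_real_derivative - partial_deriv j T (x + (-h) *\<^sub>R ?a)) (at h)"
      by simp
    then show "((\<lambda>h. T (x + (-h) *\<^sub>R ?a) * partial_deriv i S x) has_real_derivative
        - partial_deriv j T (x + (-h) *\<^sub>R ?a) * partial_deriv i S x) (at h)"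
      by (rule DERIV_cmult_right)
  next
    fix h assume h: "h \<in> ?U"
    have "continuous_on K (\<lambda>x. T (x + (-h) *\<^sub>R ?a))"
    proof (rule continuous_on_compose2[OF C1_on_continuous[OF T]])
      show "(\<lambda>x. x + (-h) *\<^sub>R ?a) ` K \<subseteq> D"
        using h by (intro image_subsetI shiftD) auto
    qed (intro continuous_intros)
    moreover have "continuous_on K (partial_deriv i S)"
      by (rule C1_on_continuous_partial_subset[OF S(1) K(2)])
    ultimately show "continuous_on K (\<lambda>x. T (x + (-h) *\<^sub>R ?a) * partial_deriv i S x)"
      by (rule continuous_on_mult)
  next
    have "continuous_on (?U \<times> K) (\<lambda>p. partial_deriv j T (snd p + (- fst p) *\<^sub>R ?a))"
    proof (rule continuous_on_compose2[OF C1_on_continuous_partial[OF T]])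
      show "(\<lambda>p. snd p + (- fst p) *\<^sub>R ?a) ` (?U \<times> K) \<subseteq> D"
        by (intro image_subsetI shiftD) auto
    qed (intro continuous_intros)
    moreover have "continuous_on (?U \<times> K) (\<lambda>p. partial_deriv i S (snd p))"
      by (intro continuous_on_compose2[OF C1_on_continuous_partial[OF S(1)]] continuous_intros)
        (use K in auto)
    ultimately have "continuous_on (?U \<times> K)
        (\<lambda>p. - partial_deriv j T (snd p + (- fst p) *\<^sub>R ?a) * partial_deriv i S (snd p))"
      by (intro continuous_intros)
    then show "continuous_on (?U \<times> K)
        (\<lambda>(h, x). - partial_deriv j T (x + (-h) *\<^sub>R ?a) * partial_deriv i S x)"
      by (simp add: case_prod_unfold)
  qed (use d in auto)
  from DERIV_minus[OF 2]
  have "((\<lambda>h. integral M (\<lambda>x. partial_deriv i T x * E (x + h *\<^sub>R ?a))) has_real_derivative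
      - integral K (\<lambda>x. - partial_deriv j T (x + (-0) *\<^sub>R ?a) * partial_deriv i S x)) (at 0)"
  proof (rule has_field_derivative_transform_within_open[where S = ?U])
    fix h assume "h \<in> ?U"
    then show "- integral K (\<lambda>x. T (x + (-h) *\<^sub>R ?a) * partial_deriv i S x)
        = integral M (\<lambda>x. partial_deriv i T x * E (x + h *\<^sub>R ?a))"
      by (simp only: ibp)
  qed (use d in auto)
  from DERIV_unique[OF 1 this]
  have "integral M (\<lambda>x. partial_deriv i T x * partial_deriv j E x)
      = integral K (\<lambda>x. partial_deriv j T x * partial_deriv i S x)"
    by simp
  moreover have "integral M (\<lambda>x. partial_deriv i T x * partial_deriv j E x)
      = integral K (\<lambda>x. partial_deriv i T x * partial_deriv j E x)"
    by (rule integral_eq_if_zero_outside[OF KM]) (simp add: ext(2))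
  moreover have "\<dots> = integral K (\<lambda>x. partial_deriv i T x * partial_deriv j S x)"
    by (rule Henstock_Kurzweil_Integration.integral_cong) (simp add: ext(2))
  ultimately show ?thesis by simp
qed

lemma integral_partial_deriv_swap:
  fixes T S :: "real ^ 'n \<Rightarrow> 'e::euclidean_space"
  assumes D: "open D" and K: "compact K" "K \<subseteq> D" and T: "C1_on D T"
    and S: "C1_on D S" "\<forall>x\<in>D - K. S x = 0"
  shows "integral K (\<lambda>x. partial_deriv i T x \<bullet> partial_deriv j S x)
    = integral K (\<lambda>x. partial_deriv j T x \<bullet> partial_deriv i S x)"
proof -
  have expand: "integral K (\<lambda>x. partial_deriv i T x \<bullet> partial_deriv j S x)
      = (\<Sum>b\<in>Basis. integral K (\<lambda>x. partial_deriv i (\<lambda>x. T x \<bullet> b) x * partial_deriv j (\<lambda>x. S x \<bullet> b) x))"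
    (is "?L = ?R") for i j
  proof -
    have "?L = integral K (\<lambda>x. \<Sum>b\<in>Basis. partial_deriv i (\<lambda>x. T x \<bullet> b) x * partial_deriv j
        (\<lambda>x. S x \<bullet> b) x)"
    proof (rule Henstock_Kurzweil_Integration.integral_cong)
      fix x assume "x \<in> K"
      then have "x \<in> D" using K by auto
      then show "partial_deriv i T x \<bullet> partial_deriv j S x
          = (\<Sum>b\<in>Basis. partial_deriv i (\<lambda>x. T x \<bullet> b) x * partial_deriv j (\<lambda>x. S x \<bullet> b) x)"
        by (simp add: partial_deriv_inner_const[OF T] partial_deriv_inner_const[OF S(1)]
            euclidean_inner[symmetric])
    qed
    also have "\<dots> = ?R"
    proof (rule Henstock_Kurzweil_Integration.integral_sum)
      fix b :: 'e
      have "continuous_on K (partial_deriv i (\<lambda>x. T x \<bullet> b))" "continuous_on K (partial_deriv j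
          (\<lambda>x. S x \<bullet> b))"
        by (intro C1_on_continuous_partial_subset[OF _ K(2)] C1_on_inner_const T S(1))+
      then show "(\<lambda>x. partial_deriv i (\<lambda>x. T x \<bullet> b) x * partial_deriv j
          (\<lambda>x. S x \<bullet> b) x) integrable_on K"
        by (intro integrable_on_compact[OF K(1)] continuous_on_mult)
    qed simp
    finally show ?thesis .
  qed
  show ?thesis
    unfolding expand
    by (intro sum.cong refl integral_partial_deriv_swap_real[OF D K] C1_on_inner_const T S)
      (simp add: S(2))
qed

section \<open>The second variation of volume\<close>

text \<open>The coordinate frame of a map, as a family of vectors at each point.\<close>

definition frame :: "(real ^ 'n \<Rightarrow> 'e::real_normed_vector) \<Rightarrow> real ^ 'n \<Rightarrow> 'n \<Rightarrow> 'e"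
  where "frame X x i = partial_deriv i X x"

lemma volume_eq: "volume K X = integral K (\<lambda>x. area (frame X x))"
proof -
  have "induced_metric X x = gram (frame X x)" for x
    by (simp add: induced_metric_def gram_def frame_def)
  then show ?thesis by (simp add: volume_def area_def)
qed

text \<open>Differentiating twice under the integral sign; the Gram determinant stays positive for small
  times because \<open>K\<close> is compact.\<close>

lemma second_variation:
  fixes F F' F'' :: "real \<Rightarrow> real ^ 'n \<Rightarrow> 'e::euclidean_space"
  assumes D: "open D" and K: "compact K" "K \<subseteq> D" and \<epsilon>: "0 < \<epsilon>"
    and F': "\<And>t x. t \<in> {-\<epsilon><..<\<epsilon>} \<Longrightarrow> x \<in> D \<Longrightarrow> ((\<lambda>s. F s x) has_vector_derivative F' t x) (at t)"
    and F'': "\<And>t x. t \<in> {-\<epsilon><..<\<epsilon>} \<Longrightarrow> x \<in> D \<Longrightarrow> ((\<lambda>s. F' s x) has_vector_derivative F'' t x) (at t)"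
    and C: "C1_family {-\<epsilon><..<\<epsilon>} D F" "C1_family {-\<epsilon><..<\<epsilon>} D F'" "C1_family {-\<epsilon><..<\<epsilon>} D F''"
    and nondeg: "\<And>x. x \<in> K \<Longrightarrow> 0 < det (gram (frame (F 0) x))"
  defines "c \<equiv> integral K (\<lambda>x. \<Sum>j\<in>UNIV.
      area_hess (frame (F 0) x) (frame (F' 0) x) j \<bullet> frame (F' 0) x j
      + area_grad (frame (F 0) x) j \<bullet> frame (F'' 0) x j)"
  shows "\<exists>A'. (\<forall>\<^sub>F t in nhds 0. ((\<lambda>t. volume K (F t)) has_real_derivative A' t) (at t)) \<and>
    (A' has_real_derivative c) (at 0)"
proof -
  let ?I = "{-\<epsilon><..<\<epsilon>}"
  have cont: "continuous_on (?I \<times> D) (\<lambda>p. frame (G (fst p)) (snd p) i)" if "C1_family ?I D G"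
    for G :: "real \<Rightarrow> real ^ 'n \<Rightarrow> 'e" and i
    using that by (simp add: C1_family_def frame_def case_prod_unfold)
  have diff: "G t differentiable (at x)" if "C1_family ?I D G" "t \<in> ?I" "x \<in> D"
    for G :: "real \<Rightarrow> real ^ 'n \<Rightarrow> 'e" and t x
    using that by (simp add: C1_family_def)
  have dF: "((\<lambda>s. frame (F s) x i) has_vector_derivative frame (F' t) x i) (at t)"
    if "t \<in> ?I" "x \<in> D" for t x i
    unfolding frame_def
    using that by (intro has_vector_derivative_partial_deriv[OF D that(2,1) F'] diff C)
  have dF': "((\<lambda>s. frame (F' s) x i) has_vector_derivative frame (F'' t) x i) (at t)"
    if "t \<in> ?I" "x \<in> D" for t x i
    unfolding frame_def
    using that by (intro has_vector_derivative_partial_deriv[OF D that(2,1) F''] diff C)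
  define W where "W = (?I \<times> D) \<inter> (\<lambda>p. det (gram (frame (F (fst p)) (snd p)))) -` {0<..}"
  have "open W"
  proof -
    have "continuous_on (?I \<times> D) (\<lambda>p. det (gram (frame (F (fst p)) (snd p))))"
      by (rule continuous_on_det_gram, rule cont, rule C)
    then show ?thesis
      unfolding W_def
      by (rule continuous_open_preimage) (intro open_Times open_greaterThanLessThan open_greaterThan D)+
  qed
  moreover have "{0} \<times> K \<subseteq> W" using nondeg \<epsilon> K(2) by (auto simp: W_def)
  ultimately have "\<exists>U. 0 \<in> U \<and> open U \<and> U \<times> K \<subseteq> W"
    by (rule Elementary_Topology.tube_lemma[OF K(1)])
  then obtain U where U: "0 \<in> U" "open U" "U \<times> K \<subseteq> W" by blast
  \<comment> \<open>For empty \<open>K\<close> the neighbourhood \<open>U\<close> is unconstrained, so that case is separate.\<close>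
  have UI: "U \<subseteq> ?I" if ne: "K \<noteq> {}"
  proof
    fix t assume "t \<in> U"
    moreover obtain x where "x \<in> K" using ne by blast
    ultimately have "(t, x) \<in> W" using U(3) by blast
    then show "t \<in> ?I" by (simp add: W_def)
  qed
  show ?thesis
  proof (cases "K = {}")
    case True
    then show ?thesis by (intro exI[of _ "\<lambda>_. 0"]) (simp add: volume_eq c_def)
  next
    case False
    note UI = UI[OF False]
    have pos: "0 < det (gram (frame (F t) x))" if "t \<in> U" "x \<in> K" for t x
      using U(3) that by (auto simp: W_def)
    have contU: "continuous_on (U \<times> K) (\<lambda>p. frame (G (fst p)) (snd p) i)" if "C1_family ?I D G"
      for G :: "real \<Rightarrow> real ^ 'n \<Rightarrow> 'e" and i
      by (rule continuous_on_subset[OF cont[OF that]]) (use UI K(2) in auto)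
    have slice: "continuous_on K (h t)" if "t \<in> U" "continuous_on (U \<times> K) (\<lambda>(t, x). h t x)"
      for t and h :: "real \<Rightarrow> real ^ 'n \<Rightarrow> real"
      using continuous_on_compose2[OF that(2) continuous_on_Pair[OF continuous_on_const continuous_on_id, of K t]]
        that(1) by auto
    let ?P = "\<lambda>t x. frame (F t) x" and ?P' = "\<lambda>t x. frame (F' t) x" and ?P'' = "\<lambda>t x. frame (F'' t) x"
    define f' where "f' t x = (\<Sum>j\<in>UNIV. area_grad (?P t x) j \<bullet> ?P' t x j)" for t x
    define f'' where "f'' t x = (\<Sum>j\<in>UNIV. area_hess (?P t x) (?P' t x) j \<bullet> ?P' t x j
      + area_grad (?P t x) j \<bullet> ?P'' t x j)" for t x
    have dP: "((\<lambda>s. ?P s x i) has_derivative (\<lambda>h. h *\<^sub>R ?P' t x i)) (at t)"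
      and dP': "((\<lambda>s. ?P' s x i) has_derivative (\<lambda>h. h *\<^sub>R ?P'' t x i)) (at t)"
      if "t \<in> U" "x \<in> K" for t x i
    proof -
      have "t \<in> ?I" "x \<in> D" using UI K(2) that by blast+
      then show "((\<lambda>s. ?P s x i) has_derivative (\<lambda>h. h *\<^sub>R ?P' t x i)) (at t)"
        "((\<lambda>s. ?P' s x i) has_derivative (\<lambda>h. h *\<^sub>R ?P'' t x i)) (at t)"
        using dF[of t x i] dF'[of t x i] by (simp_all add: has_vector_derivative_def)
    qed
    have d1: "((\<lambda>s. area (?P s x)) has_real_derivative f' t x) (at t)" if "t \<in> U" "x \<in> K" for t x
    proof -
      have "((\<lambda>s. area (?P s x)) has_derivative
          (\<lambda>h. \<Sum>k\<in>UNIV. area_grad (?P t x) k \<bullet> (h *\<^sub>R ?P' t x k))) (at t)"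
        by (rule has_derivative_area[OF dP[OF that] pos[OF that]])
      then show ?thesis
        by (rule has_derivative_imp_has_field_derivative) (simp add: f'_def sum_distrib_left)
    qed
    have d2: "((\<lambda>s. f' s x) has_real_derivative f'' t x) (at t)" if "t \<in> U" "x \<in> K" for t x
    proof -
      have "((\<lambda>s. f' s x) has_derivative
          (\<lambda>h. \<Sum>j\<in>UNIV. area_grad (?P t x) j \<bullet> (h *\<^sub>R ?P'' t x j)
            + area_hess (?P t x) (\<lambda>k. h *\<^sub>R ?P' t x k) j \<bullet> ?P' t x j)) (at t)"
        unfolding f'_def
        by (intro has_derivative_sum has_derivative_inner dP' that
            has_derivative_area_grad[OF dP[OF that] pos[OF that]])
      then show ?thesis
        by (rule has_derivative_imp_has_field_derivative)
          (simp add: f''_def sum_distrib_left area_hess_scaleR algebra_simps)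
    qed
    have c0: "continuous_on (U \<times> K) (\<lambda>(t, x). area (?P t x))"
      unfolding case_prod_unfold by (intro continuous_on_area contU C)
    have c1: "continuous_on (U \<times> K) (\<lambda>(t, x). f' t x)"
      unfolding case_prod_unfold f'_def
      by (intro continuous_on_sum continuous_on_inner continuous_on_area_grad contU C)
        (use pos in auto)
    have c2: "continuous_on (U \<times> K) (\<lambda>(t, x). f'' t x)"
      unfolding case_prod_unfold f''_def
      by (intro continuous_on_sum continuous_on_add continuous_on_inner continuous_on_area_grad
          continuous_on_area_hess contU C) (use pos in auto)
    have v1: "((\<lambda>t. volume K (F t)) has_real_derivative integral K (f' t)) (at t)" if "t \<in> U" for t
      unfolding volume_eq
      by (rule has_real_derivative_integral_compact[OF K(1) U(2) that d1 slice[OF _ c0] c1])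
    have v2: "((\<lambda>t. integral K (f' t)) has_real_derivative integral K (f'' 0)) (at 0)"
      by (rule has_real_derivative_integral_compact[OF K(1) U(2) U(1) d2 slice[OF _ c1] c2])
    have "\<forall>\<^sub>F t in nhds 0. ((\<lambda>t. volume K (F t)) has_real_derivative integral K (f' t)) (at t)"
      using v1 U(1,2) unfolding eventually_nhds by blast
    moreover have "integral K (f'' 0) = c"
      unfolding c_def f''_def by simp
    ultimately show ?thesis using v2 by metis
  qed
qed

section \<open>Stationary immersions and their second variation form\<close>

text \<open>The \<open>C2\<close> immersions of an open set into a Euclidean space.\<close>

locale immersion =
  fixes D :: "(real ^ 'n) set" and X :: "real ^ 'n \<Rightarrow> 'e::euclidean_space"
  assumes open_D: "open D"
    and C2: "C2_on D X"
    and nondeg: "x \<in> D \<Longrightarrow> 0 < det (gram (frame X x))"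
begin

lemma C1_frame: "C1_on D (\<lambda>x. frame X x i)"
  using C2 by (simp add: C2_on_def frame_def)

lemma partial_frame_commute:
  "x \<in> D \<Longrightarrow> partial_deriv j (\<lambda>x. frame X x i) x = partial_deriv i (\<lambda>x. frame X x j) x"
  using partial_deriv_commute[OF open_D C2] by (simp add: frame_def)

lemma
  shows C1_dual: "C1_on D (\<lambda>x. dual (frame X x) i)"
    and partial_deriv_dual: "x \<in> D \<Longrightarrow> partial_deriv k (\<lambda>x. dual (frame X x) i) x
      = dual_deriv (frame X x) (\<lambda>j. partial_deriv k (\<lambda>x. frame X x j) x) i"
    and C1_area_grad: "C1_on D (\<lambda>x. area_grad (frame X x) i)"
    and partial_deriv_area_grad: "x \<in> D \<Longrightarrow> partial_deriv k (\<lambda>x. area_grad (frame X x) i) x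
      = area_hess (frame X x) (\<lambda>j. partial_deriv k (\<lambda>x. frame X x j) x) i"
proof -
  let ?R = "\<lambda>x k j. partial_deriv k (\<lambda>x. frame X x j) x"
  have R: "frechet_derivative (\<lambda>x. frame X x j) (at x) (axis k 1) = ?R x k j" for x j k
    by (simp add: partial_deriv_def)
  have d: "((\<lambda>y. frame X y j) has_derivative frechet_derivative (\<lambda>x. frame X x j) (at x)) (at x)"
    if "x \<in> D" for x j by (rule C1_on_has_derivative[OF C1_frame that])
  note du = has_derivative_dual[where P = "frame X", OF d nondeg]
    and da = has_derivative_area_grad[where P = "frame X", OF d nondeg]
  have c: "continuous_on D (\<lambda>x. frame X x j)" "continuous_on D (\<lambda>x. ?R x k j)" for j k
    using C1_on_continuous[OF C1_frame] C1_on_continuous_partial[OF C1_frame] by auto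
  show "C1_on D (\<lambda>x. dual (frame X x) i)"
    by (rule C1_onI[OF du]) (simp_all add: R continuous_on_dual_deriv c nondeg)
  show "C1_on D (\<lambda>x. area_grad (frame X x) i)"
    by (rule C1_onI[OF da]) (simp_all add: R continuous_on_area_hess c nondeg)
  show "partial_deriv k (\<lambda>x. dual (frame X x) i) x = dual_deriv (frame X x) (?R x k) i" if "x \<in> D"
    using partial_deriv_eq[OF du[OF that that]] by (simp add: R)
  show "partial_deriv k (\<lambda>x. area_grad (frame X x) i) x = area_hess (frame X x) (?R x k) i" if "x \<in> D"
    using partial_deriv_eq[OF da[OF that that]] by (simp add: R)
qed

text \<open>The second derivatives of \<open>X\<close> and the gradient of the logarithm of the area integrand.\<close>

definition hess :: "real ^ 'n \<Rightarrow> 'n \<Rightarrow> 'n \<Rightarrow> 'e"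
  where "hess x k i = partial_deriv k (\<lambda>x. frame X x i) x"

definition dlog :: "real ^ 'n \<Rightarrow> 'n \<Rightarrow> real"
  where "dlog x k = (\<Sum>i\<in>UNIV. dual (frame X x) i \<bullet> hess x k i)"

lemma hess_commute: "x \<in> D \<Longrightarrow> hess x k i = hess x i k"
  by (simp add: hess_def partial_frame_commute)

lemma partial_deriv_area_grad_hess:
  "x \<in> D \<Longrightarrow> partial_deriv k (\<lambda>x. area_grad (frame X x) i) x
    = area (frame X x) *\<^sub>R (dlog x k *\<^sub>R dual (frame X x) i + dual_deriv (frame X x) (hess x k) i)"
  by (simp add: partial_deriv_area_grad area_hess_def dlog_def hess_def[abs_def])

lemma partial_deriv_dual_hess:
  "x \<in> D \<Longrightarrow> partial_deriv k (\<lambda>x. dual (frame X x) i) x = dual_deriv (frame X x) (hess x k) i"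
  by (simp add: partial_deriv_dual hess_def[abs_def])

text \<open>The divergence of the gradient of area is the mean curvature vector, times the area
  integrand. Its tangential part vanishes because second derivatives commute.\<close>

lemma sum_partial_area_grad:
  assumes x: "x \<in> D"
  shows "(\<Sum>i\<in>UNIV. partial_deriv i (\<lambda>x. area_grad (frame X x) i) x) = area (frame X x) *\<^sub>R
    nproj (frame X x) (\<Sum>i\<in>UNIV. \<Sum>k\<in>UNIV. (dual (frame X x) i \<bullet> dual (frame X x) k) *\<^sub>R hess x i k)"
proof -
  let ?P = "frame X x" and ?d = "dual (frame X x)"
  have "(\<Sum>i\<in>UNIV. \<Sum>k\<in>UNIV. (?d i \<bullet> hess x i k) *\<^sub>R ?d k) = (\<Sum>k\<in>UNIV. dlog x k *\<^sub>R ?d k)"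
    by (subst sum.swap) (simp add: dlog_def scaleR_sum_left hess_commute[OF x])
  then have "(\<Sum>i\<in>UNIV. dlog x i *\<^sub>R ?d i + dual_deriv ?P (hess x i) i)
      = nproj ?P (\<Sum>i\<in>UNIV. \<Sum>k\<in>UNIV. (?d i \<bullet> ?d k) *\<^sub>R hess x i k)"
    by (simp add: dual_deriv_def sum.distrib sum_subtractf nproj_sum nproj_scaleR)
  then show ?thesis
    by (simp add: partial_deriv_area_grad_hess[OF x] scaleR_sum_right[symmetric])
qed

end

text \<open>The Euler--Lagrange equation of the area integrand, in all components of the ambient space.\<close>

locale stationary_immersion = immersion D X
  for D :: "(real ^ 'n) set" and X :: "real ^ 'n \<Rightarrow> 'e::euclidean_space" +
  assumes stationary: "x \<in> D \<Longrightarrow> (\<Sum>j\<in>UNIV. partial_deriv j (\<lambda>y. area_grad (frame X y) j) x) = 0"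
begin

context
  fixes K :: "(real ^ 'n) set"
  assumes K: "compact K" "K \<subseteq> D"
begin

lemma integrable_K: "continuous_on D u \<Longrightarrow> u integrable_on K" for u :: "real ^ 'n \<Rightarrow> real"
  by (meson integrable_on_compact K continuous_on_subset)

lemma integral_cong_K: "(\<And>x. x \<in> D \<Longrightarrow> u x = v x) \<Longrightarrow> integral K u = integral K v"
  for u v :: "real ^ 'n \<Rightarrow> real"
  using K by (intro Henstock_Kurzweil_Integration.integral_cong) auto

lemma first_variation:
  assumes W: "C1_on D W" "\<forall>x\<in>D - K. W x = 0"
  shows "integral K (\<lambda>x. \<Sum>j\<in>UNIV. area_grad (frame X x) j \<bullet> partial_deriv j W x) = 0"
proof -
  let ?E = "\<lambda>j x. area_grad (frame X x) j"
  have "integral K (\<lambda>x. \<Sum>j\<in>UNIV. ?E j x \<bullet> partial_deriv j W x)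
      = integral K (\<lambda>x. \<Sum>j\<in>UNIV. partial_deriv j (\<lambda>x. ?E j x \<bullet> W x) x)"
  proof (rule integral_cong_K)
    fix x assume x: "x \<in> D"
    have "(\<Sum>j\<in>UNIV. partial_deriv j (?E j) x \<bullet> W x) = 0"
      using stationary[OF x] by (simp add: inner_sum_left[symmetric])
    then show "(\<Sum>j\<in>UNIV. ?E j x \<bullet> partial_deriv j W x)
        = (\<Sum>j\<in>UNIV. partial_deriv j (\<lambda>x. ?E j x \<bullet> W x) x)"
      by (simp add: partial_deriv_inner[OF C1_area_grad W(1) x] sum.distrib)
  qed
  also have "\<dots> = (\<Sum>j\<in>UNIV. integral K (partial_deriv j (\<lambda>x. ?E j x \<bullet> W x)))"
    by (rule Henstock_Kurzweil_Integration.integral_sum)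
      (auto intro!: integrable_K C1_on_continuous_partial C1_on_inner C1_area_grad W)
  also have "\<dots> = 0"
    by (rule sum.neutral)
      (auto intro!: integral_partial_deriv_eq_0[OF open_D K C1_on_inner[OF C1_area_grad W(1)]]
        simp: W(2))
  finally show ?thesis .
qed

text \<open>Tangential fields are Jacobi fields: the second variation form pairs them to zero with every
  compactly supported \<open>C1\<close> field. The pairing is the sum of the expressions \<open>\<partial>\<^sub>i(\<xi>\<^sub>i E\<^sub>j) \<bullet> \<partial>\<^sub>j V
  - \<partial>\<^sub>j\<xi>\<^sub>i E\<^sub>j \<bullet> \<partial>\<^sub>i V\<close>, where \<open>E\<^sub>j\<close> is the gradient of area; swapping the two partial derivatives
  in the first term leaves \<open>\<xi>\<^sub>i \<partial>\<^sub>jE\<^sub>j \<bullet> \<partial>\<^sub>i V\<close>, whose sum over \<open>j\<close> vanishes.\<close>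

lemma tangential_second_variation:
  assumes \<xi>: "\<And>i. C1_on D (\<xi> i)" and V: "C1_on D V" "\<forall>x\<in>D - K. V x = 0"
  shows "integral K (\<lambda>x. \<Sum>j\<in>UNIV.
    area_hess (frame X x) (frame (\<lambda>y. \<Sum>i\<in>UNIV. \<xi> i y *\<^sub>R frame X y i) x) j \<bullet> frame V x j) = 0"
proof -
  let ?E = "\<lambda>j x. area_grad (frame X x) j"
  let ?T = "\<lambda>i j x. \<xi> i x *\<^sub>R ?E j x"
  let ?r = "\<lambda>i j x. partial_deriv j (\<xi> i) x * (?E j x \<bullet> partial_deriv i V x)"
  have T: "C1_on D (?T i j)" for i j
    by (intro C1_on_scaleR \<xi> C1_area_grad)
  have dT: "partial_deriv k (?T i j) x = \<xi> i x *\<^sub>R partial_deriv k (?E j) x + partial_deriv k (\<xi> i) x *\<^sub>R ?E j x"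
    if "x \<in> D" for i j k x
    by (rule partial_deriv_scaleR[OF \<xi> C1_area_grad that])
  have pointwise: "(\<Sum>j\<in>UNIV. area_hess (frame X x) (frame
      (\<lambda>y. \<Sum>i\<in>UNIV. \<xi> i y *\<^sub>R frame X y i) x) j \<bullet> frame V x j)
      = (\<Sum>i\<in>UNIV. \<Sum>j\<in>UNIV. partial_deriv i (?T i j) x \<bullet> partial_deriv j V x - ?r i j x)"
    if x: "x \<in> D" for x
  proof -
    let ?P = "frame X x" and ?S = "\<lambda>j. partial_deriv j V x"
    let ?c = "\<lambda>i j. partial_deriv j (\<xi> i) x"
    have R: "frame (\<lambda>y. \<Sum>i\<in>UNIV. \<xi> i y *\<^sub>R frame X y i) x
        = (\<lambda>j. (\<Sum>i\<in>UNIV. \<xi> i x *\<^sub>R partial_deriv i (\<lambda>y. frame X y j) x) + (\<Sum>i\<in>UNIV. ?c i j *\<^sub>R ?P i))"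
    proof
      fix j
      have "frame (\<lambda>y. \<Sum>i\<in>UNIV. \<xi> i y *\<^sub>R frame X y i) x j
          = (\<Sum>i\<in>UNIV. \<xi> i x *\<^sub>R partial_deriv j (\<lambda>y. frame X y i) x + ?c i j *\<^sub>R ?P i)"
        unfolding frame_def[of "\<lambda>y. \<Sum>i\<in>UNIV. \<xi> i y *\<^sub>R frame X y i"]
        by (subst partial_deriv_sum[where D = D])
          (simp_all add: x C1_on_scaleR \<xi> C1_frame partial_deriv_scaleR[OF \<xi> C1_frame x])
      then show "frame (\<lambda>y. \<Sum>i\<in>UNIV. \<xi> i y *\<^sub>R frame X y i) x j
          = (\<Sum>i\<in>UNIV. \<xi> i x *\<^sub>R partial_deriv i (\<lambda>y. frame X y j) x) + (\<Sum>i\<in>UNIV. ?c i j *\<^sub>R ?P i)"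
        by (simp add: sum.distrib partial_frame_commute[OF x, of j])
    qed
    have 1: "(\<Sum>j\<in>UNIV. area_hess ?P (\<lambda>j. \<Sum>i\<in>UNIV. \<xi> i x *\<^sub>R partial_deriv i
        (\<lambda>y. frame X y j) x) j \<bullet> ?S j)
        = (\<Sum>i\<in>UNIV. \<Sum>j\<in>UNIV. \<xi> i x * (partial_deriv i (?E j) x \<bullet> ?S j))"
      by (subst sum.swap)
        (simp add: area_hess_sum area_hess_scaleR partial_deriv_area_grad[OF x] inner_sum_left)
    have 2: "(\<Sum>j\<in>UNIV. area_hess ?P (\<lambda>j. \<Sum>i\<in>UNIV. ?c i j *\<^sub>R ?P i) j \<bullet> ?S j)
        = (\<Sum>i\<in>UNIV. \<Sum>j\<in>UNIV. ?c i i * (?E j x \<bullet> ?S j)) - (\<Sum>i\<in>UNIV. \<Sum>j\<in>UNIV. ?r i j x)"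
    proof -
      have d: "dual ?P i \<bullet> (\<Sum>k\<in>UNIV. ?c k j *\<^sub>R ?P k) = ?c i j" for i j
      proof -
        have "dual ?P i \<bullet> (\<Sum>k\<in>UNIV. ?c k j *\<^sub>R ?P k) = (\<Sum>k\<in>UNIV. if i = k then ?c k j else 0)"
          unfolding inner_sum_right
          by (intro sum.cong) (auto simp: inner_dual_frame[OF nondeg[OF x]])
        then show ?thesis by simp
      qed
      have n: "nproj ?P (\<Sum>k\<in>UNIV. ?c k j *\<^sub>R ?P k) = 0" for j
        by (simp add: nproj_sum nproj_scaleR nproj_frame[OF nondeg[OF x]])
      show ?thesis
        unfolding sum_area_hess_inner[OF nondeg[OF x]] d n
        by (simp add: area_grad_def sum_distrib_left sum_distrib_right right_diff_distrib mult_ac)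
          (rule sum.swap)
    qed
    have "(\<Sum>j\<in>UNIV. area_hess ?P (frame (\<lambda>y. \<Sum>i\<in>UNIV. \<xi> i y *\<^sub>R frame X y i) x) j \<bullet> ?S j)
        = (\<Sum>i\<in>UNIV. \<Sum>j\<in>UNIV. \<xi> i x * (partial_deriv i (?E j) x \<bullet> ?S j))
          + ((\<Sum>i\<in>UNIV. \<Sum>j\<in>UNIV. ?c i i * (?E j x \<bullet> ?S j)) - (\<Sum>i\<in>UNIV. \<Sum>j\<in>UNIV. ?r i j x))"
      unfolding R area_hess_add inner_add_left sum.distrib 1 2 ..
    also have "\<dots> = (\<Sum>i\<in>UNIV. \<Sum>j\<in>UNIV. partial_deriv i (?T i j) x \<bullet> ?S j - ?r i j x)"
      by (simp add: dT[OF x] inner_add_left sum.distrib sum_subtractf)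
    finally show ?thesis by (simp add: frame_def[of V])
  qed
  have cr: "continuous_on D (?r i j)" for i j
    by (intro continuous_on_mult continuous_on_inner C1_on_continuous_partial C1_on_continuous
        \<xi> C1_area_grad V)
  have ct: "continuous_on D (\<lambda>x. partial_deriv k (?T i j) x \<bullet> partial_deriv l V x)" for i j k l
    by (intro continuous_on_inner C1_on_continuous_partial T V)
  note I = integrable_K[OF cr] integrable_K[OF ct]
  have "integral K (\<lambda>x. \<Sum>j\<in>UNIV. area_hess (frame X x)
        (frame (\<lambda>y. \<Sum>i\<in>UNIV. \<xi> i y *\<^sub>R frame X y i) x) j \<bullet> frame V x j)
      = integral K (\<lambda>x. \<Sum>i\<in>UNIV. \<Sum>j\<in>UNIV. partial_deriv i (?T i j) x \<bullet> partial_deriv j V x - ?r i j x)"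
    by (rule integral_cong_K) (rule pointwise)
  also have "\<dots> = (\<Sum>i\<in>UNIV. \<Sum>j\<in>UNIV. integral K (\<lambda>x. partial_deriv i (?T i j) x \<bullet> partial_deriv j V x)
      - integral K (?r i j))"
    by (simp add: Henstock_Kurzweil_Integration.integral_sum Henstock_Kurzweil_Integration.integral_diff
        integrable_sum integrable_diff I)
  also have "\<dots> = (\<Sum>i\<in>UNIV. \<Sum>j\<in>UNIV. integral K (\<lambda>x. partial_deriv j (?T i j) x \<bullet> partial_deriv i V x)
      - integral K (?r i j))"
    by (subst integral_partial_deriv_swap[OF open_D K T V]) simp
  also have "\<dots> = integral K (\<lambda>x. \<Sum>i\<in>UNIV. \<Sum>j\<in>UNIV. partial_deriv j (?T i j) x \<bullet> partial_deriv i V x - ?r i j x)"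
    by (simp add: Henstock_Kurzweil_Integration.integral_sum Henstock_Kurzweil_Integration.integral_diff
        integrable_sum integrable_diff I)
  also have "\<dots> = integral K (\<lambda>x. 0)"
  proof (rule integral_cong_K)
    fix x assume x: "x \<in> D"
    have "(\<Sum>j\<in>UNIV. partial_deriv j (?T i j) x \<bullet> partial_deriv i V x - ?r i j x)
        = \<xi> i x * ((\<Sum>j\<in>UNIV. partial_deriv j (?E j) x) \<bullet> partial_deriv i V x)" for i
      by (simp add: dT[OF x] inner_add_left inner_sum_left sum_distrib_left)
    then show "(\<Sum>i\<in>UNIV. \<Sum>j\<in>UNIV. partial_deriv j (?T i j) x \<bullet> partial_deriv i V x - ?r i j x) = 0"
      by (simp add: stationary[OF x])
  qed
  finally show ?thesis by simp
qed

text \<open>Hence the second variation of a field only depends on its normal part.\<close>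

lemma
  assumes V: "C1_on D V" "\<forall>x\<in>D - K. V x = 0"
  shows C1_normal_part: "C1_on D (\<lambda>x. nproj (frame X x) (V x))"
    and second_variation_normal_part:
      "integral K (\<lambda>x. \<Sum>j\<in>UNIV. area_hess (frame X x) (frame V x) j \<bullet> frame V x j)
      = integral K (\<lambda>x. \<Sum>j\<in>UNIV. area_hess (frame X x) (frame (\<lambda>y. nproj (frame X y) (V y)) x) j
          \<bullet> frame (\<lambda>y. nproj (frame X y) (V y)) x j)"
proof -
  define \<xi> where "\<xi> i x = dual (frame X x) i \<bullet> V x" for i x
  define T where "T x = (\<Sum>i\<in>UNIV. \<xi> i x *\<^sub>R frame X x i)" for x
  let ?N = "\<lambda>x. nproj (frame X x) (V x)"
  let ?b = "\<lambda>R S x. \<Sum>j\<in>UNIV. area_hess (frame X x) (frame R x) j \<bullet> frame S x j"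
  have N_eq: "?N = (\<lambda>x. V x - T x)"
    by (simp add: nproj_def T_def \<xi>_def)
  have \<xi>: "C1_on D (\<xi> i)" for i
    unfolding \<xi>_def by (intro C1_on_inner C1_dual V)
  have T: "C1_on D T"
    unfolding T_def by (intro C1_on_sum C1_on_scaleR \<xi> C1_frame)
  show N: "C1_on D ?N"
    unfolding N_eq by (rule C1_on_diff[OF V(1) T])
  have T0: "\<forall>x\<in>D - K. T x = 0" and N0: "\<forall>x\<in>D - K. ?N x = 0"
    using V(2) by (auto simp: T_def \<xi>_def nproj_zero)
  have cont: "continuous_on D (?b R S)" if "C1_on D R" "C1_on D S" for R S :: "real ^ 'n \<Rightarrow> 'e"
    using C1_on_continuous[OF C1_frame] C1_on_continuous_partial[OF that(1)] C1_on_continuous_partial[OF that(2)]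
    by (intro continuous_on_sum continuous_on_inner continuous_on_area_hess)
      (auto simp: frame_def[of R] frame_def[of S] nondeg)
  note I = cont[THEN integrable_K]
  have zero: "integral K (?b T N) = 0" if "C1_on D N" "\<forall>x\<in>D - K. N x = 0" for N
    using tangential_second_variation[OF \<xi> that] by (simp add: T_def[abs_def])
  have "integral K (?b V V) = integral K (\<lambda>x. ?b ?N ?N x + (2 * ?b T ?N x + ?b T T x))"
  proof (rule integral_cong_K)
    fix x assume x: "x \<in> D"
    have VNT: "frame V x = (\<lambda>j. frame ?N x j + frame T x j)"
    proof
      fix j
      have "V = (\<lambda>x. ?N x + T x)" by (rule ext) (simp add: fun_cong[OF N_eq])
      then have "frame V x j = partial_deriv j (\<lambda>x. ?N x + T x) x" by (simp add: frame_def)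
      then show "frame V x j = frame ?N x j + frame T x j"
        by (simp only: partial_deriv_add[OF N T x] frame_def)
    qed
    have "?b ?N T x = ?b T ?N x"
      by (rule sum_area_hess_inner_commute[OF nondeg[OF x]])
    then show "?b V V x = ?b ?N ?N x + (2 * ?b T ?N x + ?b T T x)"
      unfolding VNT by (simp add: area_hess_add inner_add_left inner_add_right sum.distrib)
  qed
  also have "\<dots> = integral K (?b ?N ?N) + (2 * integral K (?b T ?N) + integral K (?b T T))"
    by (subst Henstock_Kurzweil_Integration.integral_add
        | (intro integrable_add integrable_on_mult_right I N T)
        | simp add: Henstock_Kurzweil_Integration.integral_add I N T)+
  finally show "integral K (?b V V) = integral K (?b ?N ?N)"
    using zero[OF N N0] zero[OF T T0] by simp
qed

end

end

section \<open>The stability inequality\<close>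

lemma sum_inner_mult_inner_eq:
  fixes d :: "'i::finite \<Rightarrow> 'd::euclidean_space" and U W :: "'i \<Rightarrow> 'e::real_inner"
  shows "(\<Sum>i\<in>UNIV. \<Sum>j\<in>UNIV. (d i \<bullet> d j) * (U i \<bullet> W j))
    = (\<Sum>a\<in>Basis. (\<Sum>i\<in>UNIV. (d i \<bullet> a) *\<^sub>R U i) \<bullet> (\<Sum>j\<in>UNIV. (d j \<bullet> a) *\<^sub>R W j))"
proof -
  have "(\<Sum>a\<in>Basis. (\<Sum>i\<in>UNIV. (d i \<bullet> a) *\<^sub>R U i) \<bullet> (\<Sum>j\<in>UNIV. (d j \<bullet> a) *\<^sub>R W j))
      = (\<Sum>a\<in>Basis. \<Sum>i\<in>UNIV. \<Sum>j\<in>UNIV. ((d i \<bullet> a) * (d j \<bullet> a)) * (U i \<bullet> W j))"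
    by (simp add: inner_sum_left inner_sum_right sum_distrib_left mult.assoc)
      (rule sum.cong[OF refl], subst sum.swap, simp add: mult_ac)
  also have "\<dots> = (\<Sum>i\<in>UNIV. \<Sum>a\<in>Basis. \<Sum>j\<in>UNIV. ((d i \<bullet> a) * (d j \<bullet> a)) * (U i \<bullet> W j))"
    by (rule sum.swap)
  also have "\<dots> = (\<Sum>i\<in>UNIV. \<Sum>j\<in>UNIV. \<Sum>a\<in>Basis. ((d i \<bullet> a) * (d j \<bullet> a)) * (U i \<bullet> W j))"
    by (intro sum.cong refl sum.swap)
  also have "\<dots> = (\<Sum>i\<in>UNIV. \<Sum>j\<in>UNIV. (d i \<bullet> d j) * (U i \<bullet> W j))"
    unfolding sum_distrib_right[symmetric] by (subst (3) euclidean_inner) simp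
  finally show ?thesis by simp
qed

lemma sum_inner_mult_inner_nonneg:
  fixes d :: "'i::finite \<Rightarrow> 'd::euclidean_space" and W :: "'i \<Rightarrow> 'e::real_inner"
  shows "0 \<le> (\<Sum>i\<in>UNIV. \<Sum>j\<in>UNIV. (d i \<bullet> d j) * (W i \<bullet> W j))"
  unfolding sum_inner_mult_inner_eq by (intro sum_nonneg inner_ge_zero)

text \<open>The squared norm of a bilinear map \<open>B\<close>, with indices raised by the Gram matrix of \<open>d\<close>.\<close>

definition sq_norm2 :: "('i::finite \<Rightarrow> 'd::euclidean_space) \<Rightarrow> ('i \<Rightarrow> 'i \<Rightarrow> 'e::real_inner) \<Rightarrow> real"
  where "sq_norm2 d B = (\<Sum>j\<in>UNIV. \<Sum>l\<in>UNIV. (d j \<bullet> d l) *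
    (\<Sum>k\<in>UNIV. \<Sum>i\<in>UNIV. (d k \<bullet> d i) * (B j k \<bullet> B l i)))"

lemma sq_norm2_nonneg: "0 \<le> sq_norm2 d B"
proof -
  let ?w = "\<lambda>c j. \<Sum>k\<in>UNIV. (d k \<bullet> c) *\<^sub>R B j k"
  have "sq_norm2 d B = (\<Sum>j\<in>UNIV. \<Sum>l\<in>UNIV. \<Sum>c\<in>Basis. (d j \<bullet> d l) * (?w c j \<bullet> ?w c l))"
    unfolding sq_norm2_def sum_inner_mult_inner_eq[of d "B _"] by (simp add: sum_distrib_left)
  also have "\<dots> = (\<Sum>j\<in>UNIV. \<Sum>c\<in>Basis. \<Sum>l\<in>UNIV. (d j \<bullet> d l) * (?w c j \<bullet> ?w c l))"
    by (intro sum.cong refl sum.swap)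
  also have "\<dots> = (\<Sum>c\<in>Basis. \<Sum>j\<in>UNIV. \<Sum>l\<in>UNIV. (d j \<bullet> d l) * (?w c j \<bullet> ?w c l))"
    by (rule sum.swap)
  finally show ?thesis
    by (simp add: sum_nonneg sum_inner_mult_inner_nonneg)
qed

text \<open>The Cauchy--Schwarz inequality \<open>|B \<cdot> N|\<^sup>2 \<le> |B|\<^sup>2 |N|\<^sup>2\<close>: remove from \<open>B\<close> its component
  along \<open>N\<close>.\<close>

lemma sq_norm2_inner_le:
  fixes B :: "'i::finite \<Rightarrow> 'i \<Rightarrow> 'e::real_inner"
  shows "sq_norm2 d (\<lambda>j k. B j k \<bullet> N) \<le> sq_norm2 d B * (N \<bullet> N)"
proof (cases "N = 0")
  case True
  then show ?thesis by (simp add: sq_norm2_def)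
next
  case False
  then have N: "N \<bullet> N > 0" by simp
  define C where "C j k = B j k - ((B j k \<bullet> N) / (N \<bullet> N)) *\<^sub>R N" for j k
  have "C j k \<bullet> C l i = B j k \<bullet> B l i - (1 / (N \<bullet> N)) * ((B j k \<bullet> N) * (B l i \<bullet> N))" for i j k l
  proof -
    have "C j k \<bullet> C l i = B j k \<bullet> B l i - (B l i \<bullet> N) / (N \<bullet> N) * (B j k \<bullet> N)
        - (B j k \<bullet> N) / (N \<bullet> N) * (N \<bullet> B l i)
        + (B j k \<bullet> N) / (N \<bullet> N) * ((B l i \<bullet> N) / (N \<bullet> N)) * (N \<bullet> N)"
      unfolding C_def inner_diff_left inner_diff_right inner_scaleR_left inner_scaleR_right
        right_diff_distrib
      by (simp only: mult_ac)
    then show ?thesis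
      using N by (simp add: inner_commute[of N "B l i"] mult.commute)
  qed
  then have "sq_norm2 d C = sq_norm2 d B - (1 / (N \<bullet> N)) * sq_norm2 d (\<lambda>j k. B j k \<bullet> N)"
    by (simp add: sq_norm2_def right_diff_distrib sum_subtractf sum_distrib_left mult_ac)
  then have "(1 / (N \<bullet> N)) * sq_norm2 d (\<lambda>j k. B j k \<bullet> N) \<le> sq_norm2 d B"
    using sq_norm2_nonneg[of d C] by simp
  then show ?thesis using N by (simp add: field_simps)
qed

context stationary_immersion
begin

lemma inner_dual_eq_0:
  assumes "x \<in> D" "\<And>i. v \<bullet> frame X x i = 0"
  shows "dual (frame X x) k \<bullet> v = 0"
  using arg_cong[OF dual_expand[OF nondeg[OF assms(1)]], of "\<lambda>w. w \<bullet> v" k] assms(2)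
  by (simp add: inner_sum_left inner_sum_right inner_commute[of _ v])

lemma continuous_on_hess: "continuous_on D (\<lambda>x. hess x k i)"
  using C1_on_continuous_partial[OF C1_frame] by (simp add: hess_def)

lemma continuous_on_frame: "continuous_on D (\<lambda>x. frame X x i)"
  by (rule C1_on_continuous[OF C1_frame])

lemma continuous_on_dual_frame: "continuous_on D (\<lambda>x. dual (frame X x) i)"
  by (rule C1_on_continuous[OF C1_dual])

lemma continuous_on_dlog: "continuous_on D (\<lambda>x. dlog x k)"
  unfolding dlog_def
  by (intro continuous_on_sum continuous_on_inner continuous_on_hess continuous_on_dual_frame)

end

text \<open>Stationary immersions whose coordinates are harmonic for the induced metric, and for which
  the Christoffel symbols \<open>dual i \<bullet> hess j k\<close> satisfy the trace identity that turns the equation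
  for the logarithm \<open>v\<close> of the area integrand into \<open>\<Delta>v = |A|\<^sup>2 + |\<nabla>v|\<^sup>2\<close>, where \<open>A\<close> is the second
  fundamental form.\<close>

locale log_area_immersion = stationary_immersion D X
  for D :: "(real ^ 'n) set" and X :: "real ^ 'n \<Rightarrow> 'e::euclidean_space" +
  assumes harmonic: "x \<in> D \<Longrightarrow>
      (\<Sum>i\<in>UNIV. \<Sum>j\<in>UNIV. (dual (frame X x) i \<bullet> dual (frame X x) j) *\<^sub>R hess x i j) = 0"
    and christoffel_trace: "x \<in> D \<Longrightarrow>
      (\<Sum>j\<in>UNIV. \<Sum>l\<in>UNIV. \<Sum>a\<in>UNIV. \<Sum>b\<in>UNIV. (dual (frame X x) a \<bullet> dual (frame X x) b) *
        ((dual (frame X x) l \<bullet> hess x a j) * (dual (frame X x) j \<bullet> hess x b l)))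
      = (\<Sum>a\<in>UNIV. \<Sum>b\<in>UNIV. (dual (frame X x) a \<bullet> dual (frame X x) b) * (dlog x a * dlog x b))"
begin

text \<open>Pointwise identities in the dual frame \<open>d\<close> and the second fundamental form \<open>A\<close>.\<close>

context
  fixes x assumes x: "x \<in> D"
begin

abbreviation (input) "P \<equiv> frame X x"
abbreviation (input) "d \<equiv> dual (frame X x)"
abbreviation (input) "A j k \<equiv> nproj (frame X x) (hess x j k)"

lemma inner_dual_harmonic: "(\<Sum>j\<in>UNIV. \<Sum>k\<in>UNIV. (d j \<bullet> d k) * (w \<bullet> hess x j k)) = 0"
  using arg_cong[OF harmonic[OF x], of "\<lambda>v. w \<bullet> v"] by (simp add: inner_sum_right)

lemma dual_deriv_inner_dual:
  "dual_deriv P (hess x j) l \<bullet> d i = - (\<Sum>k\<in>UNIV. (d l \<bullet> hess x j k) * (d k \<bullet> d i))"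
  by (simp add: dual_deriv_def inner_diff_left inner_sum_left nproj_inner_dual[OF nondeg[OF x]])

lemma sum_dual_deriv_inner_dual:
  "(\<Sum>j\<in>UNIV. dual_deriv P (hess x j) l \<bullet> d j) = 0"
proof -
  have "(\<Sum>j\<in>UNIV. dual_deriv P (hess x j) l \<bullet> d j)
      = - (\<Sum>j\<in>UNIV. \<Sum>k\<in>UNIV. (d j \<bullet> d k) * (d l \<bullet> hess x j k))"
    by (simp add: dual_deriv_inner_dual sum_negf inner_commute[of "d _" "d _"] mult.commute)
  then show ?thesis by (simp add: inner_dual_harmonic)
qed

lemma sum_partial_area_grad_inner_dual:
  "(\<Sum>j\<in>UNIV. partial_deriv j (\<lambda>x. area_grad (frame X x) l) x \<bullet> d j)
    = area P * (\<Sum>j\<in>UNIV. (d l \<bullet> d j) * dlog x j)"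
  by (simp add: partial_deriv_area_grad_hess[OF x] inner_add_left sum.distrib
      sum_distrib_left[symmetric] sum_dual_deriv_inner_dual mult.commute)

lemma dual_deriv_inner_dual_deriv:
  "dual_deriv P (hess x j) l \<bullet> dual_deriv P (hess x l) j
    = (\<Sum>k\<in>UNIV. \<Sum>i\<in>UNIV. (d l \<bullet> d k) * (d j \<bullet> d i) * (A j k \<bullet> A l i))
      + (\<Sum>a\<in>UNIV. \<Sum>b\<in>UNIV. (d a \<bullet> d b) * ((d l \<bullet> hess x a j) * (d j \<bullet> hess x b l)))"
proof -
  let ?n = "\<lambda>j l. \<Sum>k\<in>UNIV. (d l \<bullet> d k) *\<^sub>R A j k" and ?t = "\<lambda>j l. \<Sum>k\<in>UNIV. (d l \<bullet> hess x j k) *\<^sub>R d k"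
  have z: "?n j l \<bullet> ?t j' l' = 0" for j l j' l'
    by (simp add: inner_sum_left inner_sum_right nproj_inner_dual[OF nondeg[OF x]])
  have "dual_deriv P (hess x j) l \<bullet> dual_deriv P (hess x l) j = ?n j l \<bullet> ?n l j + ?t j l \<bullet> ?t l j"
    using z[of j l l j] z[of l j j l]
    by (simp add: dual_deriv_def inner_diff_left inner_diff_right inner_commute)
  moreover have "?n j l \<bullet> ?n l j = (\<Sum>k\<in>UNIV. \<Sum>i\<in>UNIV. (d l \<bullet> d k) * (d j \<bullet> d i) * (A j k \<bullet> A l i))"
    by (simp add: inner_sum_left inner_sum_right sum_distrib_left mult_ac) (rule sum.swap)
  moreover have "?t j l \<bullet> ?t l j = (\<Sum>a\<in>UNIV. \<Sum>b\<in>UNIV. (d a \<bullet> d b) * ((d l \<bullet> hess x a j)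
      * (d j \<bullet> hess x b l)))"
    by (simp add: inner_sum_left inner_sum_right sum_distrib_left mult_ac
        hess_commute[OF x, of j] hess_commute[OF x, of l]) (rule sum.swap)
  ultimately show ?thesis by simp
qed

lemma sq_norm2_hess_eq:
  fixes B :: "'n \<Rightarrow> 'n \<Rightarrow> 'b::real_inner"
  assumes "\<And>l i. B l i = B i l"
  shows "(\<Sum>j\<in>UNIV. \<Sum>l\<in>UNIV. \<Sum>k\<in>UNIV. \<Sum>i\<in>UNIV. (d l \<bullet> d k) * (d j \<bullet> d i)
      * (B j k \<bullet> B l i)) = sq_norm2 d B"
proof -
  have "sq_norm2 d B = (\<Sum>j\<in>UNIV. \<Sum>l\<in>UNIV. \<Sum>k\<in>UNIV. \<Sum>i\<in>UNIV. (d i \<bullet> d k) * (d j \<bullet> d l)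
      * (B j k \<bullet> B i l))"
    using assms by (simp add: sq_norm2_def sum_distrib_left mult_ac inner_commute[of "d _" "d _"])
  also have "\<dots> = (\<Sum>j\<in>UNIV. \<Sum>k\<in>UNIV. \<Sum>l\<in>UNIV. \<Sum>i\<in>UNIV. (d i \<bullet> d k) * (d j \<bullet> d l) * (B j k \<bullet> B i l))"
    by (intro sum.cong refl sum.swap)
  also have "\<dots> = (\<Sum>j\<in>UNIV. \<Sum>k\<in>UNIV. \<Sum>i\<in>UNIV. \<Sum>l\<in>UNIV. (d i \<bullet> d k) * (d j \<bullet> d l) * (B j k \<bullet> B i l))"
    by (intro sum.cong refl sum.swap)
  also have "\<dots> = (\<Sum>j\<in>UNIV. \<Sum>i\<in>UNIV. \<Sum>k\<in>UNIV. \<Sum>l\<in>UNIV. (d i \<bullet> d k) * (d j \<bullet> d l) * (B j k \<bullet> B i l))"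
    by (intro sum.cong refl sum.swap)
  finally show ?thesis by simp
qed

lemma sum_partial_area_grad_inner_partial_dual:
  "(\<Sum>j\<in>UNIV. \<Sum>l\<in>UNIV. partial_deriv j (\<lambda>x. area_grad (frame X x) l) x
      \<bullet> partial_deriv l (\<lambda>x. dual (frame X x) j) x)
    = area P * (sq_norm2 d A + (\<Sum>a\<in>UNIV. \<Sum>b\<in>UNIV. (d a \<bullet> d b) * (dlog x a * dlog x b)))"
proof -
  have z: "(\<Sum>l\<in>UNIV. d l \<bullet> dual_deriv P (hess x l) j) = 0" for j
    using sum_dual_deriv_inner_dual[of j] by (simp add: inner_commute)
  have "(\<Sum>j\<in>UNIV. \<Sum>l\<in>UNIV. partial_deriv j (\<lambda>x. area_grad (frame X x) l) x
      \<bullet> partial_deriv l (\<lambda>x. dual (frame X x) j) x)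
    = area P * (\<Sum>j\<in>UNIV. dlog x j * (\<Sum>l\<in>UNIV. d l \<bullet> dual_deriv P (hess x l) j))
      + area P * (\<Sum>j\<in>UNIV. \<Sum>l\<in>UNIV. dual_deriv P (hess x j) l \<bullet> dual_deriv P (hess x l) j)"
    by (simp add: partial_deriv_area_grad_hess[OF x] partial_deriv_dual_hess[OF x] inner_add_left
        sum.distrib sum_distrib_left distrib_left)
  also have "\<dots> = area P * (sq_norm2 d A + (\<Sum>a\<in>UNIV. \<Sum>b\<in>UNIV. (d a \<bullet> d b) * (dlog x a * dlog x b)))"
    unfolding z dual_deriv_inner_dual_deriv sum.distrib christoffel_trace[OF x]
    by (simp add: sq_norm2_hess_eq hess_commute[OF x])
  finally show ?thesis .
qed

end

text \<open>The weak form of \<open>\<Delta>v = |A|\<^sup>2 + |\<nabla>v|\<^sup>2\<close> for \<open>v = log area\<close>. It uses only two derivatives of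
  \<open>X\<close>: each derivative of the gradient of area is again divergence free, in the weak sense, and is
  tested against the dual frame.\<close>

lemma weak_log_area_equation:
  assumes K: "compact K" "K \<subseteq> D" and \<psi>: "C1_on D \<psi>" "\<forall>x\<in>D - K. \<psi> x = 0"
  shows "integral K (\<lambda>x. area (frame X x) *
    (\<psi> x * (sq_norm2 (dual (frame X x)) (\<lambda>j k. nproj (frame X x) (hess x j k))
        + (\<Sum>a\<in>UNIV. \<Sum>b\<in>UNIV. (dual (frame X x) a \<bullet> dual (frame X x) b) * (dlog x a * dlog x b)))
      + (\<Sum>l\<in>UNIV. partial_deriv l \<psi> x *
          (\<Sum>j\<in>UNIV. (dual (frame X x) l \<bullet> dual (frame X x) j) * dlog x j)))) = 0"
    (is "integral K ?L = 0")
proof -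
  let ?E = "\<lambda>l x. area_grad (frame X x) l" and ?d = "\<lambda>j x. dual (frame X x) j"
  let ?W = "\<lambda>j x. \<psi> x *\<^sub>R ?d j x"
  have W: "C1_on D (?W j)" "\<forall>x\<in>D - K. ?W j x = 0" for j
    using \<psi> by (auto intro: C1_on_scaleR C1_dual)
  have I: "(\<lambda>x. partial_deriv a (?E l) x \<bullet> partial_deriv b (?W j) x) integrable_on K" for a b j l
    by (intro integrable_K[OF K] continuous_on_inner C1_on_continuous_partial W C1_area_grad)
  have "integral K ?L = integral K (\<lambda>x. \<Sum>j\<in>UNIV. \<Sum>l\<in>UNIV. partial_deriv j (?E l) x \<bullet> partial_deriv l (?W j) x)"
  proof (rule integral_cong_K[OF K])
    fix x assume x: "x \<in> D"
    have "(\<Sum>j\<in>UNIV. \<Sum>l\<in>UNIV. partial_deriv j (?E l) x \<bullet> partial_deriv l (?W j) x)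
        = \<psi> x * (\<Sum>j\<in>UNIV. \<Sum>l\<in>UNIV. partial_deriv j (?E l) x \<bullet> partial_deriv l (?d j) x)
          + (\<Sum>j\<in>UNIV. \<Sum>l\<in>UNIV. partial_deriv l \<psi> x * (partial_deriv j (?E l) x \<bullet> ?d j x))"
      by (simp add: partial_deriv_scaleR[OF \<psi>(1) C1_dual x] inner_add_right sum.distrib
          sum_distrib_left)
    also have "(\<Sum>j\<in>UNIV. \<Sum>l\<in>UNIV. partial_deriv l \<psi> x * (partial_deriv j (?E l) x \<bullet> ?d j x))
        = (\<Sum>l\<in>UNIV. partial_deriv l \<psi> x * (\<Sum>j\<in>UNIV. partial_deriv j (?E l) x \<bullet> ?d j x))"
      by (subst sum.swap) (simp add: sum_distrib_left)
    finally show "?L x = (\<Sum>j\<in>UNIV. \<Sum>l\<in>UNIV. partial_deriv j (?E l) x \<bullet> partial_deriv l (?W j) x)"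
      unfolding sum_partial_area_grad_inner_partial_dual[OF x] sum_partial_area_grad_inner_dual[OF x]
      by (simp add: algebra_simps sum_distrib_left)
  qed
  also have "\<dots> = (\<Sum>j\<in>UNIV. \<Sum>l\<in>UNIV. integral K (\<lambda>x. partial_deriv j (?E l) x \<bullet> partial_deriv l (?W j) x))"
    by (simp add: Henstock_Kurzweil_Integration.integral_sum integrable_sum I)
  also have "\<dots> = (\<Sum>j\<in>UNIV. \<Sum>l\<in>UNIV. integral K (\<lambda>x. partial_deriv l (?E l) x \<bullet> partial_deriv j (?W j) x))"
    by (subst integral_partial_deriv_swap[OF open_D K C1_area_grad W]) simp
  also have "\<dots> = integral K (\<lambda>x. \<Sum>j\<in>UNIV. \<Sum>l\<in>UNIV. partial_deriv l (?E l) x \<bullet> partial_deriv j (?W j) x)"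
    by (simp add: Henstock_Kurzweil_Integration.integral_sum integrable_sum I)
  also have "\<dots> = integral K (\<lambda>x. 0)"
    by (rule integral_cong_K[OF K]) (simp add: inner_sum_left[symmetric] stationary)
  finally show ?thesis by simp
qed

text \<open>The second variation form of a normal field \<open>N\<close>: adding the weak equation with test function
  \<open>N \<bullet> N\<close> completes the square of \<open>\<nabla>N + N \<otimes> dv\<close>.\<close>

lemma second_variation_normal_nonneg:
  assumes K: "compact K" "K \<subseteq> D" and N: "C1_on D N" "\<forall>x\<in>D - K. N x = 0"
    and normal: "\<And>x i. x \<in> D \<Longrightarrow> N x \<bullet> frame X x i = 0"
  shows "0 \<le> integral K (\<lambda>x. \<Sum>j\<in>UNIV. area_hess (frame X x) (frame N x) j \<bullet> frame N x j)"
proof -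
  let ?\<psi> = "\<lambda>x. N x \<bullet> N x"
  let ?Q = "\<lambda>x. \<Sum>j\<in>UNIV. area_hess (frame X x) (frame N x) j \<bullet> frame N x j"
  let ?L = "\<lambda>x. area (frame X x) *
    (?\<psi> x * (sq_norm2 (dual (frame X x)) (\<lambda>j k. nproj (frame X x) (hess x j k))
        + (\<Sum>a\<in>UNIV. \<Sum>b\<in>UNIV. (dual (frame X x) a \<bullet> dual (frame X x) b) * (dlog x a * dlog x b)))
      + (\<Sum>l\<in>UNIV. partial_deriv l ?\<psi> x *
          (\<Sum>j\<in>UNIV. (dual (frame X x) l \<bullet> dual (frame X x) j) * dlog x j)))"
  have \<psi>: "C1_on D ?\<psi>" "\<forall>x\<in>D - K. ?\<psi> x = 0"
    using N by (auto intro: C1_on_inner)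
  have "continuous_on D ?Q"
    using C1_on_continuous_partial[OF N(1)]
    by (intro continuous_on_sum continuous_on_inner continuous_on_area_hess continuous_on_frame nondeg)
      (auto simp: frame_def[of N])
  then have IQ: "?Q integrable_on K" by (rule integrable_K[OF K])
  have "continuous_on D ?L"
    unfolding sq_norm2_def
    by (intro continuous_on_mult continuous_on_add continuous_on_sum continuous_on_inner
        continuous_on_area continuous_on_nproj continuous_on_dual_frame continuous_on_frame
        continuous_on_hess continuous_on_dlog nondeg C1_on_continuous[OF N(1)]
        C1_on_continuous_partial[OF \<psi>(1)])
  then have IL: "?L integrable_on K" by (rule integrable_K[OF K])
  have "0 \<le> ?Q x + ?L x" if "x \<in> K" for x
  proof -
    have x: "x \<in> D" using that K by auto
    let ?P = "frame X x" and ?d = "dual (frame X x)"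
    let ?A = "\<lambda>j k. nproj ?P (hess x j k)" and ?n = "\<lambda>i. nproj ?P (frame N x i)"
    note nd = nondeg[OF x]
    have nproj_N: "nproj ?P (N x) = N x"
    proof -
      have "?d k \<bullet> N x = 0" for k
        by (rule inner_dual_eq_0[OF x normal[OF x]])
      then show ?thesis by (simp add: nproj_def)
    qed
    have N_inner: "N x \<bullet> w = N x \<bullet> nproj ?P w" for w
      using nproj_inner_nproj[OF nd, of "N x" w] by (simp add: nproj_N)
    have dN: "?d i \<bullet> frame N x j = - (\<Sum>k\<in>UNIV. (?d i \<bullet> ?d k) * (?A j k \<bullet> N x))" for i j
    proof -
      have "partial_deriv j (\<lambda>x. dual (frame X x) i \<bullet> N x) x = 0"
      proof (rule partial_deriv_eq_0[OF open_D x])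
        fix y assume y: "y \<in> D"
        show "dual (frame X y) i \<bullet> N y = 0"
          by (rule inner_dual_eq_0[OF y normal[OF y]])
      qed
      then have "?d i \<bullet> frame N x j = - (dual_deriv ?P (hess x j) i \<bullet> N x)"
        by (simp add: partial_deriv_inner[OF C1_dual N(1) x] partial_deriv_dual_hess[OF x]
            frame_def[of N] eq_neg_iff_add_eq_0)
      moreover have "?d k \<bullet> N x = 0" for k
        using nproj_inner_dual[OF nd, of "N x" k] by (simp add: nproj_N inner_commute)
      ultimately show ?thesis
        by (simp add: dual_deriv_def inner_diff_left inner_sum_left)
    qed
    have div: "(\<Sum>i\<in>UNIV. ?d i \<bullet> frame N x i) = 0"
    proof -
      have "(\<Sum>i\<in>UNIV. ?d i \<bullet> frame N x i) = - (\<Sum>i\<in>UNIV. \<Sum>k\<in>UNIV. (?d i \<bullet> ?d k) * (N x \<bullet> hess x i k))"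
        by (simp add: dN sum_negf inner_commute[of _ "N x"] N_inner[symmetric])
      then show ?thesis by (simp add: inner_dual_harmonic[OF x])
    qed
    have AN: "(\<Sum>i\<in>UNIV. \<Sum>j\<in>UNIV. (?d i \<bullet> frame N x j) * (?d j \<bullet> frame N x i))
        = sq_norm2 ?d (\<lambda>j k. ?A j k \<bullet> N x)"
    proof -
      have "(\<Sum>i\<in>UNIV. \<Sum>j\<in>UNIV. (?d i \<bullet> frame N x j) * (?d j \<bullet> frame N x i))
          = (\<Sum>j\<in>UNIV. \<Sum>l\<in>UNIV. \<Sum>k\<in>UNIV. \<Sum>i\<in>UNIV. (?d l \<bullet> ?d k) * (?d j \<bullet> ?d i) *
              ((?A j k \<bullet> N x) \<bullet> (?A l i \<bullet> N x)))"
        by (subst sum.swap) (simp add: dN sum_product mult_ac)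
      also have "\<dots> = sq_norm2 ?d (\<lambda>j k. ?A j k \<bullet> N x)"
        by (rule sq_norm2_hess_eq[OF x]) (simp add: hess_commute[OF x])
      finally show ?thesis .
    qed
    have d\<psi>: "partial_deriv l ?\<psi> x = 2 * (N x \<bullet> ?n l)" for l
      by (simp add: partial_deriv_inner[OF N(1) N(1) x] inner_commute[of _ "N x"] N_inner[symmetric]
          frame_def[of N])
    have Q: "?Q x = area ?P * ((\<Sum>i\<in>UNIV. \<Sum>j\<in>UNIV. (?d i \<bullet> ?d j) * (?n i \<bullet> ?n j))
        - sq_norm2 ?d (\<lambda>j k. ?A j k \<bullet> N x))"
      unfolding sum_area_hess_inner[OF nd] div AN by simp
    let ?w = "\<lambda>i. ?n i + dlog x i *\<^sub>R N x"
    have sq: "(\<Sum>i\<in>UNIV. \<Sum>j\<in>UNIV. (?d i \<bullet> ?d j) * (?w i \<bullet> ?w j))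
        = (\<Sum>i\<in>UNIV. \<Sum>j\<in>UNIV. (?d i \<bullet> ?d j) * (?n i \<bullet> ?n j))
          + (\<Sum>l\<in>UNIV. 2 * (N x \<bullet> ?n l) * (\<Sum>j\<in>UNIV. (?d l \<bullet> ?d j) * dlog x j))
          + ?\<psi> x * (\<Sum>i\<in>UNIV. \<Sum>j\<in>UNIV. (?d i \<bullet> ?d j) * (dlog x i * dlog x j))"
    proof -
      have s: "(\<Sum>i\<in>UNIV. \<Sum>j\<in>UNIV. (?d i \<bullet> ?d j) * (dlog x i * (N x \<bullet> ?n j)))
          = (\<Sum>i\<in>UNIV. \<Sum>j\<in>UNIV. (?d i \<bullet> ?d j) * (dlog x j * (N x \<bullet> ?n i)))"
        by (subst sum.swap) (simp add: inner_commute[of "?d _" "?d _"])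
      have "(\<Sum>i\<in>UNIV. \<Sum>j\<in>UNIV. (?d i \<bullet> ?d j) * (?w i \<bullet> ?w j))
          = (\<Sum>i\<in>UNIV. \<Sum>j\<in>UNIV. (?d i \<bullet> ?d j) * (?n i \<bullet> ?n j))
          + ((\<Sum>i\<in>UNIV. \<Sum>j\<in>UNIV. (?d i \<bullet> ?d j) * (dlog x i * (N x \<bullet> ?n j)))
            + (\<Sum>i\<in>UNIV. \<Sum>j\<in>UNIV. (?d i \<bullet> ?d j) * (dlog x j * (N x \<bullet> ?n i))))
          + (\<Sum>i\<in>UNIV. \<Sum>j\<in>UNIV. (?d i \<bullet> ?d j) * (dlog x i * dlog x j * ?\<psi> x))"
        by (simp add: inner_add_left inner_add_right distrib_left sum.distrib mult_ac
            inner_commute[of "nproj _ _" "N x"])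
      then show ?thesis
        unfolding s by (simp add: sum_distrib_left mult_ac)
    qed
    have "?Q x + ?L x = area ?P * ((\<Sum>i\<in>UNIV. \<Sum>j\<in>UNIV. (?d i \<bullet> ?d j) * (?w i \<bullet> ?w j))
        + (sq_norm2 ?d ?A * ?\<psi> x - sq_norm2 ?d (\<lambda>j k. ?A j k \<bullet> N x)))"
      unfolding Q d\<psi> sq by (simp add: algebra_simps)
    moreover have "0 \<le> sq_norm2 ?d ?A * ?\<psi> x - sq_norm2 ?d (\<lambda>j k. ?A j k \<bullet> N x)"
      using sq_norm2_inner_le[of ?d ?A "N x"] by simp
    ultimately show ?thesis
      using sum_inner_mult_inner_nonneg[of ?d ?w] area_pos[OF nd] by simp
  qed
  then have "0 \<le> integral K (\<lambda>x. ?Q x + ?L x)"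
    by (intro Henstock_Kurzweil_Integration.integral_nonneg integrable_add IQ IL)
  also have "\<dots> = integral K ?Q"
    using weak_log_area_equation[OF K \<psi>]
    by (simp add: Henstock_Kurzweil_Integration.integral_add[OF IQ IL])
  finally show ?thesis .
qed

text \<open>By the first variation formula the acceleration of the variation does not contribute, so the
  second derivative of the volume is the second variation form of the normal part of the
  velocity.\<close>

lemma stable: "stable_immersion D X"
  unfolding stable_immersion_def
proof (intro allI impI)
  fix K F assume "variation D X K F"
  then obtain \<epsilon> F' F'' where K: "compact K" "K \<subseteq> D" and F0: "\<forall>x\<in>D. F 0 x = X x" and \<epsilon>: "0 < \<epsilon>"
    and fixed: "\<forall>t\<in>{-\<epsilon><..<\<epsilon>}. \<forall>x\<in>D - K. F t x = X x"
    and dF: "\<forall>t\<in>{-\<epsilon><..<\<epsilon>}. \<forall>x\<in>D.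
        ((\<lambda>s. F s x) has_vector_derivative F' t x) (at t) \<and>
        ((\<lambda>s. F' s x) has_vector_derivative F'' t x) (at t)"
    and C: "C1_family {-\<epsilon><..<\<epsilon>} D F" "C1_family {-\<epsilon><..<\<epsilon>} D F'" "C1_family {-\<epsilon><..<\<epsilon>} D F''"
    unfolding variation_def by (elim exE conjE) (rule that)
  have frame0: "frame (F 0) x = frame X x" if "x \<in> D" for x
    using partial_deriv_cong[OF open_D that, of "F 0" X] F0 by (simp add: frame_def fun_eq_iff)
  have C1: "C1_on D (F' 0)" "C1_on D (F'' 0)"
  proof -
    have "C1_on D (G 0)" if "C1_family {-\<epsilon><..<\<epsilon>} D G" for G :: "real \<Rightarrow> real ^ 'n \<Rightarrow> 'e"
      unfolding C1_on_def
    proof (intro conjI ballI allI)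
      fix x assume "x \<in> D" then show "G 0 differentiable (at x)"
        using that \<epsilon> by (simp add: C1_family_def)
    next
      fix i
      have "continuous_on ({-\<epsilon><..<\<epsilon>} \<times> D) (\<lambda>(t, x). partial_deriv i (G t) x)"
        using that by (simp add: C1_family_def)
      moreover have "Pair 0 ` D \<subseteq> {-\<epsilon><..<\<epsilon>} \<times> D" using \<epsilon> by auto
      ultimately show "continuous_on D (partial_deriv i (G 0))"
        using continuous_on_compose2[OF _ continuous_on_Pair[OF continuous_on_const continuous_on_id, of D 0],
            of "{-\<epsilon><..<\<epsilon>} \<times> D" "\<lambda>(t, x). partial_deriv i (G t) x"]
        by simp
    qed
    then show "C1_on D (F' 0)" "C1_on D (F'' 0)" using C by auto
  qed
  have F'_0: "F' t x = 0" if "t \<in> {-\<epsilon><..<\<epsilon>}" "x \<in> D - K" for t x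
  proof (rule vector_derivative_unique_at)
    show "((\<lambda>s. F s x) has_vector_derivative F' t x) (at t)" using dF that by blast
    have "((\<lambda>_. X x) has_vector_derivative 0) (at t)" by (rule has_vector_derivative_const)
    then show "((\<lambda>s. F s x) has_vector_derivative 0) (at t)"
      by (rule has_vector_derivative_transform_within_open[where S = "{-\<epsilon><..<\<epsilon>}"])
        (use fixed that in auto)
  qed
  have F''_0: "F'' 0 x = 0" if "x \<in> D - K" for x
  proof (rule vector_derivative_unique_at)
    show "((\<lambda>s. F' s x) has_vector_derivative F'' 0 x) (at 0)" using dF that \<epsilon> by auto
    have "((\<lambda>_. 0) has_vector_derivative 0) (at 0)" by (rule has_vector_derivative_const)
    then show "((\<lambda>s. F' s x) has_vector_derivative 0) (at 0)"
      by (rule has_vector_derivative_transform_within_open[where S = "{-\<epsilon><..<\<epsilon>}"])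
        (use F'_0 that \<epsilon> in auto)
  qed
  let ?c = "integral K (\<lambda>x. \<Sum>j\<in>UNIV.
      area_hess (frame (F 0) x) (frame (F' 0) x) j \<bullet> frame (F' 0) x j
      + area_grad (frame (F 0) x) j \<bullet> frame (F'' 0) x j)"
  have A': "\<exists>A'. (\<forall>\<^sub>F t in nhds 0. ((\<lambda>t. volume K (F t)) has_real_derivative A' t) (at t)) \<and>
      (A' has_real_derivative ?c) (at 0)"
  proof (rule second_variation[OF open_D K \<epsilon> _ _ C])
    fix x assume "x \<in> K"
    then have "x \<in> D" using K(2) by blast
    then show "0 < det (gram (frame (F 0) x))" by (simp add: frame0 nondeg)
  qed (use dF in blast)+
  let ?V = "F' 0"
  let ?N = "\<lambda>x. nproj (frame X x) (?V x)"
  have V: "C1_on D ?V" "\<forall>x\<in>D - K. ?V x = 0" and W: "C1_on D (F'' 0)" "\<forall>x\<in>D - K. F'' 0 x = 0"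
    using C1 F'_0 F''_0 \<epsilon> by auto
  have IQ: "(\<lambda>x. \<Sum>j\<in>UNIV. area_hess (frame X x) (frame ?V x) j \<bullet> frame ?V x j) integrable_on K"
    using C1_on_continuous_partial[OF V(1)]
    by (intro integrable_K[OF K] continuous_on_sum continuous_on_inner continuous_on_area_hess
        continuous_on_frame nondeg) (auto simp: frame_def[of ?V])
  have IW: "(\<lambda>x. \<Sum>j\<in>UNIV. area_grad (frame X x) j \<bullet> partial_deriv j (F'' 0) x) integrable_on K"
    by (intro integrable_K[OF K] continuous_on_sum continuous_on_inner
        C1_on_continuous[OF C1_area_grad] C1_on_continuous_partial[OF W(1)])
  have "?c = integral K (\<lambda>x. (\<Sum>j\<in>UNIV. area_hess (frame X x) (frame ?V x) j \<bullet> frame ?V x j)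
      + (\<Sum>j\<in>UNIV. area_grad (frame X x) j \<bullet> partial_deriv j (F'' 0) x))"
    by (rule integral_cong_K[OF K]) (simp add: frame0 sum.distrib frame_def[of "F'' 0"])
  also have "\<dots> = integral K (\<lambda>x. \<Sum>j\<in>UNIV. area_hess (frame X x) (frame ?V x) j \<bullet> frame ?V x j)"
    using first_variation[OF K W] by (simp add: Henstock_Kurzweil_Integration.integral_add[OF IQ IW])
  also have "\<dots> = integral K (\<lambda>x. \<Sum>j\<in>UNIV. area_hess (frame X x) (frame ?N x) j \<bullet> frame ?N x j)"
    by (rule second_variation_normal_part[OF K V])
  also have "\<dots> \<ge> 0"
    by (rule second_variation_normal_nonneg[OF K C1_normal_part[OF K V]])
      (use V(2) in \<open>auto simp: nproj_zero nproj_inner_frame nondeg\<close>)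
  finally show "nonneg_second_derivative_at_0 (\<lambda>t. volume K (F t))"
    unfolding nonneg_second_derivative_at_0_def using A' by blast
qed

end

section \<open>Graphs\<close>

lemma C1_on_bounded_linear:
  assumes L: "bounded_linear L" and u: "C1_on D u"
  shows "C1_on D (\<lambda>x. L (u x))" and "x \<in> D \<Longrightarrow> partial_deriv i (\<lambda>x. L (u x)) x = L (partial_deriv i u x)"
proof -
  note d = bounded_linear.has_derivative[OF L C1_on_has_derivative[OF u]]
  show "C1_on D (\<lambda>x. L (u x))"
  proof (rule C1_onI[OF d])
    fix i
    show "continuous_on D (\<lambda>x. L (frechet_derivative u (at x) (axis i 1)))"
      using bounded_linear.continuous_on[OF L C1_on_continuous_partial[OF u, of i]]
      by (simp add: partial_deriv_def)
  qed
  show "partial_deriv i (\<lambda>x. L (u x)) x = L (partial_deriv i u x)" if "x \<in> D"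
    using partial_deriv_eq[OF d[OF that]] by (simp add: partial_deriv_def)
qed

lemma C1_on_Pair:
  assumes u: "C1_on D u" and v: "C1_on D v"
  shows "C1_on D (\<lambda>x. (u x, v x))"
    and "x \<in> D \<Longrightarrow> partial_deriv i (\<lambda>x. (u x, v x)) x = (partial_deriv i u x, partial_deriv i v x)"
proof -
  note d = has_derivative_Pair[OF C1_on_has_derivative[OF u] C1_on_has_derivative[OF v]]
  show "C1_on D (\<lambda>x. (u x, v x))"
  proof (rule C1_onI[OF d])
    fix i
    show "continuous_on D (\<lambda>x. (frechet_derivative u (at x) (axis i 1), frechet_derivative v (at x) (axis i 1)))"
      using continuous_on_Pair[OF C1_on_continuous_partial[OF u, of i] C1_on_continuous_partial[OF v, of i]]
      by (simp add: partial_deriv_def)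
  qed
  show "partial_deriv i (\<lambda>x. (u x, v x)) x = (partial_deriv i u x, partial_deriv i v x)" if "x \<in> D"
    using partial_deriv_eq[OF d[OF that that]] by (simp add: partial_deriv_def)
qed

lemma frechet_derivative_eq_sum:
  assumes "u differentiable (at x)"
  shows "frechet_derivative u (at x) w = (\<Sum>k\<in>UNIV. w $ k *\<^sub>R partial_deriv k u x)"
proof -
  interpret linear "frechet_derivative u (at x)"
    by (rule linear_frechet_derivative[OF assms])
  have "frechet_derivative u (at x) (\<Sum>k\<in>UNIV. w $ k *\<^sub>R axis k 1)
      = (\<Sum>k\<in>UNIV. w $ k *\<^sub>R partial_deriv k u x)"
    by (simp add: sum scale partial_deriv_def)
  then show ?thesis
    by (metis (no_types, lifting) basis_expansion scalar_mult_eq_scaleR sum.cong)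
qed

lemma det_gram_pos:
  fixes P :: "'n::finite \<Rightarrow> 'e::euclidean_space"
  assumes "\<And>v :: real ^ 'n. v \<noteq> 0 \<Longrightarrow> (\<Sum>i\<in>UNIV. v $ i *\<^sub>R P i) \<noteq> 0"
  shows "0 < det (gram P)"
proof (rule det_pos_if_positive_definite)
  fix v :: "real ^ 'n" assume "v \<noteq> 0"
  let ?w = "\<Sum>i\<in>UNIV. v $ i *\<^sub>R P i"
  have "v \<bullet> (gram P *v v) = ?w \<bullet> ?w"
    by (simp add: inner_vec_def gram_def matrix_vector_mult_def inner_sum_left inner_sum_right
        sum_distrib_left mult_ac inner_commute[of "P _" "P _"])
  then show "0 < v \<bullet> (gram P *v v)" using assms[OF \<open>v \<noteq> 0\<close>] by simp
qed

text \<open>If \<open>M\<close> is the coefficient matrix of an orthonormal basis with respect to a basis with Gram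
  matrix \<open>G\<close>, then congruence by \<open>M\<close> is injective, and \<open>M\<close> determines the inverse of \<open>G\<close>.\<close>

lemma orthonormal_coefficients:
  fixes M G A B :: "real ^ 'n ^ 'n"
  assumes M: "M ** G ** transpose M = mat 1"
  shows "transpose M ** M ** G = mat 1"
    and "M ** A ** transpose M = M ** B ** transpose M \<Longrightarrow> A = B"
proof -
  have 1: "transpose M ** (M ** G) = mat 1"
    using M by (simp add: matrix_left_right_inverse)
  have 2: "(G ** transpose M) ** M = mat 1"
    using M by (simp add: matrix_mul_assoc matrix_left_right_inverse[of "G ** transpose M"])
  show "transpose M ** M ** G = mat 1" using 1 by (simp add: matrix_mul_assoc)
  assume AB: "M ** A ** transpose M = M ** B ** transpose M"
  have *: "C = (G ** transpose M) ** (M ** C ** transpose M) ** (M ** G)" for C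
  proof -
    have "(G ** transpose M) ** (M ** C ** transpose M) ** (M ** G)
        = ((G ** transpose M) ** M) ** C ** (transpose M ** (M ** G))"
      by (simp only: matrix_mul_assoc)
    then show ?thesis by (simp only: 1 2 matrix_mul_lid matrix_mul_rid)
  qed
  show "A = B" using AB *[of A] *[of B] by simp
qed

context
  fixes D :: "(real ^ 'n) set" and f :: "real ^ 'n \<Rightarrow> real ^ 'm"
  assumes D: "open D" and f: "C2_on D f"
begin

lemma frame_graph: "x \<in> D \<Longrightarrow> frame (graph_map f) x i = (axis i 1, partial_deriv i f x)"
  and C1_graph: "C1_on D (graph_map f)"
  and graph_hess: "x \<in> D \<Longrightarrow> partial_deriv k (\<lambda>x. frame (graph_map f) x i) x
    = (0, partial_deriv k (partial_deriv i f) x)"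
  and C2_graph: "C2_on D (graph_map f)"
proof -
  have id: "C1_on D (\<lambda>x. x)" by (rule C1_onI[OF has_derivative_ident]) simp
  have "partial_deriv i (\<lambda>x. x) x = axis i 1" for x :: "real ^ 'n" and i
    by (rule partial_deriv_eq[OF has_derivative_ident])
  note pair = C1_on_Pair[OF id C2_on_imp_C1_on[OF f], unfolded graph_map_def[symmetric] this]
  have g: "graph_map f = (\<lambda>x. graph_map f x)" by simp
  show frame: "frame (graph_map f) x i = (axis i 1, partial_deriv i f x)" if "x \<in> D" for x i
    using pair(2)[OF that] by (simp add: frame_def)
  show 1: "C1_on D (graph_map f)" using pair(1) by simp
  note pair' = C1_on_Pair[OF C1_on_const C2_on_partial[OF f]]
  have "C1_on D (partial_deriv i (graph_map f))" for i
    by (rule C1_on_cong[OF D _ pair'(1)[of "axis i 1" i]]) (simp add: frame[symmetric] frame_def)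
  with 1 show "C2_on D (graph_map f)" by (simp add: C2_on_def)
  show "partial_deriv k (\<lambda>x. frame (graph_map f) x i) x = (0, partial_deriv k (partial_deriv i f) x)"
    if "x \<in> D"
    using partial_deriv_cong[OF D that, of "\<lambda>x. frame (graph_map f) x i" "\<lambda>x. (axis i 1, partial_deriv i f x)" k]
      pair'(2)[OF that, of k "axis i 1" i] by (simp add: frame partial_deriv_const)
qed

lemma fst_sum_frame_graph:
  assumes "x \<in> D"
  shows "fst (\<Sum>i\<in>UNIV. c i *\<^sub>R frame (graph_map f) x i) = (\<chi> i. c i)"
proof -
  have "fst (\<Sum>i\<in>UNIV. c i *\<^sub>R frame (graph_map f) x i) = (\<Sum>i\<in>UNIV. c i *\<^sub>R axis i 1)"
    by (simp add: fst_sum frame_graph[OF assms])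
  also have "\<dots> = (\<Sum>i\<in>UNIV. (\<chi> i. c i) $ i *s axis i 1)"
    by (simp add: scalar_mult_eq_scaleR)
  finally show ?thesis by (simp only: basis_expansion)
qed

lemma det_gram_graph_pos:
  assumes "x \<in> D"
  shows "0 < det (gram (frame (graph_map f) x))"
proof (rule det_gram_pos)
  fix v :: "real ^ 'n" assume "v \<noteq> 0"
  then show "(\<Sum>i\<in>UNIV. v $ i *\<^sub>R frame (graph_map f) x i) \<noteq> 0"
    using fst_sum_frame_graph[OF assms, of "\<lambda>i. v $ i"] by auto
qed

lemma metric_eq_gram: "x \<in> D \<Longrightarrow> metric f x = gram (frame (graph_map f) x)"
proof -
  assume x: "x \<in> D"
  have "partial_deriv i (\<lambda>y. f y $ \<beta>) x = partial_deriv i f x $ \<beta>" for i \<beta>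
    by (rule C1_on_bounded_linear(2)[OF bounded_linear_vec_nth C2_on_imp_C1_on[OF f] x])
  then show "metric f x = gram (frame (graph_map f) x)"
    by (simp add: metric_def gram_def vec_eq_iff frame_graph[OF x] inner_axis_axis inner_vec_def[of "partial_deriv _ _ _"])
qed

interpretation immersion D "graph_map f"
  by unfold_locales (auto intro: D C2_graph det_gram_graph_pos)

lemma hess_graph: "x \<in> D \<Longrightarrow> hess x k i = (0, partial_deriv k (partial_deriv i f) x)"
  unfolding hess_def by (rule graph_hess)

lemma normal_eq_0:
  assumes "x \<in> D" "\<And>i. n \<bullet> frame (graph_map f) x i = 0" "snd n = 0"
  shows "n = 0"
proof -
  have "fst n $ i = 0" for i
    using assms(2)[of i] assms(3) by (cases n) (simp add: frame_graph[OF assms(1)] inner_axis)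
  then show ?thesis using assms(3) by (simp add: prod_eq_iff vec_eq_iff)
qed

text \<open>The minimal surface system is the vertical part of the Euler--Lagrange equation. The full
  equation follows, because its left-hand side is normal and vertical parts of normal vectors
  determine them. Moreover the vertical vector \<open>\<Sum> g\<^sup>i\<^sup>j \<partial>\<^sub>i\<partial>\<^sub>j X\<close> has no normal part, so it is
  zero.\<close>

lemma
  assumes min: "minimal_surface_system D f" and x: "x \<in> D"
  shows graph_stationary: "(\<Sum>i\<in>UNIV. partial_deriv i (\<lambda>y. area_grad (frame (graph_map f) y) i) x) = 0"
    and graph_harmonic: "(\<Sum>i\<in>UNIV. \<Sum>j\<in>UNIV.
      (dual (frame (graph_map f) x) i \<bullet> dual (frame (graph_map f) x) j) *\<^sub>R hess x i j) = 0"
proof -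
  let ?F = "frame (graph_map f)"
  let ?H = "\<Sum>i\<in>UNIV. \<Sum>j\<in>UNIV. (dual (?F x) i \<bullet> dual (?F x) j) *\<^sub>R hess x i j"
  let ?S = "\<Sum>i\<in>UNIV. partial_deriv i (\<lambda>y. area_grad (?F y) i) x"
  have vertical: "bounded_linear (\<lambda>v :: (real ^ 'n) \<times> (real ^ 'm). snd v $ \<alpha>)" for \<alpha>
    using bounded_linear_compose[OF bounded_linear_vec_nth bounded_linear_snd] .
  have "snd ?S $ \<alpha> = 0" for \<alpha>
  proof -
    let ?t = "\<lambda>i j y. sqrt (det (metric f y)) * matrix_inv (metric f y) $ i $ j
        * partial_deriv j (\<lambda>z. f z $ \<alpha>) y"
    \<comment> \<open>The same terms in a form that is visibly \<open>C1\<close>: the factor \<open>area_grad i \<bullet> ?F i\<close> is the area.\<close>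
    let ?u = "\<lambda>i j y. (dual (?F y) i \<bullet> dual (?F y) j)
        * (area_grad (?F y) i \<bullet> ?F y i) * snd (?F y j) $ \<alpha>"
    have F\<alpha>: "snd (?F y j) $ \<alpha> = partial_deriv j (\<lambda>z. f z $ \<alpha>) y" if "y \<in> D" for y j
      using C1_on_bounded_linear(2)[OF bounded_linear_vec_nth C2_on_imp_C1_on[OF f] that]
      by (simp add: frame_graph[OF that])
    have tu: "?u i j y = ?t i j y" if y: "y \<in> D" for i j y
      using nondeg[OF y]
      by (simp add: F\<alpha>[OF y, symmetric] metric_eq_gram[OF y] area_def[symmetric] inner_dual_dual
          area_grad_def inner_dual_frame)
    have u: "C1_on D (?u i j)" for i j
      by (intro C1_on_mult C1_on_inner C1_dual C1_area_grad C1_frame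
          C1_on_bounded_linear(1)[OF vertical])
    have "partial_deriv i (\<lambda>y. snd (area_grad (?F y) i) $ \<alpha>) x
        = (\<Sum>j\<in>UNIV. partial_deriv i (?t i j) x)" for i
    proof -
      have "snd (area_grad (?F y) i) $ \<alpha> = (\<Sum>j\<in>UNIV. ?u i j y)" if y: "y \<in> D" for y
      proof -
        have "snd (dual (?F y) i) $ \<alpha> = (\<Sum>j\<in>UNIV. (dual (?F y) i \<bullet> dual (?F y) j) * snd (?F y j) $ \<alpha>)"
          using arg_cong[OF dual_expand[OF nondeg[OF y]], of "\<lambda>v. snd v $ \<alpha>" i]
          by (simp add: snd_sum)
        then show ?thesis
          by (simp add: area_grad_def inner_dual_frame[OF nondeg[OF y]] sum_distrib_left mult_ac)
      qed
      then have "partial_deriv i (\<lambda>y. snd (area_grad (?F y) i) $ \<alpha>) x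
          = partial_deriv i (\<lambda>y. \<Sum>j\<in>UNIV. ?u i j y) x"
        by (rule partial_deriv_cong[OF D x])
      also have "\<dots> = (\<Sum>j\<in>UNIV. partial_deriv i (?u i j) x)"
        by (rule partial_deriv_sum[OF u x])
      also have "\<dots> = (\<Sum>j\<in>UNIV. partial_deriv i (?t i j) x)"
        by (intro sum.cong refl partial_deriv_cong[OF D x] tu)
      finally show ?thesis .
    qed
    then have "(\<Sum>i\<in>UNIV. partial_deriv i (\<lambda>y. snd (area_grad (?F y) i) $ \<alpha>) x) = 0"
      using min x by (simp add: minimal_surface_system_def)
    then show ?thesis
      by (simp add: C1_on_bounded_linear(2)[OF vertical C1_area_grad x] snd_sum)
  qed
  then have "snd ?S = 0" by (simp add: vec_eq_iff)
  moreover have S: "?S = area (?F x) *\<^sub>R nproj (?F x) ?H"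
    by (rule sum_partial_area_grad[OF x])
  moreover have "?S \<bullet> ?F x i = 0" for i
    unfolding S by (simp add: nproj_inner_frame[OF nondeg[OF x]])
  ultimately show S0: "?S = 0"
    using normal_eq_0[OF x] by blast
  then have "nproj (?F x) ?H = 0"
    using S area_pos[OF nondeg[OF x]] by simp
  then have H: "?H = (\<Sum>k\<in>UNIV. (dual (?F x) k \<bullet> ?H) *\<^sub>R ?F x k)"
    by (simp add: nproj_def)
  have "fst ?H = 0"
    by (simp add: fst_sum hess_graph[OF x])
  then have "dual (?F x) k \<bullet> ?H = 0" for k
    using arg_cong[OF H, of fst] unfolding fst_sum_frame_graph[OF x] by (simp add: vec_eq_iff)
  then show "?H = 0" using H by simp
qed

text \<open>In an orthonormal frame the second fundamental form of the normal \<open>\<nu> \<alpha>\<close> is congruent to the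
  matrix \<open>S\<close> of second derivatives of \<open>X\<close> in the direction \<open>\<nu> \<alpha>\<close>, so flatness says that the
  matrices \<open>S g\<inverse> T\<close> are symmetric in the two normals. As the vertical parts of the normals span,
  the same symmetry holds for the second derivatives in any two directions.\<close>

lemma flat_normal_bundle_hess:
  assumes flat: "flat_normal_bundle D f" and x: "x \<in> D"
  shows "(\<Sum>a\<in>UNIV. \<Sum>b\<in>UNIV. (dual (frame (graph_map f) x) a \<bullet> dual (frame (graph_map f) x) b) *
      ((p \<bullet> hess x j a) * (q \<bullet> hess x b l)))
    = (\<Sum>a\<in>UNIV. \<Sum>b\<in>UNIV. (dual (frame (graph_map f) x) a \<bullet> dual (frame (graph_map f) x) b) *
      ((q \<bullet> hess x j a) * (p \<bullet> hess x b l)))"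
proof -
  let ?F = "frame (graph_map f)"
  let ?G = "gram (?F x)"
  obtain U e \<nu> where U: "open U" "x \<in> U" "U \<subseteq> D" and fr: "orthonormal_frame U f e \<nu>"
    and R: "\<forall>x\<in>U. \<forall>\<alpha> \<beta> i j. normal_curvature e \<nu> x \<alpha> \<beta> i j = 0"
    using flat[unfolded flat_normal_bundle_def, rule_format, OF x] by (elim exE conjE) (rule that)
  have \<nu>C1: "C1_on U (\<nu> \<alpha>)" and e_tan: "e i x \<in> tangent_space f x"
    and e_orth: "e i x \<bullet> e j x = (if i = j then 1 else 0)"
    and \<nu>_nor: "y \<in> U \<Longrightarrow> \<nu> \<alpha> y \<in> normal_space f y"
    and \<nu>_orth: "\<nu> \<alpha> x \<bullet> \<nu> \<beta> x = (if \<alpha> = \<beta> then 1 else 0)" for i j \<alpha> \<beta> y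
    using fr U(2) by (auto simp: orthonormal_frame_def)
  have gd: "graph_map f differentiable (at y)" if "y \<in> D" for y
    using C1_graph that by (simp add: C1_on_def)
  have \<nu>_frame: "\<nu> \<alpha> y \<bullet> ?F y k = 0" if y: "y \<in> U" for \<alpha> y k
  proof -
    have "?F y k \<in> tangent_space f y"
      by (simp add: tangent_space_def frame_def partial_deriv_def)
    then show ?thesis using \<nu>_nor[OF y] by (auto simp: normal_space_def)
  qed
  define \<epsilon> where "\<epsilon> i = fst (e i x)" for i
  have e_eq: "e i x = (\<Sum>k\<in>UNIV. \<epsilon> i $ k *\<^sub>R ?F x k)" for i
  proof -
    obtain w where w: "e i x = (\<Sum>k\<in>UNIV. w $ k *\<^sub>R ?F x k)"
      using e_tan[of i] frechet_derivative_eq_sum[OF gd[OF x]]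
      by (auto simp: tangent_space_def frame_def)
    then have "\<epsilon> i = w" by (simp add: \<epsilon>_def fst_sum_frame_graph[OF x])
    with w show ?thesis by simp
  qed
  define M :: "real ^ 'n ^ 'n" where "M = (\<chi> i k. \<epsilon> i $ k)"
  define S :: "'m \<Rightarrow> real ^ 'n ^ 'n" where "S \<alpha> = (\<chi> k l. \<nu> \<alpha> x \<bullet> hess x k l)" for \<alpha>
  define h :: "'m \<Rightarrow> real ^ 'n ^ 'n" where "h \<alpha> = (\<chi> i j. second_fundamental e \<nu> x \<alpha> i j)" for \<alpha>
  have MGM: "M ** ?G ** transpose M = mat 1"
  proof -
    have "(M ** ?G ** transpose M) $ i $ j = e i x \<bullet> e j x" for i j
      unfolding e_eq
      by (simp add: matrix_matrix_mult_def M_def gram_def transpose_def inner_sum_left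
          inner_sum_right sum_distrib_left sum_distrib_right mult_ac)
    then show ?thesis by (simp add: vec_eq_iff e_orth mat_def)
  qed
  have MM: "transpose M ** M = matrix_inv ?G"
  proof -
    have "transpose M ** M = transpose M ** M ** (?G ** matrix_inv ?G)"
      using matrix_inv_mult[of ?G] nondeg[OF x] by simp
    also have "\<dots> = matrix_inv ?G"
      using orthonormal_coefficients(1)[OF MGM] by (simp add: matrix_mul_assoc)
    finally show ?thesis .
  qed
  have d\<nu>: "partial_deriv k (\<nu> \<alpha>) x \<bullet> ?F x l = - (\<nu> \<alpha> x \<bullet> hess x k l)" for k l \<alpha>
  proof -
    have "partial_deriv k (\<lambda>y. \<nu> \<alpha> y \<bullet> ?F y l) x = 0"
      by (rule partial_deriv_eq_0[OF U(1,2) \<nu>_frame])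
    then show ?thesis
      by (simp add: partial_deriv_inner[OF \<nu>C1 C1_on_subset[OF C1_frame U(3)] U(2)] hess_def
          eq_neg_iff_add_eq_0 add.commute)
  qed
  have h: "h \<alpha> = - (M ** S \<alpha> ** transpose M)" for \<alpha>
  proof -
    have "\<nu> \<alpha> differentiable (at x)" using \<nu>C1 U(2) by (auto simp: C1_on_def)
    then have "nabla (\<nu> \<alpha>) x (e i x) = (\<Sum>k\<in>UNIV. \<epsilon> i $ k *\<^sub>R partial_deriv k (\<nu> \<alpha>) x)" for i
      by (simp add: nabla_def \<epsilon>_def frechet_derivative_eq_sum)
    then have "h \<alpha> $ i $ j = - (M ** S \<alpha> ** transpose M) $ i $ j" for i j
      by (simp add: h_def second_fundamental_def e_eq[of j] inner_sum_left inner_sum_right d\<nu>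
          sum_negf matrix_matrix_mult_def M_def S_def transpose_def sum_distrib_left
          sum_distrib_right mult_ac) (rule sum.swap)
    then show ?thesis by (simp add: vec_eq_iff)
  qed
  have S_sym: "transpose (S \<alpha>) = S \<alpha>" for \<alpha>
    by (simp add: S_def transpose_def vec_eq_iff hess_commute[OF x])
  have flatS: "S \<alpha> ** matrix_inv ?G ** S \<beta> = S \<beta> ** matrix_inv ?G ** S \<alpha>" for \<alpha> \<beta>
  proof (rule orthonormal_coefficients(2)[OF MGM])
    have hh: "h \<alpha> ** transpose (h \<beta>) = M ** (S \<alpha> ** matrix_inv ?G ** S \<beta>) ** transpose M" for \<alpha> \<beta>
    proof -
      have "h \<alpha> ** transpose (h \<beta>) = (M ** S \<alpha> ** transpose M) ** transpose (M ** S \<beta> ** transpose M)"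
        by (simp add: h vec_eq_iff matrix_matrix_mult_def transpose_def)
      also have "\<dots> = M ** (S \<alpha> ** (transpose M ** M) ** S \<beta>) ** transpose M"
        by (simp add: matrix_transpose_mul S_sym matrix_mul_assoc)
      finally show ?thesis by (simp only: MM)
    qed
    have "(h \<alpha> ** transpose (h \<beta>)) $ i $ j = (h \<beta> ** transpose (h \<alpha>)) $ i $ j" for i j
      using R[rule_format, OF U(2), of \<alpha> \<beta> i j]
      by (simp add: normal_curvature_def Let_def h_def matrix_matrix_mult_def transpose_def
          sum_subtractf mult.commute)
    then show "M ** (S \<alpha> ** matrix_inv ?G ** S \<beta>) ** transpose M
        = M ** (S \<beta> ** matrix_inv ?G ** S \<alpha>) ** transpose M"
      unfolding hh[symmetric] by (simp add: vec_eq_iff)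
  qed
  let ?T = "\<lambda>p q j l. \<Sum>a\<in>UNIV. \<Sum>b\<in>UNIV. (dual (?F x) a \<bullet> dual (?F x) b) * ((p \<bullet> hess x j a)
      * (q \<bullet> hess x b l))"
  have T\<nu>: "?T (\<nu> \<alpha> x) (\<nu> \<beta> x) j l = ?T (\<nu> \<beta> x) (\<nu> \<alpha> x) j l" for \<alpha> \<beta>
  proof -
    have "?T (\<nu> \<alpha> x) (\<nu> \<beta> x) j l = (S \<alpha> ** matrix_inv ?G ** S \<beta>) $ j $ l" for \<alpha> \<beta>
      by (subst sum.swap) (simp add: matrix_matrix_mult_def S_def inner_dual_dual[OF nondeg[OF x]]
          sum_distrib_left sum_distrib_right mult_ac)
    then show ?thesis by (simp only: flatS[of \<alpha> \<beta>])
  qed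
  have span: "\<exists>c. \<forall>k l. p \<bullet> hess x k l = (\<Sum>\<alpha>\<in>UNIV. c \<alpha> * (\<nu> \<alpha> x \<bullet> hess x k l))" for p
  proof -
    let ?B = "\<lambda>c :: real ^ 'm. \<Sum>\<alpha>\<in>UNIV. c $ \<alpha> *\<^sub>R snd (\<nu> \<alpha> x)"
    have lin: "linear ?B"
      by (intro linearI) (simp_all add: scaleR_add_left sum.distrib scaleR_sum_right)
    have "inj ?B"
    proof (rule linear_injective_0[OF lin, THEN iffD2], intro allI impI)
      fix c assume c: "?B c = 0"
      let ?n = "\<Sum>\<alpha>\<in>UNIV. c $ \<alpha> *\<^sub>R \<nu> \<alpha> x"
      have "?n = 0"
        by (rule normal_eq_0[OF x]) (use c in \<open>simp_all add: inner_sum_left \<nu>_frame[OF U(2)] snd_sum\<close>)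
      then have "?n \<bullet> \<nu> \<beta> x = 0" for \<beta> by simp
      moreover have "?n \<bullet> \<nu> \<beta> x = c $ \<beta>" for \<beta>
      proof -
        have "?n \<bullet> \<nu> \<beta> x = (\<Sum>\<alpha>\<in>UNIV. if \<alpha> = \<beta> then c $ \<alpha> else 0)"
          unfolding inner_sum_left by (intro sum.cong) (auto simp: \<nu>_orth)
        then show ?thesis by simp
      qed
      ultimately show "c = 0" by (simp add: vec_eq_iff)
    qed
    from surjD[OF linear_inj_imp_surj[OF lin this], of "snd p"]
    obtain c where c: "snd p = ?B c" by (elim exE)
    have "v \<bullet> hess x k l = snd v \<bullet> partial_deriv k (partial_deriv l f) x" for v k l
      by (cases v) (simp add: hess_graph[OF x])
    then show ?thesis
      by (intro exI[of _ "\<lambda>\<alpha>. c $ \<alpha>"]) (simp add: c inner_sum_left)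
  qed
  from span[of p] obtain c where
    "\<forall>k l. p \<bullet> hess x k l = (\<Sum>\<alpha>\<in>UNIV. c \<alpha> * (\<nu> \<alpha> x \<bullet> hess x k l))" by (elim exE)
  note c = this[rule_format]
  from span[of q] obtain c' where
    "\<forall>k l. q \<bullet> hess x k l = (\<Sum>\<alpha>\<in>UNIV. c' \<alpha> * (\<nu> \<alpha> x \<bullet> hess x k l))" by (elim exE)
  note c' = this[rule_format]
  have expand: "?T u v j l = (\<Sum>\<alpha>\<in>UNIV. \<Sum>\<beta>\<in>UNIV. (r \<alpha> * s \<beta>) * ?T (\<nu> \<alpha> x) (\<nu> \<beta> x) j l)"
    if "\<And>k l. u \<bullet> hess x k l = (\<Sum>\<alpha>\<in>UNIV. r \<alpha> * (\<nu> \<alpha> x \<bullet> hess x k l))"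
      "\<And>k l. v \<bullet> hess x k l = (\<Sum>\<alpha>\<in>UNIV. s \<alpha> * (\<nu> \<alpha> x \<bullet> hess x k l))" for u v r s
  proof -
    let ?k = "\<lambda>\<alpha> \<beta> a b. (r \<alpha> * s \<beta>) * ((dual (?F x) a \<bullet> dual (?F x) b) * ((\<nu> \<alpha> x \<bullet> hess x j a)
        * (\<nu> \<beta> x \<bullet> hess x b l)))"
    have "?T u v j l = (\<Sum>a\<in>UNIV. \<Sum>b\<in>UNIV. \<Sum>\<alpha>\<in>UNIV. \<Sum>\<beta>\<in>UNIV. ?k \<alpha> \<beta> a b)"
      unfolding that sum_product by (simp add: sum_distrib_left mult_ac)
    also have "\<dots> = (\<Sum>a\<in>UNIV. \<Sum>\<alpha>\<in>UNIV. \<Sum>b\<in>UNIV. \<Sum>\<beta>\<in>UNIV. ?k \<alpha> \<beta> a b)"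
      by (intro sum.cong refl sum.swap)
    also have "\<dots> = (\<Sum>\<alpha>\<in>UNIV. \<Sum>a\<in>UNIV. \<Sum>b\<in>UNIV. \<Sum>\<beta>\<in>UNIV. ?k \<alpha> \<beta> a b)"
      by (rule sum.swap)
    also have "\<dots> = (\<Sum>\<alpha>\<in>UNIV. \<Sum>a\<in>UNIV. \<Sum>\<beta>\<in>UNIV. \<Sum>b\<in>UNIV. ?k \<alpha> \<beta> a b)"
      by (intro sum.cong refl sum.swap)
    also have "\<dots> = (\<Sum>\<alpha>\<in>UNIV. \<Sum>\<beta>\<in>UNIV. \<Sum>a\<in>UNIV. \<Sum>b\<in>UNIV. ?k \<alpha> \<beta> a b)"
      by (intro sum.cong refl sum.swap)
    finally show ?thesis by (simp add: sum_distrib_left)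
  qed
  have "?T p q j l = (\<Sum>\<alpha>\<in>UNIV. \<Sum>\<beta>\<in>UNIV. (c \<alpha> * c' \<beta>) * ?T (\<nu> \<alpha> x) (\<nu> \<beta> x) j l)"
    by (rule expand[OF c c'])
  also have "\<dots> = (\<Sum>\<beta>\<in>UNIV. \<Sum>\<alpha>\<in>UNIV. (c \<alpha> * c' \<beta>) * ?T (\<nu> \<alpha> x) (\<nu> \<beta> x) j l)"
    by (rule sum.swap)
  also have "\<dots> = (\<Sum>\<beta>\<in>UNIV. \<Sum>\<alpha>\<in>UNIV. (c' \<beta> * c \<alpha>) * ?T (\<nu> \<beta> x) (\<nu> \<alpha> x) j l)"
    by (subst T\<nu>) (simp only: mult.commute)
  also have "\<dots> = ?T q p j l"
    by (rule expand[OF c' c, symmetric])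
  finally show ?thesis .
qed

lemma graph_stable:
  assumes min: "minimal_surface_system D f" and flat: "flat_normal_bundle D f"
  shows "stable_immersion D (graph_map f)"
proof -
  interpret log_area_immersion D "graph_map f"
  proof
    fix x assume x: "x \<in> D"
    let ?d = "dual (frame (graph_map f) x)"
    show "(\<Sum>j\<in>UNIV. partial_deriv j (\<lambda>y. area_grad (frame (graph_map f) y) j) x) = 0"
      by (rule graph_stationary[OF min x])
    show "(\<Sum>i\<in>UNIV. \<Sum>j\<in>UNIV. (?d i \<bullet> ?d j) *\<^sub>R hess x i j) = 0"
      by (rule graph_harmonic[OF min x])
    have "(\<Sum>a\<in>UNIV. \<Sum>b\<in>UNIV. (?d a \<bullet> ?d b) * ((?d l \<bullet> hess x a j) * (?d j \<bullet> hess x b l)))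
        = (\<Sum>a\<in>UNIV. \<Sum>b\<in>UNIV. (?d a \<bullet> ?d b) * ((?d j \<bullet> hess x a j) * (?d l \<bullet> hess x b l)))" for j l
      using flat_normal_bundle_hess[OF flat x, of "?d l" j "?d j" l]
      by (simp add: hess_commute[OF x, of j])
    then have "(\<Sum>j\<in>UNIV. \<Sum>l\<in>UNIV. \<Sum>a\<in>UNIV. \<Sum>b\<in>UNIV. (?d a \<bullet> ?d b) *
          ((?d l \<bullet> hess x a j) * (?d j \<bullet> hess x b l)))
        = (\<Sum>j\<in>UNIV. \<Sum>l\<in>UNIV. \<Sum>a\<in>UNIV. \<Sum>b\<in>UNIV. (?d a \<bullet> ?d b) *
          ((?d j \<bullet> hess x a j) * (?d l \<bullet> hess x b l)))"
      by simp
    also have "\<dots> = (\<Sum>j\<in>UNIV. \<Sum>a\<in>UNIV. \<Sum>l\<in>UNIV. \<Sum>b\<in>UNIV. (?d a \<bullet> ?d b) *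
          ((?d j \<bullet> hess x a j) * (?d l \<bullet> hess x b l)))"
      by (intro sum.cong refl sum.swap)
    also have "\<dots> = (\<Sum>a\<in>UNIV. \<Sum>j\<in>UNIV. \<Sum>l\<in>UNIV. \<Sum>b\<in>UNIV. (?d a \<bullet> ?d b) *
          ((?d j \<bullet> hess x a j) * (?d l \<bullet> hess x b l)))"
      by (rule sum.swap)
    also have "\<dots> = (\<Sum>a\<in>UNIV. \<Sum>j\<in>UNIV. \<Sum>b\<in>UNIV. \<Sum>l\<in>UNIV. (?d a \<bullet> ?d b) *
          ((?d j \<bullet> hess x a j) * (?d l \<bullet> hess x b l)))"
      by (intro sum.cong refl sum.swap)
    also have "\<dots> = (\<Sum>a\<in>UNIV. \<Sum>b\<in>UNIV. \<Sum>j\<in>UNIV. \<Sum>l\<in>UNIV. (?d a \<bullet> ?d b) *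
          ((?d j \<bullet> hess x a j) * (?d l \<bullet> hess x b l)))"
      by (intro sum.cong refl sum.swap)
    also have "\<dots> = (\<Sum>a\<in>UNIV. \<Sum>b\<in>UNIV. (?d a \<bullet> ?d b) * (dlog x a * dlog x b))"
      unfolding dlog_def sum_product by (simp add: sum_distrib_left)
    finally show "(\<Sum>j\<in>UNIV. \<Sum>l\<in>UNIV. \<Sum>a\<in>UNIV. \<Sum>b\<in>UNIV. (?d a \<bullet> ?d b) *
          ((?d l \<bullet> hess x a j) * (?d j \<bullet> hess x b l)))
        = (\<Sum>a\<in>UNIV. \<Sum>b\<in>UNIV. (?d a \<bullet> ?d b) * (dlog x a * dlog x b))" .
  qed
  show ?thesis by (rule stable)
qed

end

theorem theorem1p1:
  fixes D :: "(real ^ 'n) set" and f :: "real ^ 'n \<Rightarrow> real ^ 'm"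
  assumes "open D"
    and "C2_on D f"
    and "minimal_surface_system D f"
    and "flat_normal_bundle D f"
  shows "stable_immersion D (graph_map f)"
  using assms by (rule graph_stable)

end
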